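(* Let $A$ be an $l\times l$ square block of sites ($|A|=l^2$) in the $L\times L$ periodic lattice, with $L\to\infty$ (i.e. $L$ sufficiently large depending on $d,D,l$). Then for any physical dimension $d\ge2$ and bond dimension $D\ge3$, the purity of the reduced density matrix $\rho_A$ of the random tensor-network state satisfies, for a small constant $\epsilon>0$, $$\Pr\left[\left|\mathrm{Tr}(\rho_A^2)-d^{-|A|}\right|\ge\epsilon\right]\le O\left(\frac{D^{-4}}{\epsilon}\right),$$ where the implied constant is independent of $D$, $\epsilon$ and $L$.
   Context: Random tensor-network state: the sites are the elements $v=(x,y)$ of $\mathbb{Z}_L\times\mathbb{Z}_L$ (torus, coordinates modulo $L$). To each site attach an independent random unitary $U_v$ on $\mathbb{C}^D\otimes\mathbb{C}^D\otimes\mathbb{C}^d$, distributed according to Haar measure on $U(D^2d)$. Define the site tensor $A^{(v)}_{\alpha,\beta,\gamma,\lambda,j}=\langle\alpha,\beta,0|U_v|\gamma,\lambda,j\rangle$, where $\alpha,\beta,\gamma,\lambda\in\{1,\dots,D\}$ are bond indices, $j\in\{1,\dots,d\}$ is the physical index, and $|0\rangle$ is a fixed unit reference vector of $\mathbb{C}^d$. The index $\gamma$ of site $(x,y)$ is identified with the index $\alpha$ of site $(x,y+1)$, and the index $\lambda$ of site $(x,y)$ with the index $\beta$ of site $(x+1,y)$. The state $|\Psi\rangle\in(\mathbb{C}^d)^{\otimes L^2}$ is $|\Psi\rangle=\sum_{(j_v)}\left(\sum_{\text{bond indices}}\prod_v A^{(v)}\right)|(j_v)_v\rangle$; it is not normalized.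 $\rho_A=\mathrm{Tr}_{A^c}|\Psi\rangle\langle\Psi|$ is the reduced density matrix on the physical legs in $A$, without dividing by the norm. Probability is with respect to the choice of the unitaries. *)

theory Defs
  imports "HOL-Probability.Probability"
begin

text \<open>
  Operators on the Hilbert space with orthonormal basis indexed by a finite set \<open>I\<close> are
  matrices \<open>'i \<times> 'i \<Rightarrow> complex\<close>, set to \<open>undefined\<close> outside \<open>I \<times> I\<close>.
\<close>

definition op_mult :: "'i set \<Rightarrow> ('i \<times> 'i \<Rightarrow> complex) \<Rightarrow> ('i \<times> 'i \<Rightarrow> complex) \<Rightarrow> ('i \<times> 'i \<Rightarrow> complex)" where
  "op_mult I S T = (\<lambda>(i, k)\<in>I \<times> I. \<Sum>j\<in>I. S (i, j) * T (j, k))"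

definition op_one :: "'i set \<Rightarrow> ('i \<times> 'i \<Rightarrow> complex)" where
  "op_one I = (\<lambda>(i, k)\<in>I \<times> I. if i = k then 1 else 0)"

definition op_adjoint :: "'i set \<Rightarrow> ('i \<times> 'i \<Rightarrow> complex) \<Rightarrow> ('i \<times> 'i \<Rightarrow> complex)" where
  "op_adjoint I T = (\<lambda>(i, k)\<in>I \<times> I. cnj (T (k, i)))"

definition op_trace :: "'i set \<Rightarrow> ('i \<times> 'i \<Rightarrow> complex) \<Rightarrow> complex" where
  "op_trace I T = (\<Sum>i\<in>I. T (i, i))"

definition unitary_group :: "'i set \<Rightarrow> ('i \<times> 'i \<Rightarrow> complex) set" where
  "unitary_group I = {U \<in> extensional (I \<times> I).
     op_mult I U (op_adjoint I U) = op_one I \<and> op_mult I (op_adjoint I U) U = op_one I}"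

text \<open>
  For finite \<open>I\<close> the product sigma-algebra is the Borel sigma-algebra of the space of matrices,
  so its restriction is the Borel sigma-algebra of the unitary group. Haar measure is the unique
  probability measure on it that is invariant under translations.
\<close>

definition haar_measure :: "'i set \<Rightarrow> ('i \<times> 'i \<Rightarrow> complex) measure \<Rightarrow> bool" where
  "haar_measure I \<mu> \<longleftrightarrow>
     prob_space \<mu> \<and>
     sets \<mu> = sets (restrict_space (\<Pi>\<^sub>M p\<in>I \<times> I. borel) (unitary_group I)) \<and>
     (\<forall>V\<in>unitary_group I.
        distr \<mu> \<mu> (\<lambda>U. op_mult I V U) = \<mu> \<and> distr \<mu> \<mu> (\<lambda>U. op_mult I U V) = \<mu>)"

type_synonym site = "nat \<times> nat"

definition torus :: "nat \<Rightarrow> site set" where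
  "torus L = {..<L} \<times> {..<L}"

text \<open>The \<open>l \<times> l\<close> block with corner \<open>(x, y)\<close>; it may wrap around the torus.\<close>

definition block :: "nat \<Rightarrow> nat \<Rightarrow> site \<Rightarrow> site set" where
  "block L l = (\<lambda>(x, y). (\<lambda>(i, j). ((x + i) mod L, (y + j) mod L)) ` ({..<l} \<times> {..<l}))"

text \<open>Basis of \<open>\<complex>\<^sup>D \<otimes> \<complex>\<^sup>D \<otimes> \<complex>\<^sup>d\<close>, with labels counted from 0.\<close>

definition legs :: "nat \<Rightarrow> nat \<Rightarrow> (nat \<times> nat \<times> nat) set" where
  "legs D d = {..<D} \<times> {..<D} \<times> {..<d}"

type_synonym site_op = "(nat \<times> nat \<times> nat) \<times> (nat \<times> nat \<times> nat) \<Rightarrow> complex"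

definition unit_vector :: "nat \<Rightarrow> (nat \<Rightarrow> complex) \<Rightarrow> bool" where
  "unit_vector d \<phi> \<longleftrightarrow> (\<Sum>k<d. (cmod (\<phi> k))\<^sup>2) = 1"

text \<open>
  The matrix element of \<open>U\<close> between the bra \<open>\<langle>\<alpha>, \<beta>, \<phi>|\<close> and the ket \<open>|\<gamma>, \<kappa>, j\<rangle>\<close>,
  where \<open>\<phi>\<close> is the reference vector, given by its coordinates in the standard basis.
\<close>

definition site_tensor ::
  "nat \<Rightarrow> (nat \<Rightarrow> complex) \<Rightarrow> site_op \<Rightarrow> nat \<Rightarrow> nat \<Rightarrow> nat \<Rightarrow> nat \<Rightarrow> nat \<Rightarrow> complex" where
  "site_tensor d \<phi> U \<alpha> \<beta> \<gamma> \<kappa> j = (\<Sum>k<d. cnj (\<phi> k) * U ((\<alpha>, \<beta>, k), (\<gamma>, \<kappa>, j)))"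

definition configs :: "site set \<Rightarrow> nat \<Rightarrow> (site \<Rightarrow> nat) set" where
  "configs V q = V \<rightarrow>\<^sub>E {..<q}"

text \<open>
  Coefficient of the basis vector \<open>|j\<rangle>\<close>. The summation variables \<open>a\<close> and \<open>b\<close> are the values of the
  first two bond indices at all sites; the other two bond indices of a site are read off from its
  neighbours, which is the contraction on the torus.
\<close>

definition tn_state ::
  "nat \<Rightarrow> nat \<Rightarrow> nat \<Rightarrow> (nat \<Rightarrow> complex) \<Rightarrow> (site \<Rightarrow> site_op) \<Rightarrow> (site \<Rightarrow> nat) \<Rightarrow> complex" where
  "tn_state L D d \<phi> U j =
     (\<Sum>a\<in>configs (torus L) D. \<Sum>b\<in>configs (torus L) D.
        \<Prod>(x, y)\<in>torus L.
          site_tensor d \<phi> (U (x, y)) (a (x, y)) (b (x, y))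
            (a (x, (y + 1) mod L)) (b ((x + 1) mod L, y)) (j (x, y)))"

definition ket_bra :: "'c set \<Rightarrow> ('c \<Rightarrow> complex) \<Rightarrow> ('c \<times> 'c \<Rightarrow> complex)" where
  "ket_bra I \<psi> = (\<lambda>(i, k)\<in>I \<times> I. \<psi> i * cnj (\<psi> k))"

text \<open>Partial trace over the sites in \<open>V - A\<close>, for an operator on the sites \<open>V\<close>.\<close>

definition reduced_op ::
  "site set \<Rightarrow> nat \<Rightarrow> site set \<Rightarrow> ((site \<Rightarrow> nat) \<times> (site \<Rightarrow> nat) \<Rightarrow> complex)
    \<Rightarrow> ((site \<Rightarrow> nat) \<times> (site \<Rightarrow> nat) \<Rightarrow> complex)" where
  "reduced_op V d A T = (\<lambda>(i, i')\<in>configs A d \<times> configs A d.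
     \<Sum>k\<in>configs (V - A) d. T (merge A (V - A) (i, k), merge A (V - A) (i', k)))"

definition reduced_density ::
  "nat \<Rightarrow> nat \<Rightarrow> nat \<Rightarrow> (nat \<Rightarrow> complex) \<Rightarrow> site set \<Rightarrow> (site \<Rightarrow> site_op)
    \<Rightarrow> ((site \<Rightarrow> nat) \<times> (site \<Rightarrow> nat) \<Rightarrow> complex)" where
  "reduced_density L D d \<phi> A U =
     reduced_op (torus L) d A (ket_bra (configs (torus L) d) (tn_state L D d \<phi> U))"

definition purity :: "'i set \<Rightarrow> ('i \<times> 'i \<Rightarrow> complex) \<Rightarrow> complex" where
  "purity I \<rho> = op_trace I (op_mult I \<rho> \<rho>)"

end

theory Submission
  imports Defs "HOL-Combinatorics.Permutations"
begin

text \<open>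
  Averaging two copies of every \<open>U\<^sub>v\<close> and of its conjugate turns the expected purity into the
  partition function of an Ising model: a site carries one of the two permutations of the
  replicas, encoded as a boolean with \<open>True\<close> for the identity, and interacts with the two
  neighbours to which its last two bond indices lead. All weights are nonnegative, so the
  antidiagonals of the torus can be summed out one by one with a substochastic transfer matrix.
  Outside the block a swap both of whose neighbours are identities has weight 0; hence a swap
  domain is created inside the block, at cost \<open>D\<^sup>-\<^sup>2\<close>, or winds around the torus, which costs a
  factor exponentially small in \<open>L\<close>. The two ends of a domain on the next antidiagonal cost a
  factor of order \<open>1 / D\<close> each, so all configurations with a swap contribute \<open>O(D\<^sup>-\<^sup>4)\<close>, and the
  identity configuration at most \<open>d\<^sup>-\<^sup>|\<^sup>A\<^sup>|\<close>.

  The same model with empty block shows that the squared norm \<open>T\<close> of the state, which has mean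
  1, has variance tending to 0 as the torus grows. By Cauchy--Schwarz the purity is at least
  \<open>T\<^sup>2 / d\<^sup>|\<^sup>A\<^sup>|\<close>, so the bound on its mean bounds its mean absolute deviation, and Markov's
  inequality concludes.
\<close>

subsection \<open>Second moments of Haar measure\<close>

text \<open>A site weight couples a spin only to its right and upper neighbours, so the spins of one
  antidiagonal are independent once the preceding antidiagonal is fixed. The sum over a layer
  factorises into local sums, each at most 1; this is what makes the transfer matrix substochastic,
  and it would fail for horizontal or vertical layers. The zero weight outside the block is exact:
  with two identity neighbours the three overlaps of a site form the Gram matrix of the two
  permutations in dimension \<open>D * D * d\<close>, and the Weingarten matrix is the inverse of
  that matrix.

  The obstacle is a layer consisting of swaps only: it has no ends, so the factors of order 1 / D
  are absent. It must not be reachable from the all-identity layer in one step, which is ensured by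
  a column that the block misses.

  For winding domains there are at most 2^L starting layers, against a factor (2/3)^2 per layer
  outside the block; 2 * (2/3)^2 = 8/9 < 1, and D \<ge> 3 enters as 2 / D \<le> 2 / 3.

  The mean purity alone does not control deviations below it. Subtracting T^2 / d^|A| instead of 1 /
  d^|A| leaves a nonnegative variable, whose mean absolute value is just its mean.\<close>

lemma sum_product4:
  fixes f g h k :: "'a \<Rightarrow> 'b::comm_semiring_0"
  shows "sum f A * sum g B * sum h C * sum k D = (\<Sum>a\<in>A. \<Sum>b\<in>B. \<Sum>c\<in>C. \<Sum>e\<in>D. f a * g b * h c * k e)"
  by (simp only: sum_distrib_left[symmetric] sum_distrib_right[symmetric])

section \<open>Unitary matrices and explicit test unitaries\<close>

lemma unitary_group_iff:
  "V \<in> unitary_group I \<longleftrightarrow> V \<in> extensional (I \<times> I) \<and>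
    (\<forall>i\<in>I. \<forall>k\<in>I. (\<Sum>j\<in>I. V (i, j) * cnj (V (k, j))) = of_bool (i = k)) \<and>
    (\<forall>i\<in>I. \<forall>k\<in>I. (\<Sum>j\<in>I. cnj (V (j, i)) * V (j, k)) = of_bool (i = k))"
proof -
  have "op_mult I V (op_adjoint I V) = op_one I \<longleftrightarrow>
      (\<forall>i\<in>I. \<forall>k\<in>I. (\<Sum>j\<in>I. V (i, j) * cnj (V (k, j))) = of_bool (i = k))"
    by (auto simp: op_mult_def op_adjoint_def op_one_def fun_eq_iff restrict_def split: if_splits)
  moreover have "op_mult I (op_adjoint I V) V = op_one I \<longleftrightarrow>
      (\<forall>i\<in>I. \<forall>k\<in>I. (\<Sum>j\<in>I. cnj (V (j, i)) * V (j, k)) = of_bool (i = k))"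
    by (auto simp: op_mult_def op_adjoint_def op_one_def fun_eq_iff restrict_def split: if_splits)
  ultimately show ?thesis by (simp add: unitary_group_def)
qed

lemma unitary_rows:
  "V \<in> unitary_group I \<Longrightarrow> i \<in> I \<Longrightarrow> k \<in> I \<Longrightarrow> (\<Sum>j\<in>I. V (i, j) * cnj (V (k, j))) = of_bool (i = k)"
  by (simp add: unitary_group_iff)

lemma unitary_columns:
  "V \<in> unitary_group I \<Longrightarrow> i \<in> I \<Longrightarrow> k \<in> I \<Longrightarrow> (\<Sum>j\<in>I. cnj (V (j, i)) * V (j, k)) = of_bool (i = k)"
  by (simp add: unitary_group_iff)

lemma unitary_entry_le_1:
  assumes "finite I" "V \<in> unitary_group I" "i \<in> I" "j \<in> I"
  shows "cmod (V (i, j)) \<le> 1"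
proof -
  have "complex_of_real (\<Sum>j\<in>I. (cmod (V (i, j)))\<^sup>2) = 1"
    using unitary_rows[OF assms(2,3,3)] by (simp add: complex_norm_square del: of_real_power)
  then have "(\<Sum>j\<in>I. (cmod (V (i, j)))\<^sup>2) = 1" by (metis of_real_eq_1_iff)
  then have "(cmod (V (i, j)))\<^sup>2 \<le> 1"
    using member_le_sum[of j I "\<lambda>j. (cmod (V (i, j)))\<^sup>2"] assms by simp
  then show ?thesis by (simp add: power_le_one_iff)
qed

lemma unitary_mult:
  assumes "finite I" "V \<in> unitary_group I" "U \<in> unitary_group I"
  shows "op_mult I V U \<in> unitary_group I"
  unfolding unitary_group_iff
proof (intro conjI ballI)
  fix i k assume ik: "i \<in> I" "k \<in> I"
  have "(\<Sum>j\<in>I. op_mult I V U (i, j) * cnj (op_mult I V U (k, j))) =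
      (\<Sum>j\<in>I. \<Sum>a\<in>I. \<Sum>b\<in>I. V (i, a) * cnj (V (k, b)) * (U (a, j) * cnj (U (b, j))))"
    using ik by (simp add: op_mult_def sum_product mult_ac)
  also have "\<dots> = (\<Sum>a\<in>I. \<Sum>j\<in>I. \<Sum>b\<in>I. V (i, a) * cnj (V (k, b)) * (U (a, j) * cnj (U (b, j))))"
    by (rule sum.swap)
  also have "\<dots> = (\<Sum>a\<in>I. \<Sum>b\<in>I. \<Sum>j\<in>I. V (i, a) * cnj (V (k, b)) * (U (a, j) * cnj (U (b, j))))"
    by (intro sum.cong refl sum.swap)
  also have "\<dots> = (\<Sum>a\<in>I. \<Sum>b\<in>I. V (i, a) * cnj (V (k, b)) * of_bool (a = b))"
    by (simp add: sum_distrib_left[symmetric] unitary_rows[OF assms(3)])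
  also have "\<dots> = of_bool (i = k)"
    using ik assms by (simp add: of_bool_def if_distrib[of "\<lambda>x. _ * x"] sum.delta unitary_rows cong: if_cong)
  finally show "(\<Sum>j\<in>I. op_mult I V U (i, j) * cnj (op_mult I V U (k, j))) = of_bool (i = k)" .
  have "(\<Sum>j\<in>I. cnj (op_mult I V U (j, i)) * op_mult I V U (j, k)) =
      (\<Sum>j\<in>I. \<Sum>a\<in>I. \<Sum>b\<in>I. cnj (U (a, i)) * U (b, k) * (cnj (V (j, a)) * V (j, b)))"
    using ik by (simp add: op_mult_def sum_product) (simp add: mult_ac)
  also have "\<dots> = (\<Sum>a\<in>I. \<Sum>j\<in>I. \<Sum>b\<in>I. cnj (U (a, i)) * U (b, k) * (cnj (V (j, a)) * V (j, b)))"
    by (rule sum.swap)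
  also have "\<dots> = (\<Sum>a\<in>I. \<Sum>b\<in>I. \<Sum>j\<in>I. cnj (U (a, i)) * U (b, k) * (cnj (V (j, a)) * V (j, b)))"
    by (intro sum.cong refl sum.swap)
  also have "\<dots> = (\<Sum>a\<in>I. \<Sum>b\<in>I. cnj (U (a, i)) * U (b, k) * of_bool (a = b))"
    by (simp add: sum_distrib_left[symmetric] unitary_columns[OF assms(2)])
  also have "\<dots> = of_bool (i = k)"
    using ik assms by (simp add: of_bool_def if_distrib[of "\<lambda>x. _ * x"] sum.delta unitary_columns cong: if_cong)
  finally show "(\<Sum>j\<in>I. cnj (op_mult I V U (j, i)) * op_mult I V U (j, k)) = of_bool (i = k)" .
qed (simp add: op_mult_def)

text \<open>Right multiplication by the transpose of \<open>V\<close> acts on column indices with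
  the same coefficients as left multiplication by \<open>V\<close> on row indices. Hence
  \<open>invariant_tensor\<close> serves both sides of a moment.\<close>

definition op_transpose :: "'i set \<Rightarrow> ('i \<times> 'i \<Rightarrow> complex) \<Rightarrow> ('i \<times> 'i \<Rightarrow> complex)" where
  "op_transpose I V = (\<lambda>(i, k)\<in>I \<times> I. V (k, i))"

lemma unitary_transpose:
  assumes "V \<in> unitary_group I"
  shows "op_transpose I V \<in> unitary_group I"
proof -
  have "(\<Sum>j\<in>I. V (j, i) * cnj (V (j, k))) = of_bool (i = k)"
    "(\<Sum>j\<in>I. cnj (V (i, j)) * V (k, j)) = of_bool (i = k)" if "i \<in> I" "k \<in> I" for i k
    using unitary_columns[OF assms that(2,1)] unitary_rows[OF assms that(2,1)]
    by (simp_all add: mult.commute eq_commute)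
  then show ?thesis by (simp add: unitary_group_iff op_transpose_def)
qed

text \<open>A permutation matrix with phases; \<open>\<pi> i\<close> is the column of the nonzero
  entry in row \<open>i\<close>. In \<open>invariant_tensor\<close> the phases kill unpaired entries
  and the permutations make the paired ones independent of the chosen labels.\<close>

definition monomial_op :: "'i set \<Rightarrow> ('i \<Rightarrow> complex) \<Rightarrow> ('i \<Rightarrow> 'i) \<Rightarrow> ('i \<times> 'i \<Rightarrow> complex)" where
  "monomial_op I \<omega> \<pi> = (\<lambda>(i, k)\<in>I \<times> I. if k = \<pi> i then \<omega> i else 0)"

lemma sum_monomial_op:
  assumes "finite I" "\<pi> permutes I" "i \<in> I"
  shows "(\<Sum>k\<in>I. monomial_op I \<omega> \<pi> (i, k) * g k) = \<omega> i * g (\<pi> i)"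
    and "(\<Sum>k\<in>I. cnj (monomial_op I \<omega> \<pi> (i, k)) * g k) = cnj (\<omega> i) * g (\<pi> i)"
proof -
  have "\<pi> i \<in> I" using assms by (simp add: permutes_in_image)
  have "(\<Sum>k\<in>I. monomial_op I \<omega> \<pi> (i, k) * g k) = (\<Sum>k\<in>I. if k = \<pi> i then \<omega> i * g k else 0)"
    using assms by (intro sum.cong) (auto simp: monomial_op_def)
  then show "(\<Sum>k\<in>I. monomial_op I \<omega> \<pi> (i, k) * g k) = \<omega> i * g (\<pi> i)"
    using assms \<open>\<pi> i \<in> I\<close> by (simp add: sum.delta)
  have "(\<Sum>k\<in>I. cnj (monomial_op I \<omega> \<pi> (i, k)) * g k) = (\<Sum>k\<in>I. if k = \<pi> i then cnj (\<omega> i) * g k else 0)"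
    using assms by (intro sum.cong) (auto simp: monomial_op_def)
  then show "(\<Sum>k\<in>I. cnj (monomial_op I \<omega> \<pi> (i, k)) * g k) = cnj (\<omega> i) * g (\<pi> i)"
    using assms \<open>\<pi> i \<in> I\<close> by (simp add: sum.delta)
qed

lemma unitary_monomial_op:
  assumes "finite I" "\<pi> permutes I" "\<And>i. cmod (\<omega> i) = 1"
  shows "monomial_op I \<omega> \<pi> \<in> unitary_group I"
  unfolding unitary_group_iff
proof (intro conjI ballI)
  have norm: "\<omega> i * cnj (\<omega> i) = 1" for i
    using assms(3)[of i] by (metis complex_norm_square of_real_1 one_power2)
  fix i k assume ik: "i \<in> I" "k \<in> I"
  have "\<pi> i \<in> I" using ik assms by (simp add: permutes_in_image)
  then show "(\<Sum>j\<in>I. monomial_op I \<omega> \<pi> (i, j) * cnj (monomial_op I \<omega> \<pi> (k, j))) = of_bool (i = k)"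
    using ik assms permutes_inj[OF assms(2)]
    by (subst sum_monomial_op) (auto simp: monomial_op_def norm inj_eq)
  define j\<^sub>0 where "j\<^sub>0 = inv \<pi> i"
  have j0: "j\<^sub>0 \<in> I" "\<pi> j\<^sub>0 = i" "\<And>j. i = \<pi> j \<longleftrightarrow> j = j\<^sub>0"
    using assms ik by (auto simp: j\<^sub>0_def permutes_inverses permutes_inv permutes_in_image)
  have "(\<Sum>j\<in>I. cnj (monomial_op I \<omega> \<pi> (j, i)) * monomial_op I \<omega> \<pi> (j, k)) =
      (\<Sum>j\<in>I. if j = j\<^sub>0 then of_bool (i = k) else 0)"
    using ik j0 norm by (intro sum.cong) (auto simp: monomial_op_def mult.commute)
  then show "(\<Sum>j\<in>I. cnj (monomial_op I \<omega> \<pi> (j, i)) * monomial_op I \<omega> \<pi> (j, k)) = of_bool (i = k)"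
    using assms j0 by simp
qed (simp add: monomial_op_def)

text \<open>The only test unitary that is not monomial. Monomial invariance leaves the entry with
  four equal labels unrelated to the entries with two distinct labels; mixing two coordinates
  supplies the missing relation.\<close>

definition hadamard_op :: "'i set \<Rightarrow> 'i \<Rightarrow> 'i \<Rightarrow> ('i \<times> 'i \<Rightarrow> complex)" where
  "hadamard_op I p q = (\<lambda>(i, k)\<in>I \<times> I.
     if {i, k} \<subseteq> {p, q} then (if i = q \<and> k = q then - 1 else 1) / of_real (sqrt 2) else of_bool (i = k))"

lemma hadamard_op_simps:
  assumes "p \<in> I" "q \<in> I" "p \<noteq> q"
  shows "hadamard_op I p q (p, p) = 1 / of_real (sqrt 2)"
    "hadamard_op I p q (p, q) = 1 / of_real (sqrt 2)"
    "hadamard_op I p q (q, p) = 1 / of_real (sqrt 2)"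
    "hadamard_op I p q (q, q) = - 1 / of_real (sqrt 2)"
    "i \<in> I - {p, q} \<Longrightarrow> k \<in> I \<Longrightarrow> hadamard_op I p q (i, k) = of_bool (i = k)"
    "i \<in> I - {p, q} \<Longrightarrow> k \<in> I \<Longrightarrow> hadamard_op I p q (k, i) = of_bool (i = k)"
  using assms by (auto simp: hadamard_op_def)

lemma sqrt2_sq: "complex_of_real (sqrt 2) * complex_of_real (sqrt 2) = 2"
  by (simp flip: of_real_mult)

lemma sum_split_two:
  assumes "finite I" "p \<in> I" "q \<in> I" "p \<noteq> q"
  shows "sum g I = g p + (g q + sum g (I - {p, q}))"
proof -
  have "sum g I = g p + sum g (I - {p})" using assms by (simp add: sum.remove)
  also have "sum g (I - {p}) = g q + sum g (I - {p} - {q})" using assms by (simp add: sum.remove)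
  also have "I - {p} - {q} = I - {p, q}" by auto
  finally show ?thesis .
qed

lemma sum_hadamard_op:
  assumes "finite I" "p \<in> I" "q \<in> I" "p \<noteq> q"
  shows "(\<Sum>k\<in>I. hadamard_op I p q (p, k) * g k) = (g p + g q) / of_real (sqrt 2)"
    and "(\<Sum>k\<in>I. hadamard_op I p q (q, k) * g k) = (g p - g q) / of_real (sqrt 2)"
    and "i \<in> I - {p, q} \<Longrightarrow> (\<Sum>k\<in>I. hadamard_op I p q (i, k) * g k) = g i"
proof -
  have z: "(\<Sum>k\<in>I - {p, q}. hadamard_op I p q (x, k) * g k) = 0" if "x \<in> {p, q}" for x
    using assms that by (intro sum.neutral) (auto simp: hadamard_op_def)
  show "(\<Sum>k\<in>I. hadamard_op I p q (p, k) * g k) = (g p + g q) / of_real (sqrt 2)"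
    using assms z[of p] by (simp add: sum_split_two[OF assms] hadamard_op_simps add_divide_distrib)
  show "(\<Sum>k\<in>I. hadamard_op I p q (q, k) * g k) = (g p - g q) / of_real (sqrt 2)"
    using assms z[of q] by (simp add: sum_split_two[OF assms] hadamard_op_simps diff_divide_distrib)
  assume i: "i \<in> I - {p, q}"
  then have "(\<Sum>k\<in>I. hadamard_op I p q (i, k) * g k) = (\<Sum>k\<in>I. if i = k then g k else 0)"
    using assms by (intro sum.cong) (auto simp: hadamard_op_simps)
  then show "(\<Sum>k\<in>I. hadamard_op I p q (i, k) * g k) = g i" using i assms by simp
qed

lemma unitary_hadamard_op:
  assumes "finite I" "p \<in> I" "q \<in> I" "p \<noteq> q"
  shows "hadamard_op I p q \<in> unitary_group I"
proof -
  let ?H = "hadamard_op I p q"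
  have cnj: "cnj (?H (i, k)) = ?H (i, k)" and sym: "?H (i, k) = ?H (k, i)" if "i \<in> I" "k \<in> I" for i k
    using that by (auto simp: hadamard_op_def)
  have sq: "(\<Sum>j\<in>I. ?H (i, j) * ?H (j, k)) = of_bool (i = k)" if ik: "i \<in> I" "k \<in> I" for i k
  proof -
    consider "i = p" | "i = q" | "i \<in> I - {p, q}" using ik by blast
    then show ?thesis
    proof cases
      case 1
      then have "(\<Sum>j\<in>I. ?H (i, j) * ?H (j, k)) = (?H (p, k) + ?H (q, k)) / of_real (sqrt 2)"
        using assms by (simp add: sum_hadamard_op)
      also have "\<dots> = of_bool (i = k)"
        using 1 ik assms sqrt2_sq by (auto simp: hadamard_op_def)
      finally show ?thesis .
    next
      case 2
      then have "(\<Sum>j\<in>I. ?H (i, j) * ?H (j, k)) = (?H (p, k) - ?H (q, k)) / of_real (sqrt 2)"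
        using assms by (simp add: sum_hadamard_op)
      also have "\<dots> = of_bool (i = k)"
        using 2 ik assms sqrt2_sq by (auto simp: hadamard_op_def)
      finally show ?thesis .
    next
      case 3
      then show ?thesis using ik assms by (simp add: sum_hadamard_op hadamard_op_simps)
    qed
  qed
  have "(\<Sum>j\<in>I. ?H (i, j) * cnj (?H (k, j))) = (\<Sum>j\<in>I. ?H (i, j) * ?H (j, k))"
    "(\<Sum>j\<in>I. cnj (?H (j, i)) * ?H (j, k)) = (\<Sum>j\<in>I. ?H (i, j) * ?H (j, k))"
    if "i \<in> I" "k \<in> I" for i k
    using that by (auto intro!: sum.cong simp: cnj sym)
  then show ?thesis using sq by (simp add: unitary_group_iff) (simp add: hadamard_op_def)
qed

section \<open>Tensors invariant under the unitary group\<close>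

definition paired :: "bool \<Rightarrow> 'i \<Rightarrow> 'i \<Rightarrow> 'i \<Rightarrow> 'i \<Rightarrow> bool" where
  "paired s a b c e \<longleftrightarrow> (if s then a = c \<and> b = e else a = e \<and> b = c)"

lemma ex_permutes_two:
  assumes "a \<in> I" "b \<in> I" "a \<noteq> b" "p \<in> I" "q \<in> I" "p \<noteq> q"
  obtains \<pi> where "\<pi> permutes I" "\<pi> a = p" "\<pi> b = q"
proof -
  let ?\<sigma> = "Transposition.transpose a p"
  let ?\<pi> = "Transposition.transpose (?\<sigma> b) q \<circ> ?\<sigma>"
  have "?\<sigma> b \<noteq> p" using assms by (auto simp: Transposition.transpose_def)
  moreover have "?\<sigma> b \<in> I" using assms by (auto simp: Transposition.transpose_def)
  ultimately show ?thesis using assms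
    by (intro that[of ?\<pi>] permutes_compose permutes_swap_id) (auto simp: Transposition.transpose_def)
qed

text \<open>The two-fold case of Schur--Weyl duality.\<close>

lemma invariant_tensor:
  fixes t :: "'i \<Rightarrow> 'i \<Rightarrow> 'i \<Rightarrow> 'i \<Rightarrow> complex"
  assumes fin: "finite I" and pq: "p \<in> I" "q \<in> I" "p \<noteq> q"
    and inv: "\<And>V a b c e. V \<in> unitary_group I \<Longrightarrow> a \<in> I \<Longrightarrow> b \<in> I \<Longrightarrow> c \<in> I \<Longrightarrow> e \<in> I \<Longrightarrow>
      t a b c e = (\<Sum>a'\<in>I. V (a, a') * (\<Sum>b'\<in>I. V (b, b') *
        (\<Sum>c'\<in>I. cnj (V (c, c')) * (\<Sum>e'\<in>I. cnj (V (e, e')) * t a' b' c' e'))))"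
    and abce: "a \<in> I" "b \<in> I" "c \<in> I" "e \<in> I"
  shows "t a b c e = t p q p q * of_bool (paired True a b c e) + t p q q p * of_bool (paired False a b c e)"
proof -
  have mono: "t a b c e = \<omega> a * (\<omega> b * (cnj (\<omega> c) * (cnj (\<omega> e) * t (\<pi> a) (\<pi> b) (\<pi> c) (\<pi> e))))"
    if "\<pi> permutes I" "\<And>i. cmod (\<omega> i) = 1" "a \<in> I" "b \<in> I" "c \<in> I" "e \<in> I" for a b c e \<omega> \<pi>
    using that inv[OF unitary_monomial_op[OF fin that(1,2)] that(3-6)]
    by (simp add: sum_monomial_op fin)
  have perm: "t a b c e = t (\<pi> a) (\<pi> b) (\<pi> c) (\<pi> e)"
    if "\<pi> permutes I" "a \<in> I" "b \<in> I" "c \<in> I" "e \<in> I" for a b c e \<pi>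
    using mono[of \<pi> "\<lambda>_. 1"] that by simp
  have phase: "t a b c e = (if a = z then \<i> else 1) * ((if b = z then \<i> else 1) *
      (cnj (if c = z then \<i> else 1) * (cnj (if e = z then \<i> else 1) * t a b c e)))"
    if "a \<in> I" "b \<in> I" "c \<in> I" "e \<in> I" for a b c e z
    using mono[of id "\<lambda>i. if i = z then \<i> else 1" a b c e] that by (simp add: permutes_id)
  have unpaired: "t a b c e = 0"
    if "a \<in> I" "b \<in> I" "c \<in> I" "e \<in> I" "\<not> paired True a b c e" "\<not> paired False a b c e" for a b c e
  proof (rule ccontr)
    assume "t a b c e \<noteq> 0"
    then have "(if a = z then \<i> else 1) * (if b = z then \<i> else 1) *
        (cnj (if c = z then \<i> else 1) * cnj (if e = z then \<i> else 1)) = 1" for z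
      using phase[OF that(1-4), of z] by (simp only: mult.assoc[symmetric]) (simp only: mult_cancel_right1 simp_thms)
    \<comment> \<open>The phase at \<open>z\<close> is \<i> to the power n, where n counts
      \<open>z\<close> among \<open>a\<close>, \<open>b\<close> minus among \<open>c\<close>,
      \<open>e\<close>. As |n| \<le> 2, the phase is 1 only for n = 0, and this for
      \<open>z = a\<close> and \<open>z = b\<close> forces a pairing.\<close>
    from this[of a] this[of b] that(5,6) show False
      by (auto simp: paired_def complex_eq_iff split: if_splits)
  qed
  have distinct: "t a b a b = t p q p q" "t a b b a = t p q q p"
    if ab: "a \<in> I" "b \<in> I" "a \<noteq> b" for a b
    using ex_permutes_two[OF ab pq] perm ab by metis+
  have equal: "t a a a a = t p p p p" if "a \<in> I" for a
    using perm[of "Transposition.transpose a p" a a a a] that pq by (simp add: permutes_swap_id)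
  \<comment> \<open>The Hadamard matrix spreads each of the four indices \<open>p\<close> over
    \<open>{p, q}\<close> with factor 1 / sqrt 2. Of the sixteen entries six are paired: two with
    equal labels and two for each pairing of distinct labels. This gives
    \<open>t p p p p = t p q p q + t p q q p\<close>.\<close>
  have "t p p p p * 4 = (\<Sum>a'\<in>{p, q}. \<Sum>b'\<in>{p, q}. \<Sum>c'\<in>{p, q}. \<Sum>e'\<in>{p, q}. t a' b' c' e')"
  proof -
    have cnj: "(\<Sum>c'\<in>I. cnj (hadamard_op I p q (p, c')) * g c') = (g p + g q) / of_real (sqrt 2)" for g
    proof -
      have "(\<Sum>c'\<in>I. cnj (hadamard_op I p q (p, c')) * g c') = (\<Sum>c'\<in>I. hadamard_op I p q (p, c') * g c')"
        using pq by (intro sum.cong) (auto simp: hadamard_op_def)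
      then show ?thesis by (simp add: sum_hadamard_op fin pq)
    qed
    have "complex_of_real (sqrt 2) * (complex_of_real (sqrt 2) *
      (complex_of_real (sqrt 2) * complex_of_real (sqrt 2))) = 4"
      by (simp add: sqrt2_sq mult.assoc[symmetric])
    then have "complex_of_real (sqrt 2) * complex_of_real (sqrt 2) * complex_of_real (sqrt 2) *
      complex_of_real (sqrt 2) = 4" by (simp only: mult.assoc)
    then have *: "x / of_real (sqrt 2) / of_real (sqrt 2) / of_real (sqrt 2) / of_real (sqrt 2) * 4 = x" for x :: complex
      by simp
    note eq = inv[OF unitary_hadamard_op[OF fin pq] pq(1) pq(1) pq(1) pq(1),
      unfolded cnj sum_hadamard_op(1)[OF fin pq]]
    show ?thesis
      by (rule trans[OF arg_cong[OF eq, of "\<lambda>x. x * 4"]])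
        (simp only: add_divide_distrib[symmetric] *, simp add: pq add_ac)
  qed
  also have "\<dots> = 2 * t p p p p + 2 * t p q p q + 2 * t p q q p"
    using pq equal[of q] distinct[of q p] unpaired by (simp add: paired_def)
  finally have "2 * t p p p p = 2 * (t p q p q + t p q q p)" by (simp add: algebra_simps)
  then have "t p p p p = t p q p q + t p q q p" by (simp only: mult_cancel_left) simp
  then have eq: "t a a a a = t p q p q + t p q q p" using equal[OF abce(1)] by simp
  consider "a = b" "c = a" "e = a" | "a \<noteq> b" "c = a" "e = b" | "a \<noteq> b" "c = b" "e = a" |
    "\<not> paired True a b c e" "\<not> paired False a b c e"
    by (auto simp: paired_def)
  then show ?thesis
  proof cases
    case 1
    with eq show ?thesis by (simp add: paired_def)
  next
    case 2
    then show ?thesis using distinct(1)[OF abce(1,2)] by (simp add: paired_def)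
  next
    case 3
    then show ?thesis using distinct(2)[OF abce(1,2)] by (simp add: paired_def)
  next
    case 4
    then show ?thesis using unpaired[OF abce] by simp
  qed
qed

text \<open>The Weingarten function of U(n) for two copies; the flag says whether the row and the
  column permutation agree. As a 2 by 2 matrix it is the inverse of the Gram matrix with n^2 on and
  n off the diagonal.\<close>

definition weingarten :: "real \<Rightarrow> bool \<Rightarrow> real" where
  "weingarten n b = (if b then 1 / (n\<^sup>2 - 1) else - 1 / (n * (n\<^sup>2 - 1)))"

section \<open>Haar moments\<close>

lemma borel_measurable_cnj [measurable (raw)]:
  "f \<in> borel_measurable M \<Longrightarrow> (\<lambda>x. cnj (f x)) \<in> borel_measurable M"
  by (rule borel_measurable_continuous_on[OF continuous_on_cnj[OF continuous_on_id]])

locale haar =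
  fixes I :: "'i set" and \<mu> :: "('i \<times> 'i \<Rightarrow> complex) measure"
  assumes finite_I: "finite I" and card_I: "card I \<ge> 2" and haar: "haar_measure I \<mu>"
begin

sublocale prob_space \<mu> using haar by (simp add: haar_measure_def)

lemma sets_haar: "sets \<mu> = sets (restrict_space (\<Pi>\<^sub>M p\<in>I \<times> I. borel) (unitary_group I))"
  using haar by (simp add: haar_measure_def)

lemma space_haar: "space \<mu> = unitary_group I"
  using sets_eq_imp_space_eq[OF sets_haar]
  by (auto simp: space_restrict_space space_PiM unitary_group_def PiE_def)

lemma measurable_entry [measurable]:
  assumes "i \<in> I" "j \<in> I"
  shows "(\<lambda>U. U (i, j)) \<in> borel_measurable \<mu>"
  unfolding measurable_cong_sets[OF sets_haar refl]
  using assms by (intro measurable_restrict_space1 measurable_component_singleton) auto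

lemma measurable_op_mult:
  assumes V: "V \<in> unitary_group I"
  shows "op_mult I V \<in> measurable \<mu> \<mu>" "(\<lambda>U. op_mult I U V) \<in> measurable \<mu> \<mu>"
proof -
  have "f \<in> measurable \<mu> \<mu>" if f: "f \<in> measurable \<mu> (\<Pi>\<^sub>M p\<in>I \<times> I. borel)"
    and r: "\<And>U. U \<in> unitary_group I \<Longrightarrow> f U \<in> unitary_group I" for f
    unfolding measurable_cong_sets[OF refl sets_haar]
    using f r by (intro measurable_restrict_space2) (auto simp: space_haar)
  note * = this
  show "op_mult I V \<in> measurable \<mu> \<mu>"
  proof (rule *)
    show "op_mult I V \<in> measurable \<mu> (\<Pi>\<^sub>M p\<in>I \<times> I. borel)"
      unfolding op_mult_def[abs_def] by (intro measurable_restrict) auto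
  qed (intro unitary_mult finite_I V)
  show "(\<lambda>U. op_mult I U V) \<in> measurable \<mu> \<mu>"
  proof (rule *)
    show "(\<lambda>U. op_mult I U V) \<in> measurable \<mu> (\<Pi>\<^sub>M p\<in>I \<times> I. borel)"
      unfolding op_mult_def[abs_def] by (intro measurable_restrict) auto
  qed (intro unitary_mult finite_I V)
qed

lemma haar_invariant:
  fixes F :: "('i \<times> 'i \<Rightarrow> complex) \<Rightarrow> complex"
  assumes "V \<in> unitary_group I" "F \<in> borel_measurable \<mu>"
  shows "integral\<^sup>L \<mu> F = (\<integral>U. F (op_mult I V U) \<partial>\<mu>)" "integral\<^sup>L \<mu> F = (\<integral>U. F (op_mult I U V) \<partial>\<mu>)"
proof -
  have "distr \<mu> \<mu> (op_mult I V) = \<mu>" "distr \<mu> \<mu> (\<lambda>U. op_mult I U V) = \<mu>"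
    using haar assms(1) by (simp_all add: haar_measure_def)
  then show "integral\<^sup>L \<mu> F = (\<integral>U. F (op_mult I V U) \<partial>\<mu>)" "integral\<^sup>L \<mu> F = (\<integral>U. F (op_mult I U V) \<partial>\<mu>)"
    using integral_distr[OF measurable_op_mult(1)[OF assms(1)] assms(2)]
      integral_distr[OF measurable_op_mult(2)[OF assms(1)] assms(2)] by simp_all
qed

definition moment :: "'i \<Rightarrow> 'i \<Rightarrow> 'i \<Rightarrow> 'i \<Rightarrow> 'i \<Rightarrow> 'i \<Rightarrow> 'i \<Rightarrow> 'i \<Rightarrow> complex" where
  "moment a b c e i j k m = (\<integral>U. U (a, i) * U (b, j) * cnj (U (c, k)) * cnj (U (e, m)) \<partial>\<mu>)"

lemma integrable_moment [simp]:
  assumes "a \<in> I" "b \<in> I" "c \<in> I" "e \<in> I" "i \<in> I" "j \<in> I" "k \<in> I" "m \<in> I"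
  shows "integrable \<mu> (\<lambda>U. U (a, i) * U (b, j) * cnj (U (c, k)) * cnj (U (e, m)))"
proof (rule integrable_const_bound[where B = 1])
  show "AE U in \<mu>. cmod (U (a, i) * U (b, j) * cnj (U (c, k)) * cnj (U (e, m))) \<le> 1"
    using assms unitary_entry_le_1[OF finite_I]
    by (intro AE_I2) (auto simp: space_haar norm_mult intro!: mult_le_one)
  show "(\<lambda>U. U (a, i) * U (b, j) * cnj (U (c, k)) * cnj (U (e, m))) \<in> borel_measurable \<mu>"
    using assms by measurable
qed

lemma moment_invariant_left:
  assumes V: "V \<in> unitary_group I"
    and mem: "a \<in> I" "b \<in> I" "c \<in> I" "e \<in> I" "i \<in> I" "j \<in> I" "k \<in> I" "m \<in> I"
  shows "moment a b c e i j k m = (\<Sum>a'\<in>I. V (a, a') * (\<Sum>b'\<in>I. V (b, b') *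
        (\<Sum>c'\<in>I. cnj (V (c, c')) * (\<Sum>e'\<in>I. cnj (V (e, e')) * moment a' b' c' e' i j k m))))"
proof -
  have "moment a b c e i j k m = (\<integral>U. op_mult I V U (a, i) * op_mult I V U (b, j) *
      cnj (op_mult I V U (c, k)) * cnj (op_mult I V U (e, m)) \<partial>\<mu>)"
    unfolding moment_def using mem by (intro haar_invariant V) measurable
  also have "\<dots> = (\<integral>U. (\<Sum>a'\<in>I. \<Sum>b'\<in>I. \<Sum>c'\<in>I. \<Sum>e'\<in>I.
      (V (a, a') * V (b, b') * cnj (V (c, c')) * cnj (V (e, e'))) *
      (U (a', i) * U (b', j) * cnj (U (c', k)) * cnj (U (e', m)))) \<partial>\<mu>)"
    using mem by (intro Bochner_Integration.integral_cong refl)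
      (simp add: op_mult_def sum_product4, simp add: mult_ac)
  also have "\<dots> = (\<Sum>a'\<in>I. \<Sum>b'\<in>I. \<Sum>c'\<in>I. \<Sum>e'\<in>I.
      (V (a, a') * V (b, b') * cnj (V (c, c')) * cnj (V (e, e'))) * moment a' b' c' e' i j k m)"
    unfolding moment_def using mem by simp
  finally show ?thesis by (simp add: sum_distrib_left mult.assoc)
qed

lemma moment_invariant_right:
  assumes V: "V \<in> unitary_group I"
    and mem: "a \<in> I" "b \<in> I" "c \<in> I" "e \<in> I" "i \<in> I" "j \<in> I" "k \<in> I" "m \<in> I"
  shows "moment a b c e i j k m = (\<Sum>i'\<in>I. V (i, i') * (\<Sum>j'\<in>I. V (j, j') *
        (\<Sum>k'\<in>I. cnj (V (k, k')) * (\<Sum>m'\<in>I. cnj (V (m, m')) * moment a b c e i' j' k' m'))))"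
proof -
  let ?V = "op_transpose I V"
  have "moment a b c e i j k m = (\<integral>U. op_mult I U ?V (a, i) * op_mult I U ?V (b, j) *
      cnj (op_mult I U ?V (c, k)) * cnj (op_mult I U ?V (e, m)) \<partial>\<mu>)"
    unfolding moment_def using mem by (intro haar_invariant unitary_transpose V) measurable
  also have "\<dots> = (\<integral>U. (\<Sum>i'\<in>I. \<Sum>j'\<in>I. \<Sum>k'\<in>I. \<Sum>m'\<in>I.
      (V (i, i') * V (j, j') * cnj (V (k, k')) * cnj (V (m, m'))) *
      (U (a, i') * U (b, j') * cnj (U (c, k')) * cnj (U (e, m')))) \<partial>\<mu>)"
    using mem by (intro Bochner_Integration.integral_cong refl)
      (simp add: op_mult_def op_transpose_def sum_product4, simp add: mult_ac)
  also have "\<dots> = (\<Sum>i'\<in>I. \<Sum>j'\<in>I. \<Sum>k'\<in>I. \<Sum>m'\<in>I.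
      (V (i, i') * V (j, j') * cnj (V (k, k')) * cnj (V (m, m'))) * moment a b c e i' j' k' m')"
    unfolding moment_def using mem by simp
  finally show ?thesis by (simp add: sum_distrib_left mult.assoc)
qed

text \<open>Summing over paired rows contracts columns of \<open>U\<close> with each other, so
  unitarity makes the integrand constant. These exact values are the linear equations that determine
  all moments.\<close>

lemma moment_contract:
  assumes mem: "i \<in> I" "j \<in> I" "k \<in> I" "m \<in> I"
  shows "(\<Sum>a\<in>I. \<Sum>b\<in>I. moment a b a b i j k m) = of_bool (paired True i j k m)"
    and "(\<Sum>a\<in>I. \<Sum>b\<in>I. moment a b b a i j k m) = of_bool (paired False i j k m)"
proof -
  have "(\<Sum>a\<in>I. \<Sum>b\<in>I. moment a b a b i j k m) =
      (\<integral>U. (\<Sum>a\<in>I. \<Sum>b\<in>I. U (a, i) * U (b, j) * cnj (U (a, k)) * cnj (U (b, m))) \<partial>\<mu>)"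
    unfolding moment_def using mem by simp
  also have "\<dots> = (\<integral>U. (\<Sum>a\<in>I. cnj (U (a, k)) * U (a, i)) * (\<Sum>b\<in>I. cnj (U (b, m)) * U (b, j)) \<partial>\<mu>)"
    by (intro Bochner_Integration.integral_cong refl) (simp add: sum_product mult_ac)
  also have "\<dots> = (\<integral>U. of_bool (k = i) * of_bool (m = j) \<partial>\<mu>)"
    using mem by (intro Bochner_Integration.integral_cong refl) (simp add: space_haar unitary_columns)
  finally show "(\<Sum>a\<in>I. \<Sum>b\<in>I. moment a b a b i j k m) = of_bool (paired True i j k m)"
    by (auto simp: paired_def prob_space)
  have "(\<Sum>a\<in>I. \<Sum>b\<in>I. moment a b b a i j k m) =
      (\<integral>U. (\<Sum>a\<in>I. \<Sum>b\<in>I. U (a, i) * U (b, j) * cnj (U (b, k)) * cnj (U (a, m))) \<partial>\<mu>)"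
    unfolding moment_def using mem by simp
  also have "\<dots> = (\<integral>U. (\<Sum>a\<in>I. cnj (U (a, m)) * U (a, i)) * (\<Sum>b\<in>I. cnj (U (b, k)) * U (b, j)) \<partial>\<mu>)"
    by (intro Bochner_Integration.integral_cong refl) (simp add: sum_product mult_ac)
  also have "\<dots> = (\<integral>U. of_bool (m = i) * of_bool (k = j) \<partial>\<mu>)"
    using mem by (intro Bochner_Integration.integral_cong refl) (simp add: space_haar unitary_columns)
  finally show "(\<Sum>a\<in>I. \<Sum>b\<in>I. moment a b b a i j k m) = of_bool (paired False i j k m)"
    by (auto simp: paired_def prob_space)
qed

lemma sum_paired:
  "(\<Sum>a\<in>I. \<Sum>b\<in>I. of_bool (paired s a b a b) :: complex) = (if s then of_nat (card I) ^ 2 else of_nat (card I))"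
  "(\<Sum>a\<in>I. \<Sum>b\<in>I. of_bool (paired s a b b a) :: complex) = (if s then of_nat (card I) else of_nat (card I) ^ 2)"
proof -
  have "paired s a b a b \<longleftrightarrow> s \<or> a = b" "paired s a b b a \<longleftrightarrow> \<not> s \<or> a = b" for s and a b :: 'i
    by (auto simp: paired_def)
  then show "(\<Sum>a\<in>I. \<Sum>b\<in>I. of_bool (paired s a b a b) :: complex) = (if s then of_nat (card I) ^ 2 else of_nat (card I))"
    "(\<Sum>a\<in>I. \<Sum>b\<in>I. of_bool (paired s a b b a) :: complex) = (if s then of_nat (card I) else of_nat (card I) ^ 2)"
    using finite_I by (simp_all add: power2_eq_square of_bool_def)
qed

lemma moment_eq:
  assumes mem: "a \<in> I" "b \<in> I" "c \<in> I" "e \<in> I" "i \<in> I" "j \<in> I" "k \<in> I" "m \<in> I"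
  shows "moment a b c e i j k m = (\<Sum>s\<in>UNIV. \<Sum>t\<in>UNIV. of_real (weingarten (card I) (s = t)) *
    of_bool (paired s a b c e) * of_bool (paired t i j k m))"
proof -
  define n where "n = complex_of_nat (card I)"
  obtain p q where pq: "p \<in> I" "q \<in> I" "p \<noteq> q"
    using card_I card_le_Suc0_iff_eq[OF finite_I] by (metis not_less_eq_eq numeral_2_eq_2)
  have left: "moment a b c e i j k m = moment p q p q i j k m * of_bool (paired True a b c e) +
      moment p q q p i j k m * of_bool (paired False a b c e)"
    if "a \<in> I" "b \<in> I" "c \<in> I" "e \<in> I" "i \<in> I" "j \<in> I" "k \<in> I" "m \<in> I" for a b c e i j k m
    using that by (intro invariant_tensor[OF finite_I pq, where t = "\<lambda>a b c e. moment a b c e i j k m"]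
      moment_invariant_left)
  have right: "moment a b c e i j k m = moment a b c e p q p q * of_bool (paired True i j k m) +
      moment a b c e p q q p * of_bool (paired False i j k m)"
    if "a \<in> I" "b \<in> I" "c \<in> I" "e \<in> I" "i \<in> I" "j \<in> I" "k \<in> I" "m \<in> I" for a b c e i j k m
    using that by (intro invariant_tensor[OF finite_I pq, where t = "moment a b c e"] moment_invariant_right)
  let ?TT = "moment p q p q p q p q" and ?TF = "moment p q p q p q q p"
    and ?FT = "moment p q q p p q p q" and ?FF = "moment p q q p p q q p"
  \<comment> \<open>Inserting \<open>left\<close> into \<open>moment_contract\<close> yields, for
    fixed columns, a system for two unknowns whose matrix is the Gram matrix with entries n^2 and
    n.\<close>
  have contract: "n\<^sup>2 * moment p q p q i j k m + n * moment p q q p i j k m = of_bool (paired True i j k m)"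
    "n * moment p q p q i j k m + n\<^sup>2 * moment p q q p i j k m = of_bool (paired False i j k m)"
    if "i \<in> I" "j \<in> I" "k \<in> I" "m \<in> I" for i j k m
  proof -
    have "(\<Sum>a\<in>I. \<Sum>b\<in>I. moment a b a b i j k m) =
        (\<Sum>a\<in>I. \<Sum>b\<in>I. moment p q p q i j k m * of_bool (paired True a b a b) +
      moment p q q p i j k m * of_bool (paired False a b a b))"
      by (intro sum.cong refl left that)
    also have "\<dots> = n\<^sup>2 * moment p q p q i j k m + n * moment p q q p i j k m"
      by (simp add: sum.distrib sum_distrib_left[symmetric] sum_paired n_def)
    finally show "n\<^sup>2 * moment p q p q i j k m + n * moment p q q p i j k m = of_bool (paired True i j k m)"
      using moment_contract that by simp
    have "(\<Sum>a\<in>I. \<Sum>b\<in>I. moment a b b a i j k m) =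
        (\<Sum>a\<in>I. \<Sum>b\<in>I. moment p q p q i j k m * of_bool (paired True a b b a) +
      moment p q q p i j k m * of_bool (paired False a b b a))"
      by (intro sum.cong refl left that)
    also have "\<dots> = n * moment p q p q i j k m + n\<^sup>2 * moment p q q p i j k m"
      by (simp add: sum.distrib sum_distrib_left[symmetric] sum_paired n_def)
    finally show "n * moment p q p q i j k m + n\<^sup>2 * moment p q q p i j k m = of_bool (paired False i j k m)"
      using moment_contract that by simp
  qed
  have n0: "n \<noteq> 0" "n\<^sup>2 - 1 \<noteq> 0"
  proof -
    show "n \<noteq> 0" using card_I by (simp add: n_def)
    have "n \<noteq> 1" "n \<noteq> -1" using card_I by (auto simp: n_def complex_eq_iff)
    then show "n\<^sup>2 - 1 \<noteq> 0" by (simp add: power2_eq_1_iff)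
  qed
  have solve: "x = 1 / (n\<^sup>2 - 1)" "y = - 1 / (n * (n\<^sup>2 - 1))"
    if "n\<^sup>2 * x + n * y = 1" "n * x + n\<^sup>2 * y = 0" for x y
  proof -
    have "n * (x + n * y) = 0" using that(2) by (simp add: algebra_simps power2_eq_square)
    then have x: "x = - n * y" using n0 by (simp add: add_eq_0_iff2)
    then have "y * (n * (n\<^sup>2 - 1)) = - 1" using that(1) by (simp add: algebra_simps power2_eq_square)
    then show y: "y = - 1 / (n * (n\<^sup>2 - 1))" using n0 by (metis mult_eq_0_iff nonzero_eq_divide_eq)
    then show "x = 1 / (n\<^sup>2 - 1)" using x n0 by simp
  qed
  have "?TT = 1 / (n\<^sup>2 - 1)" "?FT = - 1 / (n * (n\<^sup>2 - 1))"
    using contract[OF pq(1,2,1,2)] pq by (intro solve; simp add: paired_def)+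
  moreover have "?FF = 1 / (n\<^sup>2 - 1)" "?TF = - 1 / (n * (n\<^sup>2 - 1))"
  proof -
    have "n\<^sup>2 * ?FF + n * ?TF = 1" "n * ?FF + n\<^sup>2 * ?TF = 0"
      using contract[OF pq(1,2,2,1)] pq by (simp_all add: paired_def add.commute)
    from solve[OF this] show "?FF = 1 / (n\<^sup>2 - 1)" "?TF = - 1 / (n * (n\<^sup>2 - 1))" .
  qed
  moreover have "n = complex_of_real (real (card I))" by (simp add: n_def)
  ultimately have eqs: "?TT = of_real (weingarten (card I) True)" "?FF = of_real (weingarten (card I) True)"
    "?TF = of_real (weingarten (card I) False)" "?FT = of_real (weingarten (card I) False)"
    by (simp_all add: weingarten_def)
  show ?thesis
    using left[OF mem] right[OF pq(1,2,1,2) mem(5-8)] right[OF pq(1,2,2,1) mem(5-8)]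
    by (simp add: UNIV_bool eqs algebra_simps)
qed

text \<open>Inserting the factor 1 = \<Sum>b |U(b, k)|^2, a consequence of unitarity, reduces this
  to \<open>moment_eq\<close> without a second invariance argument.\<close>

lemma moment1_eq:
  assumes mem: "a \<in> I" "c \<in> I" "i \<in> I" "k \<in> I"
  shows "(\<integral>U. U (a, i) * cnj (U (c, k)) \<partial>\<mu>) = of_bool (a = c) * of_bool (i = k) / of_nat (card I)"
proof -
  define n where "n = complex_of_nat (card I)"
  have "(\<integral>U. U (a, i) * cnj (U (c, k)) \<partial>\<mu>) =
      (\<integral>U. (\<Sum>b\<in>I. U (a, i) * U (b, k) * cnj (U (c, k)) * cnj (U (b, k))) \<partial>\<mu>)"
  proof (intro Bochner_Integration.integral_cong refl)
    fix U assume "U \<in> space \<mu>"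
    then have "(\<Sum>b\<in>I. cnj (U (b, k)) * U (b, k)) = 1"
      using mem by (simp add: space_haar unitary_columns)
    then have "U (a, i) * cnj (U (c, k)) = U (a, i) * cnj (U (c, k)) * (\<Sum>b\<in>I. cnj (U (b, k)) * U (b, k))"
      by simp
    also have "\<dots> = (\<Sum>b\<in>I. U (a, i) * U (b, k) * cnj (U (c, k)) * cnj (U (b, k)))"
      by (simp add: sum_distrib_left mult_ac)
    finally show "U (a, i) * cnj (U (c, k)) = (\<Sum>b\<in>I. U (a, i) * U (b, k) * cnj (U (c, k)) * cnj (U (b, k)))" .
  qed
  also have "\<dots> = (\<Sum>b\<in>I. moment a b c b i k k k)"
    unfolding moment_def using mem by simp
  \<comment> \<open>The columns \<open>i, k, k, k\<close> are paired in both ways or in none, so the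
    two Weingarten values are added. The rows \<open>a, b, c, b\<close> match the identity if
    \<open>a = c\<close>, and the swap only if also \<open>b = c\<close>.\<close>
  also have "\<dots> = (\<Sum>b\<in>I. of_bool (a = c) * of_bool (i = k) * (of_bool True + of_bool (b = c)) *
      (of_real (weingarten (card I) True) + of_real (weingarten (card I) False)))"
  proof (intro sum.cong refl)
    fix b assume b: "b \<in> I"
    show "moment a b c b i k k k = of_bool (a = c) * of_bool (i = k) * (of_bool True + of_bool (b = c)) *
      (of_real (weingarten (card I) True) + of_real (weingarten (card I) False))"
      using mem b by (cases "a = c"; cases "b = c"; cases "i = k")
        (simp_all add: moment_eq UNIV_bool paired_def algebra_simps)
  qed
  also have "\<dots> = of_bool (a = c) * of_bool (i = k) * ((n + 1) *
      (of_real (weingarten (card I) True) + of_real (weingarten (card I) False)))"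
    using mem finite_I
    by (simp add: sum_distrib_left[symmetric] sum_distrib_right[symmetric] sum.distrib n_def of_bool_def cong: if_cong)
  also have "(n + 1) * (of_real (weingarten (card I) True) + of_real (weingarten (card I) False)) =
      of_real ((real (card I) + 1) * (weingarten (card I) True + weingarten (card I) False))"
    by (simp add: n_def)
  also have "(real (card I) + 1) * (weingarten (card I) True + weingarten (card I) False) = 1 / real (card I)"
  proof -
    have *: "(real (card I))\<^sup>2 - 1 = (real (card I) + 1) * (real (card I) - 1)"
      by (simp add: algebra_simps power2_eq_square)
    show ?thesis using card_I unfolding weingarten_def * by (simp add: divide_simps)
  qed
  finally show ?thesis by simp
qed

end

subsection \<open>Averaging the purity over the site unitaries\<close>

text \<open>The Gram matrix of the two permutations acting on two copies of a q-dimensional space: q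
  to the number of cycles of their quotient.\<close>

definition overlap :: "nat \<Rightarrow> bool \<Rightarrow> bool \<Rightarrow> real" where
  "overlap q s t = (if s = t then real q ^ 2 else real q)"

text \<open>\<open>s\<close> is the row permutation of the site, \<open>x\<close> and
  \<open>y\<close> are those of its right and upper neighbours. The column permutation
  \<open>t\<close> meets only these and the physical leg, so it is summed out on the spot. Physical
  legs are closed by the swap in the region (\<open>a\<close> true) and by the identity
  elsewhere.\<close>

definition site_weight :: "nat \<Rightarrow> nat \<Rightarrow> bool \<Rightarrow> bool \<Rightarrow> bool \<Rightarrow> bool \<Rightarrow> real" where
  "site_weight D d a s x y = (\<Sum>t\<in>UNIV. weingarten (real (D * D * d)) (s = t) *
     overlap d (\<not> a) t * overlap D x t * overlap D y t)"

definition right :: "nat \<Rightarrow> site \<Rightarrow> site" where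
  "right L v = (fst v, (snd v + 1) mod L)"

definition up :: "nat \<Rightarrow> site \<Rightarrow> site" where
  "up L v = ((fst v + 1) mod L, snd v)"

definition exchange :: "site set \<Rightarrow> site set \<Rightarrow> (site \<Rightarrow> nat) \<Rightarrow> (site \<Rightarrow> nat) \<Rightarrow> (site \<Rightarrow> nat)" where
  "exchange V A j k = (\<lambda>v\<in>V. if v \<in> A then k v else j v)"

lemma finite_configs [simp]: "finite V \<Longrightarrow> finite (configs V q)"
  unfolding configs_def by (intro finite_PiE) auto

lemma card_configs: "finite V \<Longrightarrow> card (configs V q) = q ^ card V"
  unfolding configs_def by (simp add: card_PiE)

lemma exchange_in: "j \<in> configs V q \<Longrightarrow> k \<in> configs V q \<Longrightarrow> exchange V A j k \<in> configs V q"
  by (auto simp: configs_def exchange_def PiE_iff)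

lemma finite_torus [simp]: "finite (torus L)" by (simp add: torus_def)

lemma bij_betw_Suc_mod: "L > 0 \<Longrightarrow> bij_betw (\<lambda>x. Suc x mod L) {..<L} {..<L}"
proof -
  assume L: "L > 0"
  have "inj_on (\<lambda>x. Suc x mod L) {..<L}"
    by (rule inj_onI) (auto simp: mod_Suc split: if_splits)
  then show ?thesis using L by (intro bij_betw_imageI endo_inj_surj) auto
qed

lemma bij_right: "bij_betw (right L) (torus L) (torus L)"
proof (cases "L = 0")
  case False
  have "bij_betw (map_prod id (\<lambda>x. Suc x mod L)) (torus L) (torus L)"
    unfolding torus_def using False by (intro bij_betw_map_prod bij_betw_id bij_betw_Suc_mod) auto
  moreover have "map_prod id (\<lambda>x. Suc x mod L) = right L" by (auto simp: right_def fun_eq_iff)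
  ultimately show ?thesis by simp
qed (simp add: torus_def bij_betw_def)

lemma bij_up: "bij_betw (up L) (torus L) (torus L)"
proof (cases "L = 0")
  case False
  have "bij_betw (map_prod (\<lambda>x. Suc x mod L) id) (torus L) (torus L)"
    unfolding torus_def using False by (intro bij_betw_map_prod bij_betw_id bij_betw_Suc_mod) auto
  moreover have "map_prod (\<lambda>x. Suc x mod L) id = up L" by (auto simp: up_def fun_eq_iff)
  ultimately show ?thesis by simp
qed (simp add: torus_def bij_betw_def)

definition site_amp :: "nat \<Rightarrow> nat \<Rightarrow> (nat \<Rightarrow> complex) \<Rightarrow>
    (site \<Rightarrow> nat) \<times> (site \<Rightarrow> nat) \<Rightarrow> (site \<Rightarrow> nat) \<Rightarrow> site \<Rightarrow> site_op \<Rightarrow> complex" where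
  "site_amp L d \<phi> p j v u =
     site_tensor d \<phi> u (fst p v) (snd p v) (fst p (right L v)) (snd p (up L v)) (j v)"

lemma tn_state_eq:
  "tn_state L D d \<phi> U j =
     (\<Sum>p\<in>configs (torus L) D \<times> configs (torus L) D. \<Prod>v\<in>torus L. site_amp L d \<phi> p j v (U v))"
  by (simp add: tn_state_def sum.cartesian_product site_amp_def right_def up_def case_prod_unfold)

section \<open>The purity as a sum over pairs of configurations\<close>

lemma restrict_config: "j \<in> configs V q \<Longrightarrow> restrict j V = j"
  unfolding configs_def by (rule PiE_restrict)

lemma sum_configs_split:
  assumes "A \<subseteq> V"
  shows "(\<Sum>i\<in>configs A q. \<Sum>k\<in>configs (V - A) q. F i k) =
    (\<Sum>j\<in>configs V q. F (restrict j A) (restrict j (V - A)))"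
proof -
  have 1: "restrict (merge A (V - A) (i, k)) A = i" "restrict (merge A (V - A) (i, k)) (V - A) = k"
    "merge A (V - A) (i, k) \<in> configs V q"
    if "i \<in> configs A q" "k \<in> configs (V - A) q" for i k
    using that assms by (auto simp: configs_def PiE_iff merge_def extensional_def fun_eq_iff restrict_def)
  have 2: "merge A (V - A) (restrict j A, restrict j (V - A)) = j"
    "restrict j A \<in> configs A q" "restrict j (V - A) \<in> configs (V - A) q" if "j \<in> configs V q" for j
    using that assms by (auto simp: configs_def PiE_iff merge_def extensional_def fun_eq_iff restrict_def)
  show ?thesis
    unfolding sum.cartesian_product
    by (rule sum.reindex_bij_witness[where j = "merge A (V - A)" and i = "\<lambda>j. (restrict j A, restrict j (V - A))"])
      (auto simp: 1 2 restrict_config Un_absorb1 assms)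
qed

lemma reduced_op_ket_bra:
  assumes "A \<subseteq> V" "i \<in> configs A d" "i' \<in> configs A d"
  shows "reduced_op V d A (ket_bra (configs V d) \<psi>) (i, i') =
    (\<Sum>k\<in>configs (V - A) d. \<psi> (merge A (V - A) (i, k)) * cnj (\<psi> (merge A (V - A) (i', k))))"
proof -
  have "merge A (V - A) (i, k) \<in> configs V d" if "i \<in> configs A d" "k \<in> configs (V - A) d" for i k
    using that assms(1) by (auto simp: configs_def PiE_iff merge_def extensional_def)
  then show ?thesis using assms by (simp add: reduced_op_def ket_bra_def)
qed

lemma merge_restrict_exchange: "A \<subseteq> V \<Longrightarrow>
  merge A (V - A) (restrict j A, restrict k (V - A)) = exchange V A k j"
  by (auto simp: merge_def exchange_def fun_eq_iff)

lemma exchange_self: "j \<in> configs V q \<Longrightarrow> exchange V A j j = j"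
  by (auto simp: exchange_def configs_def PiE_iff extensional_def fun_eq_iff)

text \<open>The purity is the expectation of the swap of \<open>A\<close> in two copies of the
  state. The row index of either factor of the product, together with a traced index, forms one
  global configuration; the conjugated amplitudes see the same configurations with their parts in
  \<open>A\<close> exchanged.\<close>

lemma purity_reduced_op:
  assumes "finite V" "A \<subseteq> V"
  shows "purity (configs A d) (reduced_op V d A (ket_bra (configs V d) \<psi>)) =
    (\<Sum>j\<in>configs V d. \<Sum>k\<in>configs V d.
       \<psi> j * \<psi> k * cnj (\<psi> (exchange V A j k)) * cnj (\<psi> (exchange V A k j)))"
proof -
  let ?m = "\<lambda>i k. merge A (V - A) (i, k)"
  let ?G = "\<lambda>i k i' k'. \<psi> (?m i k) * \<psi> (?m i' k') * cnj (\<psi> (?m i' k)) * cnj (\<psi> (?m i k'))"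
  have "purity (configs A d) (reduced_op V d A (ket_bra (configs V d) \<psi>)) =
      (\<Sum>i\<in>configs A d. \<Sum>i'\<in>configs A d. \<Sum>k\<in>configs (V - A) d. \<Sum>k'\<in>configs (V - A) d. ?G i k i' k')"
    unfolding purity_def op_trace_def op_mult_def
    by (simp add: reduced_op_ket_bra assms sum_product mult_ac)
  also have "\<dots> = (\<Sum>i\<in>configs A d. \<Sum>k\<in>configs (V - A) d. \<Sum>i'\<in>configs A d. \<Sum>k'\<in>configs (V - A) d. ?G i k i' k')"
    by (intro sum.cong refl sum.swap)
  also have "\<dots> = (\<Sum>j\<in>configs V d. \<Sum>k\<in>configs V d.
      ?G (restrict j A) (restrict j (V - A)) (restrict k A) (restrict k (V - A)))"
    by (simp add: sum_configs_split assms(2))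
  also have "\<dots> = (\<Sum>j\<in>configs V d. \<Sum>k\<in>configs V d.
       \<psi> j * \<psi> k * cnj (\<psi> (exchange V A j k)) * cnj (\<psi> (exchange V A k j)))"
    by (intro sum.cong refl) (simp only: merge_restrict_exchange[OF assms(2)] exchange_self)
  finally show ?thesis .
qed

text \<open>Since the reduced matrix is Hermitian, its purity is the sum of the squared moduli of
  all entries. Dropping the off-diagonal ones and applying Cauchy--Schwarz to the trace, which is
  the squared norm of \<open>\<psi>\<close>, gives the inequality.\<close>

lemma purity_real_ge:
  fixes \<psi> :: "(site \<Rightarrow> nat) \<Rightarrow> complex" and d :: nat
  assumes "finite V" "A \<subseteq> V"
  defines "P \<equiv> purity (configs A d) (reduced_op V d A (ket_bra (configs V d) \<psi>))"
  shows "P \<in> \<real>" "(\<Sum>j\<in>configs V d. (cmod (\<psi> j))\<^sup>2)\<^sup>2 \<le> real d ^ card A * Re P"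
proof -
  define \<rho> where "\<rho> = reduced_op V d A (ket_bra (configs V d) \<psi>)"
  have fA: "finite A" using assms by (auto intro: finite_subset)
  have herm: "\<rho> (i', i) = cnj (\<rho> (i, i'))" if "i \<in> configs A d" "i' \<in> configs A d" for i i'
    using that by (simp add: \<rho>_def reduced_op_ket_bra assms mult.commute)
  have "P = (\<Sum>i\<in>configs A d. \<Sum>i'\<in>configs A d. \<rho> (i, i') * \<rho> (i', i))"
    by (simp add: P_def purity_def op_trace_def op_mult_def \<rho>_def)
  also have "\<dots> = (\<Sum>i\<in>configs A d. \<Sum>i'\<in>configs A d. of_real ((cmod (\<rho> (i, i')))\<^sup>2))"
    by (intro sum.cong refl) (metis herm complex_norm_square)
  also have "\<dots> = of_real (\<Sum>i\<in>configs A d. \<Sum>i'\<in>configs A d. (cmod (\<rho> (i, i')))\<^sup>2)"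
    by simp
  finally have P: "P = of_real (\<Sum>i\<in>configs A d. \<Sum>i'\<in>configs A d. (cmod (\<rho> (i, i')))\<^sup>2)" .
  then show "P \<in> \<real>" by simp
  have "complex_of_real (\<Sum>j\<in>configs V d. (cmod (\<psi> j))\<^sup>2) = (\<Sum>j\<in>configs V d. \<psi> j * cnj (\<psi> j))"
    by (simp add: complex_norm_square del: of_real_power)
  also have "\<dots> = (\<Sum>j\<in>configs V d. \<psi> (merge A (V - A) (restrict j A, restrict j (V - A))) *
      cnj (\<psi> (merge A (V - A) (restrict j A, restrict j (V - A)))))"
    by (intro sum.cong refl) (simp only: merge_restrict_exchange[OF assms(2)] exchange_self)
  also have "\<dots> = (\<Sum>i\<in>configs A d. \<Sum>k\<in>configs (V - A) d.
      \<psi> (merge A (V - A) (i, k)) * cnj (\<psi> (merge A (V - A) (i, k))))"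
    by (rule sum_configs_split[symmetric]) (rule assms)
  also have "\<dots> = (\<Sum>i\<in>configs A d. \<rho> (i, i))"
    by (simp add: \<rho>_def reduced_op_ket_bra assms)
  finally have "cmod (of_real (\<Sum>j\<in>configs V d. (cmod (\<psi> j))\<^sup>2)) = cmod (\<Sum>i\<in>configs A d. \<rho> (i, i))"
    by (rule arg_cong)
  then have "(\<Sum>j\<in>configs V d. (cmod (\<psi> j))\<^sup>2) = cmod (\<Sum>i\<in>configs A d. \<rho> (i, i))"
    by (simp only: norm_of_real abs_of_nonneg[OF sum_nonneg[OF zero_le_power2]])
  also have "\<dots> \<le> (\<Sum>i\<in>configs A d. cmod (\<rho> (i, i)))" by (rule norm_sum)
  finally have "(\<Sum>j\<in>configs V d. (cmod (\<psi> j))\<^sup>2)\<^sup>2 \<le> (\<Sum>i\<in>configs A d. cmod (\<rho> (i, i)))\<^sup>2"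
    by (intro power_mono sum_nonneg) auto
  also have "\<dots> \<le> real (card (configs A d)) * (\<Sum>i\<in>configs A d. (cmod (\<rho> (i, i)))\<^sup>2)"
    using sum_squared_le_sum_of_squares[of "\<lambda>i. cmod (\<rho> (i, i))" "configs A d"] fA
    by (simp add: mult.commute)
  also have "(\<Sum>i\<in>configs A d. (cmod (\<rho> (i, i)))\<^sup>2) \<le> Re P"
    unfolding P Re_complex_of_real
    by (intro sum_mono member_le_sum) (use fA in auto)
  finally show "(\<Sum>j\<in>configs V d. (cmod (\<psi> j))\<^sup>2)\<^sup>2 \<le> real d ^ card A * Re P"
    by (simp add: card_configs fA mult_left_mono)
qed

section \<open>Summing out bond and physical indices\<close>

lemma sum_PiE_prod4:
  fixes f :: "'v \<Rightarrow> 'x \<Rightarrow> 'x \<Rightarrow> 'x \<Rightarrow> 'x \<Rightarrow> 'b::comm_semiring_1"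
  assumes "finite V" "finite X"
  shows "(\<Sum>a\<in>V \<rightarrow>\<^sub>E X. \<Sum>b\<in>V \<rightarrow>\<^sub>E X. \<Sum>c\<in>V \<rightarrow>\<^sub>E X. \<Sum>e\<in>V \<rightarrow>\<^sub>E X. \<Prod>v\<in>V. f v (a v) (b v) (c v) (e v)) =
    (\<Prod>v\<in>V. \<Sum>a\<in>X. \<Sum>b\<in>X. \<Sum>c\<in>X. \<Sum>e\<in>X. f v a b c e)"
  by (simp add: prod_sum_PiE assms)

lemma sum_UNIV_bool: "(\<Sum>b\<in>UNIV. f b) = f False + f True"
  by (simp add: UNIV_bool)

lemma sum_delta2:
  fixes q r :: nat and u :: "'b::comm_monoid_add"
  assumes "x < q" "y < r"
  shows "(\<Sum>c<q. \<Sum>e<r. if c = x then if e = y then u else 0 else 0) = u"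
proof -
  have "(\<Sum>c<q. \<Sum>e<r. if c = x then if e = y then u else 0 else 0) = (\<Sum>c<q. if c = x then u else 0)"
    using assms by (intro sum.cong refl) simp
  then show ?thesis using assms by simp
qed

lemma sum_paired_paired:
  "(\<Sum>a<q. \<Sum>b<q. \<Sum>c<q. \<Sum>e<q. of_bool (paired s a b c e) * of_bool (paired t a b c e)) =
    complex_of_real (overlap q s t)"
proof -
  have *: "(\<Sum>c<q. \<Sum>e<q. of_bool (paired s a b c e) * of_bool (paired t a b c e)) =
      (if s = t \<or> a = b then 1 else 0 :: complex)" if "a < q" "b < q" for a b
  proof -
    let ?c = "if s then a else b" and ?e = "if s then b else a"
    have "(\<Sum>c<q. \<Sum>e<q. of_bool (paired s a b c e) * of_bool (paired t a b c e)) =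
        (\<Sum>c<q. \<Sum>e<q. if c = ?c then (if e = ?e then of_bool (paired t a b ?c ?e) else 0) else (0 :: complex))"
      by (intro sum.cong refl) (auto simp: paired_def)
    also have "\<dots> = of_bool (paired t a b ?c ?e)"
      using that by (intro sum_delta2) auto
    also have "\<dots> = (if s = t \<or> a = b then 1 else 0)" by (auto simp: paired_def)
    finally show ?thesis .
  qed
  have "(\<Sum>a<q. \<Sum>b<q. \<Sum>c<q. \<Sum>e<q. of_bool (paired s a b c e) * of_bool (paired t a b c e)) =
      (\<Sum>a<q. \<Sum>b<q. if s = t \<or> a = b then 1 else (0 :: complex))"
    by (intro sum.cong refl *) auto
  also have "\<dots> = of_real (overlap q s t)"
    by (cases "s = t") (simp_all add: overlap_def power2_eq_square)
  finally show ?thesis .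
qed

lemma sum_paired_exchange:
  "(\<Sum>j<q. \<Sum>k<q. of_bool (paired t j k (if a then k else j) (if a then j else k))) =
    complex_of_real (overlap q (\<not> a) t)"
proof -
  have "(\<Sum>j<q. \<Sum>k<q. of_bool (paired t j k (if a then k else j) (if a then j else k))) =
      (\<Sum>j<q. \<Sum>k<q. if (\<not> a) = t \<or> j = k then 1 else (0 :: complex))"
    by (intro sum.cong refl) (auto simp: paired_def)
  also have "\<dots> = of_real (overlap q (\<not> a) t)"
    by (cases "(\<not> a) = t") (auto simp: overlap_def power2_eq_square)
  finally show ?thesis .
qed

text \<open>A bond variable at \<open>v\<close> occurs twice: among the row indices of
  \<open>v\<close> and among the column indices of the preimage of \<open>v\<close> under
  \<open>r\<close>. Reindexing the second factor by the inverse of \<open>r\<close> brings both to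
  the same site, where the sum is a single overlap.\<close>

lemma bond_sum:
  assumes "finite V" "bij_betw r V V"
  shows "(\<Sum>a\<in>configs V q. \<Sum>b\<in>configs V q. \<Sum>c\<in>configs V q. \<Sum>e\<in>configs V q.
      \<Prod>v\<in>V. of_bool (paired (\<sigma> v) (a v) (b v) (c v) (e v)) *
        of_bool (paired (\<tau> v) (a (r v)) (b (r v)) (c (r v)) (e (r v)))) =
    (\<Prod>v\<in>V. complex_of_real (overlap q (\<sigma> (r v)) (\<tau> v)))"
proof -
  define r' where "r' = the_inv_into V r"
  have r': "r' (r v) = v" if "v \<in> V" for v
    using that assms by (simp add: r'_def the_inv_into_f_f bij_betw_def)
  have re: "(\<Prod>v\<in>V. F v (r v)) = (\<Prod>v\<in>V. F (r' v) v)" for F :: "site \<Rightarrow> site \<Rightarrow> complex"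
    using prod.reindex_bij_betw[OF assms(2), of "\<lambda>v. F (r' v) v"] r' by simp
  have "(\<Prod>v\<in>V. of_bool (paired (\<sigma> v) (a v) (b v) (c v) (e v)) *
        of_bool (paired (\<tau> v) (a (r v)) (b (r v)) (c (r v)) (e (r v)))) =
      (\<Prod>v\<in>V. of_bool (paired (\<sigma> v) (a v) (b v) (c v) (e v)) *
        (of_bool (paired (\<tau> (r' v)) (a v) (b v) (c v) (e v)) :: complex))" for a b c e :: "site \<Rightarrow> nat"
    using re[of "\<lambda>v w. of_bool (paired (\<tau> v) (a w) (b w) (c w) (e w))"] by (simp add: prod.distrib)
  then have "(\<Sum>a\<in>configs V q. \<Sum>b\<in>configs V q. \<Sum>c\<in>configs V q. \<Sum>e\<in>configs V q.
      \<Prod>v\<in>V. of_bool (paired (\<sigma> v) (a v) (b v) (c v) (e v)) *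
        of_bool (paired (\<tau> v) (a (r v)) (b (r v)) (c (r v)) (e (r v)))) =
      (\<Prod>v\<in>V. complex_of_real (overlap q (\<sigma> v) (\<tau> (r' v))))"
    unfolding configs_def
    using sum_PiE_prod4[OF assms(1), of "{..<q}" "\<lambda>v a b c e. of_bool (paired (\<sigma> v) a b c e) *
      (of_bool (paired (\<tau> (r' v)) a b c e) :: complex)"]
    by (simp only: sum_paired_paired finite_lessThan simp_thms)
  then show ?thesis using re[of "\<lambda>v w. complex_of_real (overlap q (\<sigma> w) (\<tau> v))"] by simp
qed

text \<open>Decouples the two bond directions: \<open>F\<close> collects the first and
  \<open>G\<close> the second components of the bond configurations.\<close>

lemma sum_pairs4:
  fixes F G :: "'a \<Rightarrow> 'a \<Rightarrow> 'a \<Rightarrow> 'a \<Rightarrow> 'c::comm_semiring_1"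
  shows "(\<Sum>p\<in>X \<times> X. \<Sum>q\<in>X \<times> X. \<Sum>p'\<in>X \<times> X. \<Sum>q'\<in>X \<times> X.
      F (fst p) (fst q) (fst p') (fst q') * G (snd p) (snd q) (snd p') (snd q')) =
    (\<Sum>a\<in>X. \<Sum>b\<in>X. \<Sum>c\<in>X. \<Sum>e\<in>X. F a b c e) * (\<Sum>a\<in>X. \<Sum>b\<in>X. \<Sum>c\<in>X. \<Sum>e\<in>X. G a b c e)"
proof -
  have *: "(\<Sum>p\<in>X \<times> X. f (fst p) * g (snd p)) = sum f X * sum g X" for f g :: "'a \<Rightarrow> 'c"
    by (simp add: sum_product sum.cartesian_product case_prod_unfold)
  show ?thesis
    by (simp only: *[of "F x y z" "G x' y' z'" for x y z x' y' z']
        *[of "\<lambda>c. \<Sum>e\<in>X. F x y c e" "\<lambda>c. \<Sum>e\<in>X. G x' y' c e" for x y x' y']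
        *[of "\<lambda>b. \<Sum>c\<in>X. \<Sum>e\<in>X. F x b c e" "\<lambda>b. \<Sum>c\<in>X. \<Sum>e\<in>X. G x' b c e" for x x']
        *[of "\<lambda>a. \<Sum>b\<in>X. \<Sum>c\<in>X. \<Sum>e\<in>X. F a b c e" "\<lambda>a. \<Sum>b\<in>X. \<Sum>c\<in>X. \<Sum>e\<in>X. G a b c e"])
qed

lemma prod_sum_bool2:
  fixes g :: "'v \<Rightarrow> bool \<Rightarrow> bool \<Rightarrow> 'c::comm_semiring_1"
  assumes "finite V"
  shows "(\<Prod>v\<in>V. \<Sum>s\<in>UNIV. \<Sum>t\<in>UNIV. g v s t) =
    (\<Sum>\<sigma>\<in>V \<rightarrow>\<^sub>E UNIV. \<Sum>\<tau>\<in>V \<rightarrow>\<^sub>E UNIV. \<Prod>v\<in>V. g v (\<sigma> v) (\<tau> v))"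
  using assms by (simp add: prod_sum_PiE)

lemma site_tensor_cnj: "cnj (site_tensor d \<phi> U \<alpha> \<beta> \<gamma> \<kappa> j) = (\<Sum>k<d. \<phi> k * cnj (U ((\<alpha>, \<beta>, k), (\<gamma>, \<kappa>, j))))"
  by (simp add: site_tensor_def)

lemma paired_Pair: "paired s (a, a') (b, b') (c, c') (e, e') \<longleftrightarrow> paired s a b c e \<and> paired s a' b' c' e'"
  by (auto simp: paired_def)

lemma sum_cnj_unit_vector:
  assumes "unit_vector d \<phi>"
  shows "(\<Sum>k<d. cnj (\<phi> k) * \<phi> k) = 1"
proof -
  have "(\<Sum>k<d. cnj (\<phi> k) * \<phi> k) = complex_of_real (\<Sum>k<d. (cmod (\<phi> k))\<^sup>2)"
    by (simp add: complex_norm_square mult.commute del: of_real_power)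
  then show ?thesis using assms by (simp only: unit_vector_def of_real_1)
qed

text \<open>Two copies of the reference vector are fixed by the swap, so the reference leg
  contributes 1 for either pairing. Hence the replica model does not depend on
  \<open>\<phi>\<close>.\<close>

lemma sum_paired_unit_vector:
  assumes "unit_vector d \<phi>"
  shows "(\<Sum>a<d. \<Sum>b<d. \<Sum>c<d. \<Sum>e<d. cnj (\<phi> a) * cnj (\<phi> b) * \<phi> c * \<phi> e * of_bool (paired s a b c e)) = 1"
proof -
  have norm: "(\<Sum>k<d. cnj (\<phi> k) * \<phi> k) = 1"
  using assms by (rule sum_cnj_unit_vector)
  have "(\<Sum>c<d. \<Sum>e<d. cnj (\<phi> a) * cnj (\<phi> b) * \<phi> c * \<phi> e * of_bool (paired s a b c e)) =
      cnj (\<phi> a) * \<phi> a * (cnj (\<phi> b) * \<phi> b)" if "a < d" "b < d" for a b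
  proof -
    let ?c = "if s then a else b" and ?e = "if s then b else a"
    have "(\<Sum>c<d. \<Sum>e<d. cnj (\<phi> a) * cnj (\<phi> b) * \<phi> c * \<phi> e * of_bool (paired s a b c e)) =
      (\<Sum>c<d. \<Sum>e<d. if c = ?c then (if e = ?e then cnj (\<phi> a) * \<phi> a * (cnj (\<phi> b) * \<phi> b) else 0) else 0)"
      by (intro sum.cong refl) (auto simp: paired_def)
    also have "\<dots> = cnj (\<phi> a) * \<phi> a * (cnj (\<phi> b) * \<phi> b)"
      using that by (intro sum_delta2) auto
    finally show ?thesis .
  qed
  then have "(\<Sum>a<d. \<Sum>b<d. \<Sum>c<d. \<Sum>e<d. cnj (\<phi> a) * cnj (\<phi> b) * \<phi> c * \<phi> e * of_bool (paired s a b c e)) =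
      (\<Sum>a<d. \<Sum>b<d. cnj (\<phi> a) * \<phi> a * (cnj (\<phi> b) * \<phi> b))"
    by (intro sum.cong refl) auto
  also have "\<dots> = 1" by (simp add: sum_product[symmetric] norm)
  finally show ?thesis .
qed

lemma integral_sum2:
  fixes f :: "'a \<Rightarrow> 'b \<Rightarrow> 'x \<Rightarrow> complex"
  assumes "\<And>a b. a \<in> A \<Longrightarrow> b \<in> B \<Longrightarrow> integrable M (f a b)"
  shows "(\<integral>x. (\<Sum>a\<in>A. \<Sum>b\<in>B. u a b * f a b x) \<partial>M) = (\<Sum>a\<in>A. \<Sum>b\<in>B. u a b * (\<integral>x. f a b x \<partial>M))"
  using assms by simp

lemma integral_sum4:
  fixes f :: "'a \<Rightarrow> 'b \<Rightarrow> 'c \<Rightarrow> 'e \<Rightarrow> 'x \<Rightarrow> complex"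
  assumes "\<And>a b c e. a \<in> A \<Longrightarrow> b \<in> B \<Longrightarrow> c \<in> C \<Longrightarrow> e \<in> E \<Longrightarrow> integrable M (f a b c e)"
  shows "(\<integral>x. (\<Sum>a\<in>A. \<Sum>b\<in>B. \<Sum>c\<in>C. \<Sum>e\<in>E. u a b c e * f a b c e x) \<partial>M) =
    (\<Sum>a\<in>A. \<Sum>b\<in>B. \<Sum>c\<in>C. \<Sum>e\<in>E. u a b c e * (\<integral>x. f a b c e x \<partial>M))"
  using assms by simp

section \<open>Moments of a single site tensor\<close>

locale random_site = haar "legs D d" \<mu> for D d :: nat and \<mu> :: "site_op measure" +
  fixes \<phi> :: "nat \<Rightarrow> complex"
  assumes unit: "unit_vector d \<phi>"
begin

lemma card_legs: "card (legs D d) = D * D * d"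
  by (simp add: legs_def)

lemma measurable_site_tensor [measurable]:
  assumes "\<alpha> < D" "\<beta> < D" "\<gamma> < D" "\<kappa> < D" "j < d"
  shows "(\<lambda>U. site_tensor d \<phi> U \<alpha> \<beta> \<gamma> \<kappa> j) \<in> borel_measurable \<mu>"
  unfolding site_tensor_def using assms by (intro borel_measurable_sum borel_measurable_times
    borel_measurable_const measurable_entry) (auto simp: legs_def)

lemma integrable_bounded:
  fixes F :: "site_op \<Rightarrow> complex"
  assumes "F \<in> borel_measurable \<mu>" "\<And>U. U \<in> unitary_group (legs D d) \<Longrightarrow> cmod (F U) \<le> B"
  shows "integrable \<mu> F"
  using assms by (intro integrable_const_bound[where B = B]) (auto simp: space_haar)

lemma site_tensor_bound:
  assumes "\<alpha> < D" "\<beta> < D" "\<gamma> < D" "\<kappa> < D" "j < d" "U \<in> unitary_group (legs D d)"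
  shows "cmod (site_tensor d \<phi> U \<alpha> \<beta> \<gamma> \<kappa> j) \<le> (\<Sum>k<d. cmod (\<phi> k))"
  unfolding site_tensor_def
proof (rule order_trans[OF norm_sum] sum_mono)+
  fix k assume "k \<in> {..<d}"
  then have "cmod (U ((\<alpha>, \<beta>, k), \<gamma>, \<kappa>, j)) \<le> 1"
    using assms by (intro unitary_entry_le_1[OF finite_I]) (auto simp: legs_def)
  then show "cmod (cnj (\<phi> k) * U ((\<alpha>, \<beta>, k), \<gamma>, \<kappa>, j)) \<le> cmod (\<phi> k)"
    by (simp add: norm_mult mult_left_le)
qed

text \<open>A pairing of index triples is a pairing in each component, so every term of
  \<open>moment_eq\<close> splits into one factor per leg; the reference leg then sums to 1.\<close>

lemma site_moment:
  assumes "a\<^sub>1 < D" "b\<^sub>1 < D" "g\<^sub>1 < D" "h\<^sub>1 < D" "j\<^sub>1 < d" "a\<^sub>2 < D" "b\<^sub>2 < D" "g\<^sub>2 < D" "h\<^sub>2 < D" "j\<^sub>2 < d"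
    "a\<^sub>3 < D" "b\<^sub>3 < D" "g\<^sub>3 < D" "h\<^sub>3 < D" "j\<^sub>3 < d" "a\<^sub>4 < D" "b\<^sub>4 < D" "g\<^sub>4 < D" "h\<^sub>4 < D" "j\<^sub>4 < d"
  shows "(\<integral>U. site_tensor d \<phi> U a\<^sub>1 b\<^sub>1 g\<^sub>1 h\<^sub>1 j\<^sub>1 * site_tensor d \<phi> U a\<^sub>2 b\<^sub>2 g\<^sub>2 h\<^sub>2 j\<^sub>2 *
      cnj (site_tensor d \<phi> U a\<^sub>3 b\<^sub>3 g\<^sub>3 h\<^sub>3 j\<^sub>3) * cnj (site_tensor d \<phi> U a\<^sub>4 b\<^sub>4 g\<^sub>4 h\<^sub>4 j\<^sub>4) \<partial>\<mu>) =
    (\<Sum>s\<in>UNIV. \<Sum>t\<in>UNIV. of_real (weingarten (real (D * D * d)) (s = t)) * of_bool (paired t j\<^sub>1 j\<^sub>2 j\<^sub>3 j\<^sub>4) *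
      (of_bool (paired s a\<^sub>1 a\<^sub>2 a\<^sub>3 a\<^sub>4) * of_bool (paired t g\<^sub>1 g\<^sub>2 g\<^sub>3 g\<^sub>4)) *
      (of_bool (paired s b\<^sub>1 b\<^sub>2 b\<^sub>3 b\<^sub>4) * of_bool (paired t h\<^sub>1 h\<^sub>2 h\<^sub>3 h\<^sub>4)))" (is "?l = ?r")
proof -
  let ?c = "\<lambda>k\<^sub>1 k\<^sub>2 k\<^sub>3 k\<^sub>4. cnj (\<phi> k\<^sub>1) * cnj (\<phi> k\<^sub>2) * \<phi> k\<^sub>3 * \<phi> k\<^sub>4"
  have "?l = (\<integral>U. (\<Sum>k\<^sub>1<d. \<Sum>k\<^sub>2<d. \<Sum>k\<^sub>3<d. \<Sum>k\<^sub>4<d. ?c k\<^sub>1 k\<^sub>2 k\<^sub>3 k\<^sub>4 *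
      (U ((a\<^sub>1, b\<^sub>1, k\<^sub>1), (g\<^sub>1, h\<^sub>1, j\<^sub>1)) * U ((a\<^sub>2, b\<^sub>2, k\<^sub>2), (g\<^sub>2, h\<^sub>2, j\<^sub>2)) *
       cnj (U ((a\<^sub>3, b\<^sub>3, k\<^sub>3), (g\<^sub>3, h\<^sub>3, j\<^sub>3))) * cnj (U ((a\<^sub>4, b\<^sub>4, k\<^sub>4), (g\<^sub>4, h\<^sub>4, j\<^sub>4))))) \<partial>\<mu>)"
    unfolding site_tensor_cnj unfolding site_tensor_def sum_product4
    by (intro Bochner_Integration.integral_cong refl sum.cong) (simp add: mult_ac)
  also have "\<dots> = (\<Sum>k\<^sub>1<d. \<Sum>k\<^sub>2<d. \<Sum>k\<^sub>3<d. \<Sum>k\<^sub>4<d. ?c k\<^sub>1 k\<^sub>2 k\<^sub>3 k\<^sub>4 *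
      moment (a\<^sub>1, b\<^sub>1, k\<^sub>1) (a\<^sub>2, b\<^sub>2, k\<^sub>2) (a\<^sub>3, b\<^sub>3, k\<^sub>3) (a\<^sub>4, b\<^sub>4, k\<^sub>4)
        (g\<^sub>1, h\<^sub>1, j\<^sub>1) (g\<^sub>2, h\<^sub>2, j\<^sub>2) (g\<^sub>3, h\<^sub>3, j\<^sub>3) (g\<^sub>4, h\<^sub>4, j\<^sub>4))"
    unfolding moment_def using assms by (intro integral_sum4 integrable_moment) (auto simp: legs_def)
  also have "\<dots> = (\<Sum>k\<^sub>1<d. \<Sum>k\<^sub>2<d. \<Sum>k\<^sub>3<d. \<Sum>k\<^sub>4<d. \<Sum>s\<in>UNIV. \<Sum>t\<in>UNIV.
      (of_real (weingarten (real (D * D * d)) (s = t)) * of_bool (paired t j\<^sub>1 j\<^sub>2 j\<^sub>3 j\<^sub>4) *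
      (of_bool (paired s a\<^sub>1 a\<^sub>2 a\<^sub>3 a\<^sub>4) * of_bool (paired t g\<^sub>1 g\<^sub>2 g\<^sub>3 g\<^sub>4)) *
      (of_bool (paired s b\<^sub>1 b\<^sub>2 b\<^sub>3 b\<^sub>4) * of_bool (paired t h\<^sub>1 h\<^sub>2 h\<^sub>3 h\<^sub>4))) *
      (?c k\<^sub>1 k\<^sub>2 k\<^sub>3 k\<^sub>4 * of_bool (paired s k\<^sub>1 k\<^sub>2 k\<^sub>3 k\<^sub>4)))"
  proof (intro sum.cong refl)
    fix k\<^sub>1 k\<^sub>2 k\<^sub>3 k\<^sub>4
    assume k: "k\<^sub>1 \<in> {..<d}" "k\<^sub>2 \<in> {..<d}" "k\<^sub>3 \<in> {..<d}" "k\<^sub>4 \<in> {..<d}"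
    have "moment (a\<^sub>1, b\<^sub>1, k\<^sub>1) (a\<^sub>2, b\<^sub>2, k\<^sub>2) (a\<^sub>3, b\<^sub>3, k\<^sub>3) (a\<^sub>4, b\<^sub>4, k\<^sub>4)
        (g\<^sub>1, h\<^sub>1, j\<^sub>1) (g\<^sub>2, h\<^sub>2, j\<^sub>2) (g\<^sub>3, h\<^sub>3, j\<^sub>3) (g\<^sub>4, h\<^sub>4, j\<^sub>4) =
      (\<Sum>s\<in>UNIV. \<Sum>t\<in>UNIV. of_real (weingarten (card (legs D d)) (s = t)) *
        of_bool (paired s (a\<^sub>1, b\<^sub>1, k\<^sub>1) (a\<^sub>2, b\<^sub>2, k\<^sub>2) (a\<^sub>3, b\<^sub>3, k\<^sub>3) (a\<^sub>4, b\<^sub>4, k\<^sub>4)) *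
        of_bool (paired t (g\<^sub>1, h\<^sub>1, j\<^sub>1) (g\<^sub>2, h\<^sub>2, j\<^sub>2) (g\<^sub>3, h\<^sub>3, j\<^sub>3) (g\<^sub>4, h\<^sub>4, j\<^sub>4)))"
      by (rule moment_eq) (use assms k in \<open>auto simp: legs_def\<close>)
    then show "?c k\<^sub>1 k\<^sub>2 k\<^sub>3 k\<^sub>4 * moment (a\<^sub>1, b\<^sub>1, k\<^sub>1) (a\<^sub>2, b\<^sub>2, k\<^sub>2) (a\<^sub>3, b\<^sub>3, k\<^sub>3) (a\<^sub>4, b\<^sub>4, k\<^sub>4)
        (g\<^sub>1, h\<^sub>1, j\<^sub>1) (g\<^sub>2, h\<^sub>2, j\<^sub>2) (g\<^sub>3, h\<^sub>3, j\<^sub>3) (g\<^sub>4, h\<^sub>4, j\<^sub>4) =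
      (\<Sum>s\<in>UNIV. \<Sum>t\<in>UNIV.
      (of_real (weingarten (real (D * D * d)) (s = t)) * of_bool (paired t j\<^sub>1 j\<^sub>2 j\<^sub>3 j\<^sub>4) *
      (of_bool (paired s a\<^sub>1 a\<^sub>2 a\<^sub>3 a\<^sub>4) * of_bool (paired t g\<^sub>1 g\<^sub>2 g\<^sub>3 g\<^sub>4)) *
      (of_bool (paired s b\<^sub>1 b\<^sub>2 b\<^sub>3 b\<^sub>4) * of_bool (paired t h\<^sub>1 h\<^sub>2 h\<^sub>3 h\<^sub>4))) *
      (?c k\<^sub>1 k\<^sub>2 k\<^sub>3 k\<^sub>4 * of_bool (paired s k\<^sub>1 k\<^sub>2 k\<^sub>3 k\<^sub>4)))"
      by (simp only: sum_distrib_left paired_Pair of_bool_conj card_legs mult_ac)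
  qed
  also have "\<dots> = (\<Sum>s\<in>UNIV. \<Sum>t\<in>UNIV.
      (of_real (weingarten (real (D * D * d)) (s = t)) * of_bool (paired t j\<^sub>1 j\<^sub>2 j\<^sub>3 j\<^sub>4) *
      (of_bool (paired s a\<^sub>1 a\<^sub>2 a\<^sub>3 a\<^sub>4) * of_bool (paired t g\<^sub>1 g\<^sub>2 g\<^sub>3 g\<^sub>4)) *
      (of_bool (paired s b\<^sub>1 b\<^sub>2 b\<^sub>3 b\<^sub>4) * of_bool (paired t h\<^sub>1 h\<^sub>2 h\<^sub>3 h\<^sub>4))) *
      (\<Sum>k\<^sub>1<d. \<Sum>k\<^sub>2<d. \<Sum>k\<^sub>3<d. \<Sum>k\<^sub>4<d. ?c k\<^sub>1 k\<^sub>2 k\<^sub>3 k\<^sub>4 * of_bool (paired s k\<^sub>1 k\<^sub>2 k\<^sub>3 k\<^sub>4)))"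
    by (simp only: sum_UNIV_bool sum.distrib sum_distrib_left)
  also have "\<dots> = ?r" by (simp only: sum_paired_unit_vector[OF unit] mult_1_right)
  finally show ?thesis .
qed

lemma site_moment1:
  assumes "a\<^sub>1 < D" "b\<^sub>1 < D" "g\<^sub>1 < D" "h\<^sub>1 < D" "j < d" "a\<^sub>2 < D" "b\<^sub>2 < D" "g\<^sub>2 < D" "h\<^sub>2 < D"
  shows "(\<integral>U. site_tensor d \<phi> U a\<^sub>1 b\<^sub>1 g\<^sub>1 h\<^sub>1 j * cnj (site_tensor d \<phi> U a\<^sub>2 b\<^sub>2 g\<^sub>2 h\<^sub>2 j) \<partial>\<mu>) =
    (if a\<^sub>1 = a\<^sub>2 \<and> b\<^sub>1 = b\<^sub>2 \<and> g\<^sub>1 = g\<^sub>2 \<and> h\<^sub>1 = h\<^sub>2 then 1 / of_nat (D * D * d) else 0)" (is "?l = ?r")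
proof -
  have int: "integrable \<mu> (\<lambda>U. U (a, i) * cnj (U (c, k)))"
    if "a \<in> legs D d" "c \<in> legs D d" "i \<in> legs D d" "k \<in> legs D d" for a c i k
    using that by (intro integrable_bounded[where B = 1])
      (auto simp: norm_mult intro!: mult_le_one unitary_entry_le_1 finite_I)
  have norm: "(\<Sum>k<d. cnj (\<phi> k) * \<phi> k) = 1"
  using unit by (rule sum_cnj_unit_vector)
  have "?l = (\<integral>U. (\<Sum>k<d. \<Sum>k'<d. cnj (\<phi> k) * \<phi> k' *
      (U ((a\<^sub>1, b\<^sub>1, k), (g\<^sub>1, h\<^sub>1, j)) * cnj (U ((a\<^sub>2, b\<^sub>2, k'), (g\<^sub>2, h\<^sub>2, j))))) \<partial>\<mu>)"
    unfolding site_tensor_cnj unfolding site_tensor_def sum_product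
    by (intro Bochner_Integration.integral_cong refl sum.cong) (simp add: mult_ac)
  also have "\<dots> = (\<Sum>k<d. \<Sum>k'<d. cnj (\<phi> k) * \<phi> k' *
      (\<integral>U. U ((a\<^sub>1, b\<^sub>1, k), (g\<^sub>1, h\<^sub>1, j)) * cnj (U ((a\<^sub>2, b\<^sub>2, k'), (g\<^sub>2, h\<^sub>2, j))) \<partial>\<mu>))"
    using assms by (intro integral_sum2 int) (auto simp: legs_def)
  also have "\<dots> = (\<Sum>k<d. \<Sum>k'<d. if k = k' then cnj (\<phi> k) * \<phi> k * ?r else 0)"
    using assms by (intro sum.cong refl) (subst moment1_eq, auto simp: legs_def card_legs[symmetric])
  also have "\<dots> = (\<Sum>k<d. cnj (\<phi> k) * \<phi> k) * ?r"
    by (simp only: sum_distrib_right) (intro sum.cong refl, simp)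
  finally show ?thesis using norm by simp
qed


end

section \<open>The network average as a replica sum\<close>

locale random_network = random_site D d \<mu> \<phi> for D d :: nat and \<mu> :: "site_op measure" and \<phi> +
  fixes L :: nat
begin

abbreviation bonds :: "((site \<Rightarrow> nat) \<times> (site \<Rightarrow> nat)) set" where
  "bonds \<equiv> configs (torus L) D \<times> configs (torus L) D"

abbreviation ensemble :: "(site \<Rightarrow> site_op) measure" where
  "ensemble \<equiv> \<Pi>\<^sub>M v\<in>torus L. \<mu>"

lemma torus_shift: "v \<in> torus L \<Longrightarrow> right L v \<in> torus L" "v \<in> torus L \<Longrightarrow> up L v \<in> torus L"
  by (auto simp: torus_def right_def up_def)

lemma bond_less:
  assumes "p \<in> bonds" "v \<in> torus L"
  shows "fst p v < D" "snd p v < D" "fst p (right L v) < D" "snd p (up L v) < D"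
  using assms torus_shift[OF assms(2)] by (auto simp: configs_def PiE_iff)

lemma config_less: "j \<in> configs (torus L) d \<Longrightarrow> v \<in> torus L \<Longrightarrow> j v < d"
  by (auto simp: configs_def PiE_iff)

lemma site_amp_measurable:
  assumes "p \<in> bonds" "j \<in> configs (torus L) d" "v \<in> torus L"
  shows "site_amp L d \<phi> p j v \<in> borel_measurable \<mu>"
  unfolding site_amp_def[abs_def]
  using assms bond_less[OF assms(1,3)] config_less[OF assms(2,3)] by (intro measurable_site_tensor)

lemma site_amp_bound:
  assumes "p \<in> bonds" "j \<in> configs (torus L) d" "v \<in> torus L" "u \<in> unitary_group (legs D d)"
  shows "cmod (site_amp L d \<phi> p j v u) \<le> (\<Sum>k<d. cmod (\<phi> k))"
  unfolding site_amp_def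
  using assms bond_less[OF assms(1,3)] config_less[OF assms(2,3)] by (intro site_tensor_bound)

sublocale ens: product_prob_space "\<lambda>_ :: site. \<mu>" "torus L"
  by unfold_locales

text \<open>Independence of the sites. Entries of unitary matrices are bounded, which gives
  integrability of every factor.\<close>

lemma prod_site_amp2:
  assumes "p \<in> bonds" "q \<in> bonds" "j \<in> configs (torus L) d" "k \<in> configs (torus L) d"
  defines "F \<equiv> \<lambda>v u. site_amp L d \<phi> p j v u * cnj (site_amp L d \<phi> q k v u)"
  shows "integrable ensemble (\<lambda>U. \<Prod>v\<in>torus L. F v (U v))"
    "(\<integral>U. (\<Prod>v\<in>torus L. F v (U v)) \<partial>ensemble) = (\<Prod>v\<in>torus L. \<integral>u. F v u \<partial>\<mu>)"
proof -
  let ?B = "\<Sum>k<d. cmod (\<phi> k)"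
  have B: "?B \<ge> 0" by (intro sum_nonneg) auto
  have int: "integrable \<mu> (F v)" if "v \<in> torus L" for v
    unfolding F_def using assms that B
    by (intro integrable_bounded[where B = "?B * ?B"] borel_measurable_times borel_measurable_cnj site_amp_measurable)
      (auto simp: norm_mult intro!: mult_mono site_amp_bound)
  show "integrable ensemble (\<lambda>U. \<Prod>v\<in>torus L. F v (U v))"
    using int by (intro ens.product_integrable_prod) auto
  show "(\<integral>U. (\<Prod>v\<in>torus L. F v (U v)) \<partial>ensemble) = (\<Prod>v\<in>torus L. \<integral>u. F v u \<partial>\<mu>)"
    using int by (intro ens.product_integral_prod) auto
qed

lemma prod_site_amp4:
  assumes "p\<^sub>1 \<in> bonds" "p\<^sub>2 \<in> bonds" "p\<^sub>3 \<in> bonds" "p\<^sub>4 \<in> bonds"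
    and "j\<^sub>1 \<in> configs (torus L) d" "j\<^sub>2 \<in> configs (torus L) d" "j\<^sub>3 \<in> configs (torus L) d" "j\<^sub>4 \<in> configs (torus L) d"
  defines "F \<equiv> \<lambda>v u. site_amp L d \<phi> p\<^sub>1 j\<^sub>1 v u * site_amp L d \<phi> p\<^sub>2 j\<^sub>2 v u *
    cnj (site_amp L d \<phi> p\<^sub>3 j\<^sub>3 v u) * cnj (site_amp L d \<phi> p\<^sub>4 j\<^sub>4 v u)"
  shows "integrable ensemble (\<lambda>U. \<Prod>v\<in>torus L. F v (U v))"
    "(\<integral>U. (\<Prod>v\<in>torus L. F v (U v)) \<partial>ensemble) = (\<Prod>v\<in>torus L. \<integral>u. F v u \<partial>\<mu>)"
proof -
  let ?B = "\<Sum>k<d. cmod (\<phi> k)"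
  have B: "?B \<ge> 0" by (intro sum_nonneg) auto
  have int: "integrable \<mu> (F v)" if "v \<in> torus L" for v
    unfolding F_def using assms that B
    by (intro integrable_bounded[where B = "?B * ?B * ?B * ?B"] borel_measurable_times borel_measurable_cnj site_amp_measurable)
      (auto simp: norm_mult intro!: mult_mono site_amp_bound mult_nonneg_nonneg)
  show "integrable ensemble (\<lambda>U. \<Prod>v\<in>torus L. F v (U v))"
    using int by (intro ens.product_integrable_prod) auto
  show "(\<integral>U. (\<Prod>v\<in>torus L. F v (U v)) \<partial>ensemble) = (\<Prod>v\<in>torus L. \<integral>u. F v u \<partial>\<mu>)"
    using int by (intro ens.product_integral_prod) auto
qed

lemma tn_state_prod2:
  "tn_state L D d \<phi> U j * cnj (tn_state L D d \<phi> U k) =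
    (\<Sum>p\<in>bonds. \<Sum>q\<in>bonds. \<Prod>v\<in>torus L. site_amp L d \<phi> p j v (U v) * cnj (site_amp L d \<phi> q k v (U v)))"
  by (simp add: tn_state_eq sum_product prod.distrib)

lemma tn_state_prod4:
  "tn_state L D d \<phi> U j\<^sub>1 * tn_state L D d \<phi> U j\<^sub>2 * cnj (tn_state L D d \<phi> U j\<^sub>3) * cnj (tn_state L D d \<phi> U j\<^sub>4) =
    (\<Sum>p\<^sub>1\<in>bonds. \<Sum>p\<^sub>2\<in>bonds. \<Sum>p\<^sub>3\<in>bonds. \<Sum>p\<^sub>4\<in>bonds. \<Prod>v\<in>torus L.
      site_amp L d \<phi> p\<^sub>1 j\<^sub>1 v (U v) * site_amp L d \<phi> p\<^sub>2 j\<^sub>2 v (U v) *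
      cnj (site_amp L d \<phi> p\<^sub>3 j\<^sub>3 v (U v)) * cnj (site_amp L d \<phi> p\<^sub>4 j\<^sub>4 v (U v)))"
  by (simp only: tn_state_eq cnj_sum cnj_prod sum_product4 prod.distrib)

lemma integrable_state2:
  assumes "j \<in> configs (torus L) d" "k \<in> configs (torus L) d"
  shows "integrable ensemble (\<lambda>U. tn_state L D d \<phi> U j * cnj (tn_state L D d \<phi> U k))"
  unfolding tn_state_prod2 using assms by (intro Bochner_Integration.integrable_sum prod_site_amp2(1))

lemma integrable_state4:
  assumes "j\<^sub>1 \<in> configs (torus L) d" "j\<^sub>2 \<in> configs (torus L) d" "j\<^sub>3 \<in> configs (torus L) d" "j\<^sub>4 \<in> configs (torus L) d"
  shows "integrable ensemble (\<lambda>U. tn_state L D d \<phi> U j\<^sub>1 * tn_state L D d \<phi> U j\<^sub>2 *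
    cnj (tn_state L D d \<phi> U j\<^sub>3) * cnj (tn_state L D d \<phi> U j\<^sub>4))"
  unfolding tn_state_prod4 using assms by (intro Bochner_Integration.integrable_sum prod_site_amp4(1))

text \<open>\<open>\<sigma> v\<close> and \<open>\<tau> v\<close> are the row and column
  permutations of the site \<open>v\<close>. A bond joins the column side of one site to the row
  side of the neighbour that its last two bond indices point to, hence the overlaps of
  \<open>\<tau>\<close> with shifted \<open>\<sigma>\<close>.\<close>

lemma expectation_state4:
  assumes j: "j\<^sub>1 \<in> configs (torus L) d" "j\<^sub>2 \<in> configs (torus L) d" "j\<^sub>3 \<in> configs (torus L) d" "j\<^sub>4 \<in> configs (torus L) d"
  shows "(\<integral>U. tn_state L D d \<phi> U j\<^sub>1 * tn_state L D d \<phi> U j\<^sub>2 *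
      cnj (tn_state L D d \<phi> U j\<^sub>3) * cnj (tn_state L D d \<phi> U j\<^sub>4) \<partial>ensemble) =
    (\<Sum>\<sigma>\<in>torus L \<rightarrow>\<^sub>E UNIV. \<Sum>\<tau>\<in>torus L \<rightarrow>\<^sub>E UNIV.
      (\<Prod>v\<in>torus L. of_real (weingarten (real (D * D * d)) (\<sigma> v = \<tau> v)) *
        of_bool (paired (\<tau> v) (j\<^sub>1 v) (j\<^sub>2 v) (j\<^sub>3 v) (j\<^sub>4 v))) *
      ((\<Prod>v\<in>torus L. of_real (overlap D (\<sigma> (right L v)) (\<tau> v))) *
       (\<Prod>v\<in>torus L. of_real (overlap D (\<sigma> (up L v)) (\<tau> v)))))" (is "?l = ?r")
proof -
  let ?w = "\<lambda>\<sigma> \<tau> v. of_real (weingarten (real (D * D * d)) (\<sigma> v = \<tau> v)) *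
        (of_bool (paired (\<tau> v) (j\<^sub>1 v) (j\<^sub>2 v) (j\<^sub>3 v) (j\<^sub>4 v)) :: complex)"
  let ?f = "\<lambda>r \<sigma> \<tau> a b c e v. of_bool (paired (\<sigma> v) (a v) (b v) (c v) (e v)) *
        (of_bool (paired (\<tau> v) (a (r v)) (b (r v)) (c (r v)) (e (r v))) :: complex)"
  let ?R = "right L" and ?U = "up L"
  let ?S = "torus L \<rightarrow>\<^sub>E (UNIV :: bool set)"
  have "?l = (\<Sum>p\<^sub>1\<in>bonds. \<Sum>p\<^sub>2\<in>bonds. \<Sum>p\<^sub>3\<in>bonds. \<Sum>p\<^sub>4\<in>bonds. \<Prod>v\<in>torus L. \<integral>u.
      site_amp L d \<phi> p\<^sub>1 j\<^sub>1 v u * site_amp L d \<phi> p\<^sub>2 j\<^sub>2 v u *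
      cnj (site_amp L d \<phi> p\<^sub>3 j\<^sub>3 v u) * cnj (site_amp L d \<phi> p\<^sub>4 j\<^sub>4 v u) \<partial>\<mu>)"
    unfolding tn_state_prod4
    using integral_sum4[of bonds bonds bonds bonds ensemble "\<lambda>p\<^sub>1 p\<^sub>2 p\<^sub>3 p\<^sub>4 U. \<Prod>v\<in>torus L.
      site_amp L d \<phi> p\<^sub>1 j\<^sub>1 v (U v) * site_amp L d \<phi> p\<^sub>2 j\<^sub>2 v (U v) *
      cnj (site_amp L d \<phi> p\<^sub>3 j\<^sub>3 v (U v)) * cnj (site_amp L d \<phi> p\<^sub>4 j\<^sub>4 v (U v))" "\<lambda>_ _ _ _. 1"]
      prod_site_amp4[OF _ _ _ _ j]
    by (simp only: mult_1_left cong: sum.cong)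
  also have "\<dots> = (\<Sum>p\<^sub>1\<in>bonds. \<Sum>p\<^sub>2\<in>bonds. \<Sum>p\<^sub>3\<in>bonds. \<Sum>p\<^sub>4\<in>bonds. \<Prod>v\<in>torus L.
      \<Sum>s\<in>UNIV. \<Sum>t\<in>UNIV. ?w (\<lambda>_. s) (\<lambda>_. t) v *
        ?f ?R (\<lambda>_. s) (\<lambda>_. t) (fst p\<^sub>1) (fst p\<^sub>2) (fst p\<^sub>3) (fst p\<^sub>4) v *
        ?f ?U (\<lambda>_. s) (\<lambda>_. t) (snd p\<^sub>1) (snd p\<^sub>2) (snd p\<^sub>3) (snd p\<^sub>4) v)"
    unfolding site_amp_def
    by (intro sum.cong prod.cong refl site_moment bond_less config_less j)
  also have "\<dots> = (\<Sum>p\<^sub>1\<in>bonds. \<Sum>p\<^sub>2\<in>bonds. \<Sum>p\<^sub>3\<in>bonds. \<Sum>p\<^sub>4\<in>bonds. \<Sum>\<sigma>\<in>?S. \<Sum>\<tau>\<in>?S.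
      (\<Prod>v\<in>torus L. ?w \<sigma> \<tau> v) *
      ((\<Prod>v\<in>torus L. ?f ?R \<sigma> \<tau> (fst p\<^sub>1) (fst p\<^sub>2) (fst p\<^sub>3) (fst p\<^sub>4) v) *
       (\<Prod>v\<in>torus L. ?f ?U \<sigma> \<tau> (snd p\<^sub>1) (snd p\<^sub>2) (snd p\<^sub>3) (snd p\<^sub>4) v)))"
    \<comment> \<open>The product over sites of local sums over \<open>s\<close> and
      \<open>t\<close> becomes a sum over global configurations \<open>\<sigma>\<close> and
      \<open>\<tau>\<close>; only then can the bond sums be moved inside.\<close>
    by (subst prod_sum_bool2) (simp_all only: finite_torus prod.distrib mult.assoc)
  also have "\<dots> = (\<Sum>\<sigma>\<in>?S. \<Sum>\<tau>\<in>?S. \<Sum>p\<^sub>1\<in>bonds. \<Sum>p\<^sub>2\<in>bonds. \<Sum>p\<^sub>3\<in>bonds. \<Sum>p\<^sub>4\<in>bonds.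
      (\<Prod>v\<in>torus L. ?w \<sigma> \<tau> v) *
      ((\<Prod>v\<in>torus L. ?f ?R \<sigma> \<tau> (fst p\<^sub>1) (fst p\<^sub>2) (fst p\<^sub>3) (fst p\<^sub>4) v) *
       (\<Prod>v\<in>torus L. ?f ?U \<sigma> \<tau> (snd p\<^sub>1) (snd p\<^sub>2) (snd p\<^sub>3) (snd p\<^sub>4) v)))"
    by (simp only: sum.swap[of _ ?S bonds])
  also have "\<dots> = ?r"
    by (simp only: sum_distrib_left[symmetric]
      sum_pairs4[of "\<lambda>a b c e. \<Prod>v\<in>torus L. ?f ?R \<sigma> \<tau> a b c e v" "\<lambda>a b c e. \<Prod>v\<in>torus L. ?f ?U \<sigma> \<tau> a b c e v" for \<sigma> \<tau>]
      bond_sum[OF finite_torus bij_right] bond_sum[OF finite_torus bij_up])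
  finally show ?thesis .
qed

definition replica_sum :: "site set \<Rightarrow> real" where
  "replica_sum A = (\<Sum>\<sigma>\<in>torus L \<rightarrow>\<^sub>E UNIV. \<Prod>v\<in>torus L. site_weight D d (v \<in> A) (\<sigma> v) (\<sigma> (right L v)) (\<sigma> (up L v)))"

lemma purity_eq:
  assumes "A \<subseteq> torus L"
  shows "purity (configs A d) (reduced_density L D d \<phi> A U) =
    (\<Sum>j\<in>configs (torus L) d. \<Sum>k\<in>configs (torus L) d.
      tn_state L D d \<phi> U j * tn_state L D d \<phi> U k *
      cnj (tn_state L D d \<phi> U (exchange (torus L) A j k)) * cnj (tn_state L D d \<phi> U (exchange (torus L) A k j)))"
  unfolding reduced_density_def using assms by (intro purity_reduced_op) auto

lemma integrable_purity:
  assumes "A \<subseteq> torus L"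
  shows "integrable ensemble (\<lambda>U. purity (configs A d) (reduced_density L D d \<phi> A U))"
  unfolding purity_eq[OF assms]
  by (intro Bochner_Integration.integrable_sum integrable_state4 exchange_in)

lemma expectation_purity:
  assumes "A \<subseteq> torus L"
  shows "(\<integral>U. purity (configs A d) (reduced_density L D d \<phi> A U) \<partial>ensemble) = of_real (replica_sum A)"
proof -
  let ?S = "torus L \<rightarrow>\<^sub>E (UNIV :: bool set)" and ?C = "configs (torus L) d" and ?E = "exchange (torus L) A"
  let ?wg = "\<lambda>\<sigma> \<tau> v. complex_of_real (weingarten (real (D * D * d)) (\<sigma> v = \<tau> v))"
  let ?ph = "\<lambda>\<tau> j k v. of_bool (paired (\<tau> v) (j v) (k v) (?E j k v) (?E k j v)) :: complex"
  let ?bd = "\<lambda>\<sigma> \<tau>. (\<Prod>v\<in>torus L. complex_of_real (overlap D (\<sigma> (right L v)) (\<tau> v))) *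
       (\<Prod>v\<in>torus L. complex_of_real (overlap D (\<sigma> (up L v)) (\<tau> v)))"
  have phys: "(\<Sum>j\<in>?C. \<Sum>k\<in>?C. \<Prod>v\<in>torus L. ?ph \<tau> j k v) =
      (\<Prod>v\<in>torus L. complex_of_real (overlap d (v \<notin> A) (\<tau> v)))" for \<tau>
  proof -
    have "(\<Sum>j\<in>?C. \<Sum>k\<in>?C. \<Prod>v\<in>torus L. ?ph \<tau> j k v) = (\<Sum>j\<in>?C. \<Sum>k\<in>?C. \<Prod>v\<in>torus L.
        of_bool (paired (\<tau> v) (j v) (k v) (if v \<in> A then k v else j v) (if v \<in> A then j v else k v)))"
      by (intro sum.cong prod.cong refl) (simp add: exchange_def)
    also have "\<dots> = (\<Prod>v\<in>torus L. \<Sum>j<d. \<Sum>k<d. of_bool (paired (\<tau> v) j k (if v \<in> A then k else j) (if v \<in> A then j else k)))"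
      unfolding configs_def by (simp only: prod_sum_PiE finite_torus finite_lessThan)
    finally show ?thesis by (simp only: sum_paired_exchange)
  qed
  have "(\<integral>U. purity (configs A d) (reduced_density L D d \<phi> A U) \<partial>ensemble) =
      (\<Sum>j\<in>?C. \<Sum>k\<in>?C. \<integral>U. tn_state L D d \<phi> U j * tn_state L D d \<phi> U k *
      cnj (tn_state L D d \<phi> U (?E j k)) * cnj (tn_state L D d \<phi> U (?E k j)) \<partial>ensemble)"
    unfolding purity_eq[OF assms]
    using integral_sum2[of ?C ?C ensemble "\<lambda>j k U. tn_state L D d \<phi> U j * tn_state L D d \<phi> U k *
      cnj (tn_state L D d \<phi> U (?E j k)) * cnj (tn_state L D d \<phi> U (?E k j))" "\<lambda>_ _. 1"]
      integrable_state4 exchange_in by (simp only: mult_1_left)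
  also have "\<dots> = (\<Sum>j\<in>?C. \<Sum>k\<in>?C. \<Sum>\<sigma>\<in>?S. \<Sum>\<tau>\<in>?S.
      (\<Prod>v\<in>torus L. ?wg \<sigma> \<tau> v * ?ph \<tau> j k v) * ?bd \<sigma> \<tau>)"
    by (intro sum.cong refl expectation_state4 exchange_in)
  also have "\<dots> = (\<Sum>\<sigma>\<in>?S. \<Sum>\<tau>\<in>?S. \<Sum>j\<in>?C. \<Sum>k\<in>?C.
      (\<Prod>v\<in>torus L. ?wg \<sigma> \<tau> v * ?ph \<tau> j k v) * ?bd \<sigma> \<tau>)"
    by (simp only: sum.swap[of _ ?S ?C])
  also have "\<dots> = (\<Sum>\<sigma>\<in>?S. \<Sum>\<tau>\<in>?S. (\<Prod>v\<in>torus L. ?wg \<sigma> \<tau> v) *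
      (\<Prod>v\<in>torus L. complex_of_real (overlap d (v \<notin> A) (\<tau> v))) * ?bd \<sigma> \<tau>)"
    by (simp only: prod.distrib sum_distrib_left[symmetric] sum_distrib_right[symmetric] phys)
  also have "\<dots> = (\<Sum>\<sigma>\<in>?S. \<Sum>\<tau>\<in>?S. \<Prod>v\<in>torus L. complex_of_real (weingarten (real (D * D * d)) (\<sigma> v = \<tau> v) *
      overlap d (v \<notin> A) (\<tau> v) * overlap D (\<sigma> (right L v)) (\<tau> v) * overlap D (\<sigma> (up L v)) (\<tau> v)))"
    by (simp only: of_real_mult prod.distrib mult.assoc)
  \<comment> \<open>For fixed \<open>\<sigma>\<close> no factor contains \<open>\<tau>\<close> at
    two different sites, so the sum over \<open>\<tau>\<close> is done site by site and produces
    \<open>site_weight\<close>.\<close>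
  also have "\<dots> = (\<Sum>\<sigma>\<in>?S. \<Prod>v\<in>torus L. complex_of_real
      (site_weight D d (v \<in> A) (\<sigma> v) (\<sigma> (right L v)) (\<sigma> (up L v))))"
    unfolding site_weight_def of_real_sum by (intro sum.cong refl prod_sum_PiE[symmetric]) auto
  also have "\<dots> = of_real (replica_sum A)" by (simp add: replica_sum_def)
  finally show ?thesis .
qed

definition sq_norm :: "(site \<Rightarrow> site_op) \<Rightarrow> real" where
  "sq_norm U = (\<Sum>j\<in>configs (torus L) d. (cmod (tn_state L D d \<phi> U j))\<^sup>2)"

lemma sq_norm_eq: "complex_of_real (sq_norm U) = (\<Sum>j\<in>configs (torus L) d. tn_state L D d \<phi> U j * cnj (tn_state L D d \<phi> U j))"
  by (simp add: sq_norm_def complex_norm_square del: of_real_power)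

text \<open>For the empty region the reduced matrix is 1 by 1 and its entry is the squared norm.
  Thus \<open>expectation_purity\<close> also yields the second moment of the squared norm.\<close>

lemma sq_norm_sq: "complex_of_real ((sq_norm U)\<^sup>2) = purity (configs {} d) (reduced_density L D d \<phi> {} U)"
proof -
  have "exchange (torus L) {} j k = j" if "j \<in> configs (torus L) d" for j k
    using that by (auto simp: exchange_def configs_def PiE_iff extensional_def fun_eq_iff)
  then show ?thesis
    by (simp add: purity_eq sq_norm_eq power2_eq_square sum_product mult_ac)
qed

lemma integrable_norm2: "integrable ensemble sq_norm"
proof -
  have "integrable ensemble (\<lambda>U. complex_of_real (sq_norm U))"
    unfolding sq_norm_eq by (intro Bochner_Integration.integrable_sum integrable_state2)
  then have "integrable ensemble (\<lambda>U. Re (complex_of_real (sq_norm U)))" by (rule integrable_Re)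
  then show ?thesis by simp
qed

text \<open>First moments force the two bond configurations to coincide. With N sites, each of the
  d^N basis vectors receives D^(2N) terms equal to (D^2 d)^(-N).\<close>

lemma expectation_norm2: "(\<integral>U. sq_norm U \<partial>ensemble) = 1"
proof -
  let ?n = "complex_of_nat (D * D * d)"
  have n: "?n \<noteq> 0" using card_I card_legs by (metis of_nat_eq_0_iff not_numeral_le_zero)
  have state: "(\<integral>U. tn_state L D d \<phi> U j * cnj (tn_state L D d \<phi> U j) \<partial>ensemble) = 1 / of_nat d ^ card (torus L)"
    if j: "j \<in> configs (torus L) d" for j
  proof -
    have "(\<integral>U. tn_state L D d \<phi> U j * cnj (tn_state L D d \<phi> U j) \<partial>ensemble) =
        (\<Sum>p\<in>bonds. \<Sum>q\<in>bonds. \<Prod>v\<in>torus L. \<integral>u. site_amp L d \<phi> p j v u * cnj (site_amp L d \<phi> q j v u) \<partial>\<mu>)"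
      unfolding tn_state_prod2
      using integral_sum2[of bonds bonds ensemble "\<lambda>p q U. \<Prod>v\<in>torus L.
        site_amp L d \<phi> p j v (U v) * cnj (site_amp L d \<phi> q j v (U v))" "\<lambda>_ _. 1"]
        prod_site_amp2[OF _ _ j j] by (simp only: mult_1_left cong: sum.cong)
    also have "\<dots> = (\<Sum>p\<in>bonds. \<Sum>q\<in>bonds. if p = q then (1 / ?n) ^ card (torus L) else 0)"
    proof (intro sum.cong refl)
      fix p q assume pq: "p \<in> bonds" "q \<in> bonds"
      have "(\<Prod>v\<in>torus L. \<integral>u. site_amp L d \<phi> p j v u * cnj (site_amp L d \<phi> q j v u) \<partial>\<mu>) =
          (\<Prod>v\<in>torus L. if fst p v = fst q v \<and> snd p v = snd q v \<and>
            fst p (right L v) = fst q (right L v) \<and> snd p (up L v) = snd q (up L v) then 1 / ?n else 0)"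
        unfolding site_amp_def using pq j
        by (intro prod.cong refl site_moment1 bond_less config_less)
      also have "\<dots> = (if p = q then (1 / ?n) ^ card (torus L) else 0)"
      proof (cases "p = q")
        case False
        have "\<exists>v\<in>torus L. fst p v \<noteq> fst q v \<or> snd p v \<noteq> snd q v"
        proof (rule ccontr)
          assume "\<not> ?thesis"
          then have eq: "fst p v = fst q v" "snd p v = snd q v" if "v \<in> torus L" for v
            using that by blast+
          have in_PiE: "fst r \<in> torus L \<rightarrow>\<^sub>E {..<D}" "snd r \<in> torus L \<rightarrow>\<^sub>E {..<D}" if "r \<in> bonds" for r
            using that by (simp_all add: configs_def mem_Times_iff)
          have "fst p = fst q" "snd p = snd q"
            by (rule PiE_ext[OF in_PiE(1)[OF pq(1)] in_PiE(1)[OF pq(2)] eq(1)],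
                assumption, rule PiE_ext[OF in_PiE(2)[OF pq(1)] in_PiE(2)[OF pq(2)] eq(2)])
          then show False using False by (simp add: prod_eq_iff)
        qed
        then show ?thesis using False by (auto intro!: prod_zero)
      qed simp
      finally show "(\<Prod>v\<in>torus L. \<integral>u. site_amp L d \<phi> p j v u * cnj (site_amp L d \<phi> q j v u) \<partial>\<mu>) =
        (if p = q then (1 / ?n) ^ card (torus L) else 0)" .
    qed
    also have "\<dots> = of_nat (card bonds) * (1 / ?n) ^ card (torus L)"
      by (simp add: sum.delta)
    also have "of_nat (card bonds) = (complex_of_nat (D * D)) ^ card (torus L)"
      by (simp add: card_cartesian_product card_configs power_mult_distrib)
    also have "complex_of_nat (D * D) ^ card (torus L) * (1 / ?n) ^ card (torus L) = 1 / of_nat d ^ card (torus L)"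
    proof -
      have "complex_of_nat (D * D) ^ card (torus L) * (1 / ?n) ^ card (torus L) =
          (complex_of_nat (D * D) * (1 / ?n)) ^ card (torus L)"
        by (rule power_mult_distrib[symmetric])
      also have "complex_of_nat (D * D) * (1 / ?n) = 1 / of_nat d" using n by simp
      finally show ?thesis by (simp only: power_one_over)
    qed
    finally show ?thesis .
  qed
  have "complex_of_real (\<integral>U. sq_norm U \<partial>ensemble) = (\<integral>U. complex_of_real (sq_norm U) \<partial>ensemble)"
    by simp
  also have "\<dots> = (\<Sum>j\<in>configs (torus L) d. \<integral>U. tn_state L D d \<phi> U j * cnj (tn_state L D d \<phi> U j) \<partial>ensemble)"
    unfolding sq_norm_eq by (intro Bochner_Integration.integral_sum integrable_state2)
  also have "\<dots> = 1"
    using n by (simp add: state card_configs)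
  finally show ?thesis by (metis of_real_eq_1_iff)
qed

end

subsection \<open>Bounding the partition function\<close>

lemma sum_PiE_insert:
  assumes "x \<notin> S"
  shows "(\<Sum>s\<in>PiE (insert x S) X. F s) = (\<Sum>s\<in>PiE S X. \<Sum>y\<in>X x. F (s(x := y)))"
proof -
  have "(\<Sum>s\<in>PiE (insert x S) X. F s) = (\<Sum>(y, s)\<in>X x \<times> PiE S X. F (s(x := y)))"
    unfolding PiE_insert_eq
    by (subst sum.reindex[OF inj_combinator[OF assms]]) (simp add: case_prod_unfold)
  also have "\<dots> = (\<Sum>s\<in>PiE S X. \<Sum>y\<in>X x. F (s(x := y)))"
    by (subst sum.cartesian_product[symmetric], rule sum.swap)
  finally show ?thesis .
qed

fun kernel :: "'a set \<Rightarrow> (nat \<Rightarrow> 'a \<Rightarrow> 'a \<Rightarrow> real) \<Rightarrow> nat \<Rightarrow> 'a \<Rightarrow> 'a \<Rightarrow> real" where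
  "kernel X f 0 R S = of_bool (R = S)"
| "kernel X f (Suc n) R S = (\<Sum>T\<in>X. kernel X f n R T * f n T S)"

text \<open>The factor \<open>g\<close> on the endpoints is arbitrary so that the induction can
  absorb the last step into it; later it carries the step that closes a cycle.\<close>

lemma sum_paths:
  assumes "finite X"
  shows "(\<Sum>s\<in>{..n} \<rightarrow>\<^sub>E X. (\<Prod>k<n. f k (s k) (s (Suc k))) * g (s 0) (s n)) =
    (\<Sum>R\<in>X. \<Sum>S\<in>X. kernel X f n R S * g R S)"
proof (induction n arbitrary: g)
  case 0
  have "(\<Sum>s\<in>{..0::nat} \<rightarrow>\<^sub>E X. g (s 0) (s 0)) = (\<Sum>S\<in>X. g S S)"
    unfolding atMost_0 using sum_PiE_insert[of 0 "{}" "\<lambda>s. g (s 0) (s 0)" "\<lambda>_. X"] by simp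
  also have "\<dots> = (\<Sum>R\<in>X. \<Sum>S\<in>X. if R = S then g R S else 0)"
    using assms by (simp add: sum.delta)
  also have "\<dots> = (\<Sum>R\<in>X. \<Sum>S\<in>X. kernel X f 0 R S * g R S)"
    by (intro sum.cong refl) auto
  finally show ?case by simp
next
  case (Suc n)
  have "(\<Sum>s\<in>{..Suc n} \<rightarrow>\<^sub>E X. (\<Prod>k<Suc n. f k (s k) (s (Suc k))) * g (s 0) (s (Suc n))) =
      (\<Sum>s\<in>{..n} \<rightarrow>\<^sub>E X. \<Sum>S\<in>X. (\<Prod>k<n. f k (s k) (s (Suc k))) * f n (s n) S * g (s 0) S)"
    by (simp add: atMost_Suc sum_PiE_insert)
  also have "\<dots> = (\<Sum>s\<in>{..n} \<rightarrow>\<^sub>E X. (\<Prod>k<n. f k (s k) (s (Suc k))) *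
      (\<Sum>S\<in>X. f n (s n) S * g (s 0) S))"
    by (simp add: sum_distrib_left mult.assoc)
  also have "\<dots> = (\<Sum>R\<in>X. \<Sum>T\<in>X. kernel X f n R T * (\<Sum>S\<in>X. f n T S * g R S))"
    by (rule Suc.IH)
  also have "\<dots> = (\<Sum>R\<in>X. \<Sum>T\<in>X. \<Sum>S\<in>X. kernel X f n R T * f n T S * g R S)"
    by (simp add: sum_distrib_left mult.assoc)
  also have "\<dots> = (\<Sum>R\<in>X. \<Sum>S\<in>X. \<Sum>T\<in>X. kernel X f n R T * f n T S * g R S)"
    by (intro sum.cong refl sum.swap)
  also have "\<dots> = (\<Sum>R\<in>X. \<Sum>S\<in>X. kernel X f (Suc n) R S * g R S)"
    by (simp add: sum_distrib_right)
  finally show ?case .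
qed

lemma sum_cyclic_paths:
  assumes "finite X" and "L > 0"
  shows "(\<Sum>s\<in>{..<L} \<rightarrow>\<^sub>E X. \<Prod>k<L. f k (s k) (s (Suc k mod L))) = (\<Sum>S\<in>X. kernel X f L S S)"
proof -
  obtain n where n: "L = Suc n" using assms(2) by (cases L) auto
  have "(\<Sum>s\<in>{..<L} \<rightarrow>\<^sub>E X. \<Prod>k<L. f k (s k) (s (Suc k mod L))) =
      (\<Sum>s\<in>{..n} \<rightarrow>\<^sub>E X. (\<Prod>k<n. f k (s k) (s (Suc k))) * f n (s n) (s 0))"
  proof (intro sum.cong)
    show "{..<L} \<rightarrow>\<^sub>E X = {..n} \<rightarrow>\<^sub>E X" by (simp add: n lessThan_Suc_atMost)
  qed (simp add: n)
  also have "\<dots> = (\<Sum>R\<in>X. \<Sum>S\<in>X. kernel X f n R S * f n S R)"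
    using assms(1) by (rule sum_paths[where g = "\<lambda>R S. f n S R"])
  finally show ?thesis by (simp add: n)
qed

lemma kernel_nonneg:
  assumes "\<And>k R S. f k R S \<ge> 0"
  shows "kernel X f n R S \<ge> 0"
  by (induction n arbitrary: S) (auto intro!: sum_nonneg mult_nonneg_nonneg assms)

text \<open>The supermartingale estimate for time-dependent kernels. It is applied with
  \<open>h k S\<close> an upper bound for the weight of reaching the desired final state from
  \<open>S\<close> at time \<open>k\<close>.\<close>

lemma kernel_superharmonic:
  assumes "finite X" "\<And>k R S. f k R S \<ge> 0" "R \<in> X"
    and "\<And>k T. k < n \<Longrightarrow> T \<in> X \<Longrightarrow> (\<Sum>S\<in>X. f k T S * h (Suc k) S) \<le> h k T"
  shows "(\<Sum>S\<in>X. kernel X f n R S * h n S) \<le> h 0 R"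
  using assms(4)
proof (induction n)
  case 0
  have "(\<Sum>S\<in>X. kernel X f 0 R S * h 0 S) = (\<Sum>S\<in>X. if R = S then h 0 S else 0)"
    by (intro sum.cong) auto
  then show ?case using assms(1,3) by simp
next
  case (Suc n)
  have "(\<Sum>S\<in>X. kernel X f (Suc n) R S * h (Suc n) S) =
      (\<Sum>T\<in>X. \<Sum>S\<in>X. kernel X f n R T * (f n T S * h (Suc n) S))"
    by (subst sum.swap) (simp add: sum_distrib_right mult.assoc)
  also have "\<dots> = (\<Sum>T\<in>X. kernel X f n R T * (\<Sum>S\<in>X. f n T S * h (Suc n) S))"
    by (simp add: sum_distrib_left)
  also have "\<dots> \<le> (\<Sum>T\<in>X. kernel X f n R T * h n T)"
    using Suc.prems kernel_nonneg[of f, OF assms(2)] by (intro sum_mono mult_left_mono) auto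
  also have "\<dots> \<le> h 0 R" using Suc by simp
  finally show ?case .
qed

text \<open>The properties of the site weights that the transfer argument uses. In
  \<open>w a s x y\<close> the flag \<open>a\<close> marks the region, \<open>s\<close> is the new
  spin and \<open>x\<close>, \<open>y\<close> are its neighbours in the previous layer.
  \<open>p\<close> is the weight of an identity and \<open>r\<close> that of creating a swap inside
  the region next to identities; \<open>m\<close> bounds the local sum at a domain end, and
  \<open>q\<close> the local sum outside the region near a swap.\<close>

locale wall_weights =
  fixes w :: "bool \<Rightarrow> bool \<Rightarrow> bool \<Rightarrow> bool \<Rightarrow> real" and p r m q :: real
  assumes w_nonneg: "w a s x y \<ge> 0"
    and w_out_False: "w False False True True = 0"
    and w_out_True: "w False True True True = 1"
    and w_in_True: "w True True True True = p"
    and w_in_False: "w True False True True = r"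
    and row_le_1: "w a True x y + w a False x y \<le> 1"
    and row_mixed: "x \<noteq> y \<Longrightarrow> w a True x y + w a False x y \<le> m"
    and row_out: "\<not> (x \<and> y) \<Longrightarrow> w False True x y + w False False x y \<le> q"
begin

lemma p_nonneg: "p \<ge> 0" and r_nonneg: "r \<ge> 0" and p_r: "p + r \<le> 1"
  using w_nonneg[of True True True True] w_nonneg[of True False True True] row_le_1[of True True True]
  by (simp_all add: w_in_True w_in_False)

lemma q_nonneg: "q \<ge> 0"
  using row_out[of True False] w_nonneg[of False True True False] w_nonneg[of False False True False]
  by simp

section \<open>Transfer between layers around a region\<close>

context
  fixes L K :: nat and B :: "(nat \<times> nat) set" and x\<^sub>0 :: nat
  assumes L: "L \<ge> 2" and B: "B \<subseteq> {..<K} \<times> {..<L}" and K: "K \<le> L"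
    and x0: "x\<^sub>0 < L" "\<And>k. (k, x\<^sub>0) \<notin> B"
begin

abbreviation rows :: "(nat \<Rightarrow> bool) set" where "rows \<equiv> {..<L} \<rightarrow>\<^sub>E UNIV"

text \<open>A step is weighted by the sites of the layer it creates: \<open>(k, x) \<in> B\<close>
  means that site \<open>x\<close> of layer \<open>k + 1\<close> belongs to the region.\<close>

definition step_weight :: "nat \<Rightarrow> (nat \<Rightarrow> bool) \<Rightarrow> (nat \<Rightarrow> bool) \<Rightarrow> real" where
  "step_weight k T S = (\<Prod>x<L. w ((k, x) \<in> B) (S x) (T x) (T (Suc x mod L)))"

definition row :: "nat \<Rightarrow> (nat \<Rightarrow> bool) \<Rightarrow> nat \<Rightarrow> real" where
  "row k T x = w ((k, x) \<in> B) True (T x) (T (Suc x mod L)) + w ((k, x) \<in> B) False (T x) (T (Suc x mod L))"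

definition vac :: "nat \<Rightarrow> bool" where "vac = (\<lambda>x\<in>{..<L}. True)"
definition full :: "nat \<Rightarrow> bool" where "full = (\<lambda>x\<in>{..<L}. False)"

lemma finite_X: "finite rows" by (intro finite_PiE) auto

lemma card_X: "card rows = 2 ^ L" by (simp add: card_PiE)

lemma vac_in: "vac \<in> rows" by (auto simp: vac_def)

lemma vac_neq_full: "vac \<noteq> full"
  using L by (auto simp: vac_def full_def fun_eq_iff intro!: exI[of _ 0])

lemma step_weight_nonneg: "step_weight k T S \<ge> 0"
  unfolding step_weight_def by (intro prod_nonneg) (simp add: w_nonneg)

lemma sum_step_weight: "(\<Sum>S\<in>rows. step_weight k T S) = (\<Prod>x<L. row k T x)"
  unfolding step_weight_def row_def
  by (subst prod_sum_PiE[symmetric, where f = "\<lambda>x b. w ((k, x) \<in> B) b (T x) (T (Suc x mod L))"])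
     (auto simp: UNIV_bool add.commute)

lemma row_nonneg: "row k T x \<ge> 0" and row_le: "row k T x \<le> 1"
  by (simp_all add: row_def w_nonneg row_le_1)

lemma sum_step_weight_le_1: "(\<Sum>S\<in>rows. step_weight k T S) \<le> 1"
  unfolding sum_step_weight by (intro prod_le_1) (simp add: row_nonneg row_le)

lemma sum_step_weight_two:
  assumes "x < L" "y < L" "x \<noteq> y" "row k T x \<le> c" "row k T y \<le> c"
  shows "(\<Sum>S\<in>rows. step_weight k T S) \<le> c\<^sup>2"
proof -
  have "c \<ge> 0" using assms(4) row_nonneg[of k T x] by linarith
  have "(\<Prod>x<L. row k T x) = row k T x * (row k T y * (\<Prod>z\<in>{..<L} - {x} - {y}. row k T z))"
    using assms by (simp add: prod.remove[symmetric])
  also have "\<dots> \<le> c * (c * 1)"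
    using assms \<open>c \<ge> 0\<close> by (intro mult_mono prod_le_1 mult_nonneg_nonneg prod_nonneg ballI)
      (auto simp: row_nonneg row_le)
  finally show ?thesis by (simp add: sum_step_weight power2_eq_square)
qed

lemma ex_step:
  assumes "x < L" "P x" "y < L" "\<not> P y"
  shows "\<exists>z<L. P z \<and> \<not> P (Suc z mod L)"
proof (rule ccontr)
  assume "\<not> ?thesis"
  then have step: "P (Suc z mod L)" if "z < L" "P z" for z using that by blast
  have "P ((x + n) mod L)" for n
  proof (induction n)
    case (Suc n)
    then show ?case using step[of "(x + n) mod L"] L by (simp add: mod_Suc_eq)
  qed (use assms in simp)
  \<comment> \<open>Walking \<open>y + L - x\<close> steps around the cycle leads from
    \<open>x\<close> to \<open>y\<close>; adding \<open>L\<close> keeps the subtraction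
    exact.\<close>
  from this[of "y + L - x"] show False using assms by simp
qed

lemma neq_vac: "T \<in> rows \<Longrightarrow> T \<noteq> vac \<Longrightarrow> \<exists>x<L. \<not> T x"
  by (rule ccontr) (auto simp: vac_def PiE_def extensional_def fun_eq_iff split: if_splits)

lemma neq_full: "T \<in> rows \<Longrightarrow> T \<noteq> full \<Longrightarrow> \<exists>x<L. T x"
  by (rule ccontr) (auto simp: full_def PiE_def extensional_def fun_eq_iff split: if_splits)

text \<open>Going around the cycle, a mixed row changes at least once in each direction. The two
  changes sit at different positions and contribute a factor \<open>m\<close> each.\<close>

lemma sum_step_weight_mixed:
  assumes "T \<in> rows" "T \<noteq> vac" "T \<noteq> full"
  shows "(\<Sum>S\<in>rows. step_weight k T S) \<le> m\<^sup>2"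
proof -
  obtain x y where xy: "x < L" "T x" "y < L" "\<not> T y"
    using neq_vac neq_full assms by blast
  obtain z where z: "z < L" "T z" "\<not> T (Suc z mod L)" using ex_step[of x T y] xy by blast
  obtain z' where z': "z' < L" "\<not> T z'" "T (Suc z' mod L)" using ex_step[of y "\<lambda>x. \<not> T x" x] xy by blast
  show ?thesis using z z' by (intro sum_step_weight_two[of z z']) (auto simp: row_def intro!: row_mixed)
qed

text \<open>A swap at \<open>y\<close> is a neighbour of two sites of the next layer,
  \<open>y\<close> and its cyclic predecessor, hence the square.\<close>

lemma sum_step_weight_out:
  assumes "T \<in> rows" "T \<noteq> vac" "k \<ge> K"
  shows "(\<Sum>S\<in>rows. step_weight k T S) \<le> q\<^sup>2"
proof -
  obtain y where y: "y < L" "\<not> T y" using neq_vac assms by blast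
  define x where "x = (y + L - 1) mod L"
  have x: "x < L" "Suc x mod L = y" "x \<noteq> y"
    using y L by (auto simp: x_def mod_Suc_eq mod_if)
  have "(k, z) \<notin> B" for z using B assms(3) by auto
  then show ?thesis using x y by (intro sum_step_weight_two[of x y]) (auto simp: row_def intro!: row_out)
qed

lemma step_weight_vac_out:
  assumes "S \<in> rows" "S \<noteq> vac" "k \<ge> K"
  shows "step_weight k vac S = 0"
proof -
  obtain y where y: "y < L" "\<not> S y" using neq_vac assms by blast
  have "(k, y) \<notin> B" using B assms(3) by auto
  then show ?thesis using y L unfolding step_weight_def
    by (intro prod_zero) (auto simp: vac_def w_out_False intro!: bexI[of _ y])
qed

definition layer :: "nat \<Rightarrow> nat set" where "layer k = {x. (k, x) \<in> B}"

lemma layer: "layer k \<subseteq> {..<L}" "finite (layer k)"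
proof -
  show "layer k \<subseteq> {..<L}" using B by (auto simp: layer_def)
  then show "finite (layer k)" by (rule finite_subset) simp
qed

lemma prod_layer: "(\<Prod>x<L. if (k, x) \<in> B then c else 1) = c ^ card (layer k)" for c :: real
proof -
  have "{..<L} \<inter> {x. (k, x) \<in> B} = layer k" using layer(1) by (auto simp: layer_def)
  then show ?thesis by (simp add: prod.If_cases)
qed

lemma step_weight_vac_vac: "step_weight k vac vac = p ^ card (layer k)"
proof -
  have "step_weight k vac vac = (\<Prod>x<L. if (k, x) \<in> B then p else 1)"
    unfolding step_weight_def using L by (intro prod.cong) (auto simp: vac_def w_in_True w_out_True)
  then show ?thesis by (simp add: prod_layer)
qed

lemma sum_step_weight_vac: "(\<Sum>S\<in>rows. step_weight k vac S) = (p + r) ^ card (layer k)"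
proof -
  have "(\<Sum>S\<in>rows. step_weight k vac S) = (\<Prod>x<L. if (k, x) \<in> B then p + r else 1)"
    unfolding sum_step_weight using L
    by (intro prod.cong) (auto simp: row_def vac_def w_in_True w_out_True w_in_False w_out_False)
  then show ?thesis by (simp add: prod_layer)
qed

text \<open>The row \<open>full\<close> has no domain ends and so escapes
  \<open>sum_step_weight_mixed\<close>. It cannot directly follow \<open>vac\<close>, since at
  \<open>x\<^sub>0\<close> a swap would be created outside the region.\<close>

lemma step_weight_vac_full: "step_weight k vac full = 0"
  using x0 L unfolding step_weight_def
  by (intro prod_zero) (auto simp: vac_def full_def w_out_False intro!: bexI[of _ x\<^sub>0])

text \<open>A union bound: for a layer with \<open>n\<close> sites in the region, subtracting
  \<open>p ^ n\<close> on the left leaves the weight of creating at least one swap.\<close>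

lemma power_add_le: "(p + r) ^ n \<le> p ^ n + real n * r"
proof (induction n)
  case (Suc n)
  have "(p + r) ^ Suc n \<le> p * (p ^ n + real n * r) + r * 1"
    using Suc p_nonneg r_nonneg p_r
    unfolding power_Suc distrib_right by (intro add_mono mult_left_mono power_le_one) auto
  also have "\<dots> \<le> p ^ Suc n + real n * r + r"
    using mult_left_le_one_le[of "real n * r" p] p_nonneg r_nonneg p_r by (simp add: algebra_simps)
  finally show ?case by (simp add: algebra_simps)
qed simp

lemma sum_step_weight_leave_vac: "(\<Sum>S\<in>rows - {vac}. step_weight k vac S) \<le> real (card (layer k)) * r"
  using sum_step_weight_vac[of k] power_add_le[of "card (layer k)"]
  by (simp add: sum_diff1 finite_X vac_in step_weight_vac_vac)

definition rest :: "nat \<Rightarrow> nat" where "rest k = (\<Sum>i\<in>{k..<L}. card (layer i))"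

lemma rest_0: "rest 0 = card B"
proof -
  have "B = Sigma {..<L} layer" using B K by (auto simp: layer_def)
  then have "card B = card (Sigma {..<L} layer)" by simp
  also have "\<dots> = rest 0" by (subst card_SigmaI) (auto simp: rest_def layer atLeast0LessThan)
  finally show ?thesis by simp
qed

text \<open>The first departure from \<open>vac\<close> costs \<open>r\<close> for each site of the
  region and leads to a mixed row, whose next step costs \<open>m\<^sup>2\<close>. From then on row
  sums at most 1 suffice.\<close>

lemma kernel_vac: "kernel rows step_weight L vac vac \<le> p ^ card B + real (card B) * r * m\<^sup>2"
proof -
  \<comment> \<open>\<open>h k S\<close> bounds the weight of ending in \<open>vac\<close> at time
    \<open>L\<close> from \<open>S\<close> at time \<open>k\<close>; the value 0 at
    \<open>k = L\<close> discards other endpoints. Truncation at 1 allows sums against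
    \<open>h\<close> to be bounded by plain row sums.\<close>
  define h where "h k S = (if S = vac then min 1 (p ^ rest k + real (rest k) * r * m\<^sup>2)
    else if k = L then 0 else if S = full then 1 else min 1 (m\<^sup>2))" for k S
  have h1: "0 \<le> h k S" "h k S \<le> 1" for k S
    using p_nonneg r_nonneg by (auto simp: h_def)
  have rest_L: "rest L = 0" by (simp add: rest_def)
  have "kernel rows step_weight L vac vac \<le> (\<Sum>S\<in>rows. kernel rows step_weight L vac S * h L S)"
    using member_le_sum[of vac rows "\<lambda>S. kernel rows step_weight L vac S * h L S"] h1 finite_X vac_in
    by (auto simp: h_def rest_L kernel_nonneg step_weight_nonneg)
  also have "\<dots> \<le> h 0 vac"
  proof (rule kernel_superharmonic[OF finite_X step_weight_nonneg vac_in])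
    fix k T assume k: "k < L" and T: "T \<in> rows"
    have le: "(\<Sum>S\<in>rows. step_weight k T S * h (Suc k) S) \<le> (\<Sum>S\<in>rows. step_weight k T S)"
      using h1 step_weight_nonneg by (intro sum_mono) (simp add: mult_left_le)
    consider "T = vac" | "T = full" | "T \<noteq> vac" "T \<noteq> full" by blast
    then show "(\<Sum>S\<in>rows. step_weight k T S * h (Suc k) S) \<le> h k T"
    proof cases
      case 1
      have rk: "rest k = card (layer k) + rest (Suc k)"
        unfolding rest_def using k by (simp add: sum.atLeast_Suc_lessThan)
      have "(\<Sum>S\<in>rows. step_weight k vac S * h (Suc k) S) =
          step_weight k vac vac * h (Suc k) vac + (\<Sum>S\<in>rows-{vac}. step_weight k vac S * h (Suc k) S)"
        using finite_X vac_in by (simp add: sum.remove)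
      also have "\<dots> \<le> p ^ card (layer k) * (p ^ rest (Suc k) + real (rest (Suc k)) * r * m\<^sup>2) +
          (\<Sum>S\<in>rows-{vac}. step_weight k vac S * m\<^sup>2)"
      proof (intro add_mono sum_mono)
        show "step_weight k vac vac * h (Suc k) vac \<le>
          p ^ card (layer k) * (p ^ rest (Suc k) + real (rest (Suc k)) * r * m\<^sup>2)"
          using p_nonneg by (simp add: step_weight_vac_vac h_def mult_left_mono)
        fix S assume "S \<in> rows - {vac}"
        then show "step_weight k vac S * h (Suc k) S \<le> step_weight k vac S * m\<^sup>2"
          using step_weight_nonneg step_weight_vac_full by (cases "S = full") (auto simp: h_def intro!: mult_left_mono)
      qed
      also have "(\<Sum>S\<in>rows-{vac}. step_weight k vac S * m\<^sup>2) = (\<Sum>S\<in>rows-{vac}. step_weight k vac S) * m\<^sup>2"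
        by (simp add: sum_distrib_right)
      also have "\<dots> \<le> real (card (layer k)) * r * m\<^sup>2"
        by (intro mult_right_mono sum_step_weight_leave_vac) simp
      also have "p ^ card (layer k) * (p ^ rest (Suc k) + real (rest (Suc k)) * r * m\<^sup>2) \<le>
          p ^ rest k + 1 * (real (rest (Suc k)) * r * m\<^sup>2)"
        unfolding rk power_add distrib_left
        using p_nonneg p_r r_nonneg by (intro add_left_mono mult_right_mono power_le_one) auto
      finally have "(\<Sum>S\<in>rows. step_weight k vac S * h (Suc k) S) \<le> p ^ rest k + real (rest k) * r * m\<^sup>2"
        by (simp add: rk algebra_simps)
      with le 1 sum_step_weight_le_1[of k vac] show ?thesis by (simp add: h_def)
    next
      case 2
      then show ?thesis using le sum_step_weight_le_1[of k T] k vac_neq_full by (simp add: h_def)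
    next
      case 3
      then show ?thesis using le sum_step_weight_mixed[OF T 3, of k] sum_step_weight_le_1[of k T] k by (simp add: h_def)
    qed
  qed
  also have "\<dots> \<le> p ^ card B + real (card B) * r * m\<^sup>2" by (simp add: h_def rest_0)
  finally show ?thesis .
qed

text \<open>From layer \<open>K\<close> on, \<open>vac\<close> can only be followed by
  \<open>vac\<close>. A loop based at another row therefore avoids \<open>vac\<close> there, and
  each of the \<open>L - K\<close> steps beyond the region costs \<open>q\<^sup>2\<close>.\<close>

lemma kernel_neq_vac:
  assumes "S \<in> rows" "S \<noteq> vac" "q \<le> 1"
  shows "kernel rows step_weight L S S \<le> q ^ (2 * (L - K))"
proof -
  \<comment> \<open>The value 0 records that \<open>S\<close> is unreachable from \<open>vac\<close>
    beyond layer \<open>K\<close>. Earlier steps are bounded by 1 only, so the exponent stays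
    constant up to \<open>K\<close>.\<close>
  define h where "h k R = (if R = vac \<and> k \<ge> K then 0 else q ^ (2 * (L - max k K)))" for k R
  have h0: "0 \<le> h k R" for k R using q_nonneg by (auto simp: h_def)
  have "kernel rows step_weight L S S \<le> (\<Sum>R\<in>rows. kernel rows step_weight L S R * h L R)"
    using member_le_sum[of S rows "\<lambda>R. kernel rows step_weight L S R * h L R"] h0 finite_X assms K
    by (auto simp: h_def kernel_nonneg step_weight_nonneg max_absorb1)
  also have "\<dots> \<le> h 0 S"
  proof (rule kernel_superharmonic[OF finite_X step_weight_nonneg assms(1)])
    fix k T assume k: "k < L" and T: "T \<in> rows"
    have "(\<Sum>R\<in>rows. step_weight k T R * h (Suc k) R) \<le> (\<Sum>R\<in>rows. step_weight k T R * q ^ (2 * (L - max (Suc k) K)))"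
      using q_nonneg step_weight_nonneg by (intro sum_mono mult_left_mono) (auto simp: h_def)
    then have le: "(\<Sum>R\<in>rows. step_weight k T R * h (Suc k) R) \<le> (\<Sum>R\<in>rows. step_weight k T R) * q ^ (2 * (L - max (Suc k) K))"
      by (simp add: sum_distrib_right)
    show "(\<Sum>R\<in>rows. step_weight k T R * h (Suc k) R) \<le> h k T"
    proof (cases "k < K")
      case True
      have "(\<Sum>R\<in>rows. step_weight k T R) * q ^ (2 * (L - max (Suc k) K)) \<le> 1 * q ^ (2 * (L - max (Suc k) K))"
        using q_nonneg by (intro mult_right_mono sum_step_weight_le_1) auto
      with le True show ?thesis by (simp add: h_def max_absorb2)
    next
      case False
      show ?thesis
      proof (cases "T = vac")
        case True
        have "(\<Sum>R\<in>rows. step_weight k T R * h (Suc k) R) = 0"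
          using False True step_weight_vac_out[of _ k] by (intro sum.neutral) (auto simp: h_def)
        then show ?thesis using h0 by simp
      next
        case nvac: False
        have "(\<Sum>R\<in>rows. step_weight k T R) * q ^ (2 * (L - max (Suc k) K)) \<le> q\<^sup>2 * q ^ (2 * (L - max (Suc k) K))"
          using q_nonneg sum_step_weight_out[OF T nvac, of k] False by (intro mult_right_mono) auto
        also have "\<dots> = q ^ (2 * (L - k))"
        proof -
          have "L - k = Suc (L - Suc k)" using k by simp
          then show ?thesis using False by (simp add: power_add[symmetric] max_absorb1)
        qed
        finally show ?thesis using le nvac False by (simp add: h_def max_absorb1)
      qed
    qed
  qed
  also have "\<dots> \<le> q ^ (2 * (L - K))" using q_nonneg by (simp add: h_def)
  finally show ?thesis .
qed

lemma partition_function_le: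
  assumes "q \<le> 1"
  shows "(\<Sum>s\<in>{..<L} \<rightarrow>\<^sub>E rows. \<Prod>k<L. \<Prod>x<L.
      w ((k, x) \<in> B) (s (Suc k mod L) x) (s k x) (s k (Suc x mod L))) \<le>
    p ^ card B + real (card B) * r * m\<^sup>2 + 2 ^ L * q ^ (2 * (L - K))"
proof -
  have "(\<Sum>s\<in>{..<L} \<rightarrow>\<^sub>E rows. \<Prod>k<L. \<Prod>x<L.
      w ((k, x) \<in> B) (s (Suc k mod L) x) (s k x) (s k (Suc x mod L))) = (\<Sum>S\<in>rows. kernel rows step_weight L S S)"
    using sum_cyclic_paths[OF finite_X, of L step_weight] L by (simp add: step_weight_def)
  also have "\<dots> = kernel rows step_weight L vac vac + (\<Sum>S\<in>rows-{vac}. kernel rows step_weight L S S)"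
    using finite_X vac_in by (simp add: sum.remove)
  also have "(\<Sum>S\<in>rows-{vac}. kernel rows step_weight L S S) \<le> real (card (rows - {vac})) * q ^ (2 * (L - K))"
    using kernel_neq_vac assms by (intro sum_bounded_above) auto
  also have "\<dots> \<le> 2 ^ L * q ^ (2 * (L - K))"
  proof (intro mult_right_mono)
    have "card (rows - {vac}) \<le> 2 ^ L" using card_X by (metis card_Diff1_le)
    then show "real (card (rows - {vac})) \<le> 2 ^ L"
      by (metis of_nat_le_iff of_nat_numeral of_nat_power)
  qed (use q_nonneg in simp)
  finally show ?thesis using kernel_vac by simp
qed

end
end

subsection \<open>Domain walls on the torus\<close>

text \<open>Exchanging identity and swap everywhere preserves overlaps and Weingarten values and
  interchanges the two ways of closing a physical leg. So the weights in the region follow from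
  those outside.\<close>

lemma site_weight_flip: "site_weight D d True s x y = site_weight D d False (\<not> s) (\<not> x) (\<not> y)"
  by (auto simp: site_weight_def UNIV_bool overlap_def)

section \<open>Explicit site weights and their bounds\<close>

context
  fixes D d :: nat
  assumes D: "D \<ge> 3" and d: "d \<ge> 2"
begin

definition gap :: real where "gap = (real D ^ 2 * real d) ^ 2 - 1"

lemma D_sq: "real D ^ 2 \<ge> 9"
  using D power_mono[of 3 "real D" 2] by simp

lemma gap_pos: "gap > 0"
proof -
  have "1 * 1 < real D ^ 2 * real d" using D D_sq d by (intro mult_strict_mono) auto
  then show ?thesis unfolding gap_def using one_less_power[of "real D ^ 2 * real d" 2] by simp
qed

text \<open>The values 1 and 0 have a structural reason: next to identities the three overlaps
  multiply to the overlap in dimension \<open>D * D * d\<close>, and the Weingarten matrix inverts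
  this Gram matrix. The other values come from expanding the two terms.\<close>

lemma site_weight_eqs:
  "site_weight D d False True True True = 1"
  "site_weight D d False False True True = 0"
  "site_weight D d False True False False = real D ^ 2 * (real d ^ 2 - 1) / gap"
  "site_weight D d False False False False = real d * (real D ^ 4 - 1) / gap"
  "x \<noteq> y \<Longrightarrow> site_weight D d False True x y = real D * (real d ^ 2 * real D ^ 2 - 1) / gap"
  "x \<noteq> y \<Longrightarrow> site_weight D d False False x y = real d * real D * (real D ^ 2 - 1) / gap"
proof -
  have n: "real D * real D * real d = real D ^ 2 * real d" by (simp add: power2_eq_square)
  have w: "weingarten (real D * real D * real d) True = 1 / gap"
    "weingarten (real D * real D * real d) False = - 1 / (real D ^ 2 * real d * gap)"
    by (simp_all only: weingarten_def n gap_def if_True if_False)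
  have pos: "real D \<noteq> 0" "real d \<noteq> 0" "gap \<noteq> 0" using D d gap_pos by auto
  have expand: "site_weight D d False s x y =
      (if s then 1 / gap else - 1 / (real D ^ 2 * real d * gap)) * real d ^ 2 *
        (if x then real D ^ 2 else real D) * (if y then real D ^ 2 else real D) +
      (if s then - 1 / (real D ^ 2 * real d * gap) else 1 / gap) * real d *
        (if x then real D else real D ^ 2) * (if y then real D else real D ^ 2)" for s x y
    by (cases s; cases x; cases y) (simp_all add: site_weight_def sum_UNIV_bool overlap_def w)
  have "site_weight D d False True True True = ((real D ^ 2 * real d) ^ 2 - 1) / gap"
    using pos by (simp add: expand field_simps eval_nat_numeral)
  then show "site_weight D d False True True True = 1" using pos by (simp add: gap_def)
  show "site_weight D d False False True True = 0"
    using pos by (simp add: expand field_simps eval_nat_numeral)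
  show "site_weight D d False True False False = real D ^ 2 * (real d ^ 2 - 1) / gap"
    using pos by (simp add: expand field_simps eval_nat_numeral)
  show "site_weight D d False False False False = real d * (real D ^ 4 - 1) / gap"
    using pos by (simp add: expand field_simps eval_nat_numeral)
  show "x \<noteq> y \<Longrightarrow> site_weight D d False True x y = real D * (real d ^ 2 * real D ^ 2 - 1) / gap"
    using pos by (cases x; cases y; simp add: expand field_simps eval_nat_numeral)
  show "x \<noteq> y \<Longrightarrow> site_weight D d False False x y = real d * real D * (real D ^ 2 - 1) / gap"
    using pos by (cases x; cases y; simp add: expand field_simps eval_nat_numeral)
qed

text \<open>The first three right-hand sides are the quotients of the leading terms; the corrections
  have the right sign. The last bound gives away a factor 1 / d to match the third.\<close>

lemma site_weight_bounds:
  "real d * (real D ^ 4 - 1) / gap \<le> 1 / real d"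
  "real D ^ 2 * (real d ^ 2 - 1) / gap \<le> 1 / real D ^ 2"
  "real D * (real d ^ 2 * real D ^ 2 - 1) / gap \<le> 1 / real D"
  "real d * real D * (real D ^ 2 - 1) / gap \<le> 1 / real D"
proof -
  have pos: "real D > 0" "real d > 0" "gap > 0" using D d gap_pos by auto
  have dd: "1 \<le> real d * real d" and DD: "1 \<le> real D * real D"
    using D d mult_mono[of 1 "real d" 1 "real d"] mult_mono[of 1 "real D" 1 "real D"] by auto
  have D4: "1 \<le> real D * (real D * (real D * real D))"
    using mult_mono[OF DD DD] by (simp add: mult.assoc)
  have "1 \<le> real d * real D ^ 2"
    using mult_mono[of 1 "real d" 1 "real D * real D"] DD d by (simp add: power2_eq_square)
  note pw = dd DD D4 this
  show "real d * (real D ^ 4 - 1) / gap \<le> 1 / real d"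
    using pos pw by (simp add: divide_simps) (simp add: gap_def algebra_simps eval_nat_numeral)
  show "real D ^ 2 * (real d ^ 2 - 1) / gap \<le> 1 / real D ^ 2"
    using pos pw by (simp add: divide_simps) (simp add: gap_def algebra_simps eval_nat_numeral)
  show "real D * (real d ^ 2 * real D ^ 2 - 1) / gap \<le> 1 / real D"
    using pos pw by (simp add: divide_simps) (simp add: gap_def algebra_simps eval_nat_numeral)
  have "real D ^ 2 * real d * (real D ^ 2 - 1) \<le> (real D ^ 2 * real d) * (real D ^ 2 * real d) - 1"
  proof -
    have "real D ^ 2 * real d * (real D ^ 2 * 1) \<le> real D ^ 2 * real d * (real D ^ 2 * real d)"
      using pos d by (intro mult_left_mono) auto
    then show ?thesis using pw(4) by (simp add: algebra_simps)
  qed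
  then show "real d * real D * (real D ^ 2 - 1) / gap \<le> 1 / real D"
    using pos by (simp add: divide_simps) (simp add: gap_def algebra_simps eval_nat_numeral)
qed

lemma site_weight_nonneg: "site_weight D d a s x y \<ge> 0"
proof -
  have "site_weight D d False s x y \<ge> 0" for s x y
  proof -
    have "0 \<le> real D ^ 2 - 1" "0 \<le> real d ^ 2 - 1" "0 \<le> real D ^ 4 - 1" "0 \<le> real d ^ 2 * real D ^ 2 - 1"
      using D d by (auto intro!: one_le_power mult_ge1_I)
    then show ?thesis using gap_pos
      by (cases s; cases x; cases y) (simp_all add: site_weight_eqs)
  qed
  then show ?thesis by (cases a) (simp_all add: site_weight_flip)
qed

text \<open>The constant 2 / 3 covers both cases outside the region: two swap neighbours give at
  most 1 / 2 + 1 / 9, mixed neighbours at most 2 / D \<le> 2 / 3.\<close>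

lemma site_weight_wall:
  "wall_weights (site_weight D d) (real d * (real D ^ 4 - 1) / gap) (real D ^ 2 * (real d ^ 2 - 1) / gap)
     (2 / real D) (2 / 3)"
proof -
  have inv: "1 / real D \<le> 1 / 3" "1 / real d \<le> 1 / 2" "1 / real D ^ 2 \<le> 1 / 9"
    using D d D_sq by (auto intro!: divide_left_mono)
  have eq: "real D ^ 2 * (real d ^ 2 - 1) / gap + real d * (real D ^ 4 - 1) / gap \<le> 2 / 3"
    using site_weight_bounds(1,2) inv by linarith
  have mixed: "site_weight D d False True x y + site_weight D d False False x y \<le> 2 / real D" if "x \<noteq> y" for x y
    using site_weight_bounds(3,4) that by (simp add: site_weight_eqs)
  have out: "site_weight D d False True x y + site_weight D d False False x y \<le> 2 / 3" if "\<not> (x \<and> y)" for x y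
  proof (cases "x = y")
    case True
    then show ?thesis using that eq by (simp add: site_weight_eqs)
  next
    case False
    then show ?thesis using mixed[OF False] inv by linarith
  qed
  have le1: "site_weight D d False True x y + site_weight D d False False x y \<le> 1" for x y
    using out[of x y] by (cases "x \<and> y") (auto simp: site_weight_eqs)
  show ?thesis
  proof
    show "site_weight D d a True x y + site_weight D d a False x y \<le> 1" for a x y
      using le1[of x y] le1[of "\<not> x" "\<not> y"] by (cases a) (simp_all add: site_weight_flip add.commute)
    show "site_weight D d a True x y + site_weight D d a False x y \<le> 2 / real D" if "x \<noteq> y" for a x y
      using mixed[of x y] mixed[of "\<not> x" "\<not> y"] that by (cases a) (simp_all add: site_weight_flip add.commute)
  qed (use out in \<open>simp_all add: site_weight_nonneg site_weight_eqs site_weight_flip\<close>)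
qed

end

section \<open>Antidiagonal coordinates on the torus\<close>

lemma mod_diff_reflect:
  fixes k L N :: nat
  assumes "k < L" "L \<le> N"
  shows "(N - (N - k) mod L) mod L = k"
proof -
  have "N - k = L * ((N - k) div L) + (N - k) mod L" by simp
  then have "N - (N - k) mod L = k + L * ((N - k) div L)" using assms by linarith
  then show ?thesis using assms by simp
qed

text \<open>
  Layer \<open>k\<close> is an antidiagonal; the right and upper neighbours of a site in layer \<open>k + 1\<close> lie in
  layer \<open>k\<close>. The offset \<open>h\<close> is chosen later such that the block occupies the
  layers \<open>1, \<dots>, 2 * l - 1\<close>.
\<close>

definition layer_site :: "nat \<Rightarrow> nat \<Rightarrow> nat \<Rightarrow> nat \<Rightarrow> site" where
  "layer_site L h k x = (x, (h + 2 * L - x - k) mod L)"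

text \<open>The summand \<open>2 * L\<close> in \<open>layer_site\<close> keeps the natural-number
  subtraction exact for \<open>x < L\<close> and \<open>k \<le> L\<close>. The third equation
  identifies layer \<open>L\<close> with layer 0, closing the layers into a cycle.\<close>

lemma layer_site_neighbours:
  assumes "k < L" "x < L"
  shows "right L (layer_site L h (Suc k) x) = layer_site L h k x"
    and "up L (layer_site L h (Suc k) x) = layer_site L h k (Suc x mod L)"
    and "layer_site L h (Suc k) x = layer_site L h (Suc k mod L) x"
proof -
  have "Suc (h + 2 * L - x - Suc k) = h + 2 * L - x - k" using assms by linarith
  then show "right L (layer_site L h (Suc k) x) = layer_site L h k x"
    by (simp add: right_def layer_site_def mod_Suc_eq)
  show "up L (layer_site L h (Suc k) x) = layer_site L h k (Suc x mod L)"
  proof (cases "Suc x = L")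
    case True
    then have "h + 2 * L - k = (h + 2 * L - x - Suc k) + L" using assms by linarith
    then have "(h + 2 * L - k) mod L = (h + 2 * L - x - Suc k) mod L" by (simp only: mod_add_self2)
    then show ?thesis using True by (simp add: up_def layer_site_def)
  qed (use assms in \<open>simp add: up_def layer_site_def\<close>)
  show "layer_site L h (Suc k) x = layer_site L h (Suc k mod L) x"
  proof (cases "Suc k = L")
    case True
    then have "h + 2 * L - x = (h + 2 * L - x - Suc k) + L" using assms by linarith
    then have "(h + 2 * L - x) mod L = (h + 2 * L - x - Suc k) mod L" by (metis mod_add_self2)
    then show ?thesis using True by (simp add: layer_site_def)
  qed (use assms in \<open>simp add: layer_site_def\<close>)
qed

lemma layer_site_in: "x < L \<Longrightarrow> layer_site L h k x \<in> torus L"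
  by (simp add: layer_site_def torus_def)

text \<open>The layer k is determined by fst v + snd v + k = h modulo L.\<close>

definition layer_of :: "nat \<Rightarrow> nat \<Rightarrow> site \<Rightarrow> nat" where
  "layer_of L h v = (h + 2 * L - fst v - snd v) mod L"

lemma layer_of_layer_site: "k < L \<Longrightarrow> x < L \<Longrightarrow> layer_of L h (layer_site L h k x) = k"
  using mod_diff_reflect[of k L "h + 2 * L - x"] by (simp add: layer_of_def layer_site_def)

lemma layer_site_layer_of: "v \<in> torus L \<Longrightarrow> layer_site L h (layer_of L h v) (fst v) = v"
  using mod_diff_reflect[of "snd v" L "h + 2 * L - fst v"]
  by (cases v) (auto simp: layer_of_def layer_site_def torus_def)

lemma bij_layer_site: "bij_betw (\<lambda>(k, x). layer_site L h (Suc k) x) ({..<L} \<times> {..<L}) (torus L)"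
proof (cases "L = 0")
  case False
  have "inj_on (\<lambda>(k, x). layer_site L h (Suc k) x) ({..<L} \<times> {..<L})"
  proof (rule inj_onI, clarify)
    fix k x k' x' assume lt: "k < L" "x < L" "k' < L" "x' < L"
      and eq: "layer_site L h (Suc k) x = layer_site L h (Suc k') x'"
    then have x: "x = x'" by (simp add: layer_site_def)
    have "Suc k mod L = Suc k' mod L"
      using eq layer_of_layer_site[of "Suc k mod L" L x h] layer_of_layer_site[of "Suc k' mod L" L x' h] lt
        layer_site_neighbours(3)[OF lt(1,2)] layer_site_neighbours(3)[OF lt(3,4)] False by simp
    then show "k = k' \<and> x = x'" using x lt by (auto simp: mod_Suc split: if_splits)
  qed
  moreover have "(\<lambda>(k, x). layer_site L h (Suc k) x) ` ({..<L} \<times> {..<L}) \<subseteq> {..<L} \<times> {..<L}"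
    by (auto simp: layer_site_def)
  ultimately show ?thesis
    unfolding torus_def by (intro bij_betw_imageI endo_inj_surj) auto
qed (simp add: torus_def bij_betw_def)

text \<open>A spin configuration is a closed sequence of rows. The factor of a site in layer
  \<open>Suc k\<close> involves only its own spin and two spins of layer \<open>k\<close>, which
  gives the transfer matrix form.\<close>

lemma torus_sum_layers:
  fixes w :: "bool \<Rightarrow> bool \<Rightarrow> bool \<Rightarrow> bool \<Rightarrow> real"
  shows "(\<Sum>\<sigma>\<in>torus L \<rightarrow>\<^sub>E UNIV. \<Prod>v\<in>torus L. w (v \<in> A) (\<sigma> v) (\<sigma> (right L v)) (\<sigma> (up L v))) =
    (\<Sum>s\<in>{..<L} \<rightarrow>\<^sub>E ({..<L} \<rightarrow>\<^sub>E UNIV). \<Prod>k<L. \<Prod>x<L.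
      w (layer_site L h (Suc k) x \<in> A) (s (Suc k mod L) x) (s k x) (s k (Suc x mod L)))"
proof (rule sum.reindex_bij_witness[where
    j = "\<lambda>\<sigma>. \<lambda>k\<in>{..<L}. \<lambda>x\<in>{..<L}. \<sigma> (layer_site L h k x)" and
    i = "\<lambda>s. \<lambda>v\<in>torus L. s (layer_of L h v) (fst v)"])
  fix \<sigma> :: "site \<Rightarrow> bool" assume \<sigma>: "\<sigma> \<in> torus L \<rightarrow>\<^sub>E UNIV"
  have lay: "layer_of L h v < L" "fst v < L" if "v \<in> torus L" for v
    using that by (auto simp: layer_of_def torus_def)
  show "(\<lambda>v\<in>torus L. (\<lambda>k\<in>{..<L}. \<lambda>x\<in>{..<L}. \<sigma> (layer_site L h k x)) (layer_of L h v) (fst v)) = \<sigma>"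
  proof
    fix v
    show "(\<lambda>v\<in>torus L. (\<lambda>k\<in>{..<L}. \<lambda>x\<in>{..<L}. \<sigma> (layer_site L h k x)) (layer_of L h v) (fst v)) v = \<sigma> v"
    proof (cases "v \<in> torus L")
      case True
      then show ?thesis using lay[OF True] by (simp add: layer_site_layer_of)
    next
      case False
      then show ?thesis using PiE_arb[OF \<sigma>] by simp
    qed
  qed
  show "(\<lambda>k\<in>{..<L}. \<lambda>x\<in>{..<L}. \<sigma> (layer_site L h k x)) \<in> {..<L} \<rightarrow>\<^sub>E {..<L} \<rightarrow>\<^sub>E UNIV"
    by auto
  show "(\<Prod>k<L. \<Prod>x<L. w (layer_site L h (Suc k) x \<in> A)
       ((\<lambda>k\<in>{..<L}. \<lambda>x\<in>{..<L}. \<sigma> (layer_site L h k x)) (Suc k mod L) x)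
       ((\<lambda>k\<in>{..<L}. \<lambda>x\<in>{..<L}. \<sigma> (layer_site L h k x)) k x)
       ((\<lambda>k\<in>{..<L}. \<lambda>x\<in>{..<L}. \<sigma> (layer_site L h k x)) k (Suc x mod L))) =
    (\<Prod>v\<in>torus L. w (v \<in> A) (\<sigma> v) (\<sigma> (right L v)) (\<sigma> (up L v)))" (is "?l = ?r")
  proof -
    have "?r = (\<Prod>(k, x)\<in>{..<L} \<times> {..<L}. (\<lambda>v. w (v \<in> A) (\<sigma> v) (\<sigma> (right L v)) (\<sigma> (up L v))) (layer_site L h (Suc k) x))"
      by (subst prod.reindex_bij_betw[OF bij_layer_site[of L h], symmetric]) (simp add: case_prod_unfold)
    also have "\<dots> = (\<Prod>k<L. \<Prod>x<L. (\<lambda>v. w (v \<in> A) (\<sigma> v) (\<sigma> (right L v)) (\<sigma> (up L v))) (layer_site L h (Suc k) x))"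
      by (rule prod.cartesian_product[symmetric])
    also have "\<dots> = ?l"
    proof (intro prod.cong refl)
      fix k x assume "k \<in> {..<L}" "x \<in> {..<L}"
      then have "k < L" "x < L" "Suc k mod L < L" "Suc x mod L < L" by auto
      then show "w (layer_site L h (Suc k) x \<in> A) (\<sigma> (layer_site L h (Suc k) x))
          (\<sigma> (right L (layer_site L h (Suc k) x))) (\<sigma> (up L (layer_site L h (Suc k) x))) =
        w (layer_site L h (Suc k) x \<in> A)
       ((\<lambda>k\<in>{..<L}. \<lambda>x\<in>{..<L}. \<sigma> (layer_site L h k x)) (Suc k mod L) x)
       ((\<lambda>k\<in>{..<L}. \<lambda>x\<in>{..<L}. \<sigma> (layer_site L h k x)) k x)
       ((\<lambda>k\<in>{..<L}. \<lambda>x\<in>{..<L}. \<sigma> (layer_site L h k x)) k (Suc x mod L))"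
        by (simp add: layer_site_neighbours(1,2) layer_site_neighbours(3)[symmetric])
    qed
    finally show ?thesis by simp
  qed
next
  fix s :: "nat \<Rightarrow> nat \<Rightarrow> bool" assume s: "s \<in> {..<L} \<rightarrow>\<^sub>E {..<L} \<rightarrow>\<^sub>E UNIV"
  show "(\<lambda>k\<in>{..<L}. \<lambda>x\<in>{..<L}. (\<lambda>v\<in>torus L. s (layer_of L h v) (fst v)) (layer_site L h k x)) = s"
  proof
    fix k
    show "(\<lambda>k\<in>{..<L}. \<lambda>x\<in>{..<L}. (\<lambda>v\<in>torus L. s (layer_of L h v) (fst v)) (layer_site L h k x)) k = s k"
    proof (cases "k < L")
      case True
      then have "s k \<in> extensional {..<L}" using s by (auto simp: PiE_iff)
      then show ?thesis using True
        by (auto simp: layer_site_in layer_of_layer_site extensional_def fun_eq_iff)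
          (auto simp: layer_site_def)
    next
      case False
      then show ?thesis using s by (auto simp: PiE_iff extensional_def)
    qed
  qed
qed auto

text \<open>With this offset the block site \<open>(cx + i, cy + j)\<close> satisfies k = 2 l - 2 -
  i - j modulo L, a value from 0 to 2 l - 2. The shift by one matches the convention that step
  \<open>k\<close> creates layer \<open>Suc k\<close>.\<close>

lemma block_layers:
  assumes "l \<ge> 1" "2 * l \<le> L" "k < L" "x < L"
    and "layer_site L (cx + cy + 2 * l - 1) (Suc k) x \<in> block L l (cx, cy)"
  shows "k < 2 * l - 1"
proof -
  let ?h = "cx + cy + 2 * l - 1"
  obtain i j where ij: "i < l" "j < l" and x: "x = (cx + i) mod L"
    and y: "(?h + 2 * L - x - Suc k) mod L = (cy + j) mod L"
    using assms(5) by (auto simp: block_def layer_site_def)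
  have int: "int (?h + 2 * L - x - Suc k) = int cx + int cy + 2 * int l - 2 + 2 * int L - int x - int k"
    using assms by linarith
  have dx: "int L dvd int x - (int cx + int i)"
    unfolding x by (metis mod_eq_dvd_iff mod_mod_trivial of_nat_add of_nat_mod)
  have dy: "int L dvd (int cx + int cy + 2 * int l - 2 + 2 * int L - int x - int k) - (int cy + int j)"
    using y int by (metis mod_eq_dvd_iff of_nat_add of_nat_mod)
  have "int L dvd (int x - (int cx + int i)) +
      ((int cx + int cy + 2 * int l - 2 + 2 * int L - int x - int k) - (int cy + int j)) - 2 * int L"
    by (intro dvd_diff dvd_add dx dy) simp
  also have "\<dots> = (2 * int l - 2 - int i - int j) - int k" by simp
  finally have dvd: "int L dvd (2 * int l - 2 - int i - int j) - int k" .
  \<comment> \<open>Both numbers lie between 0 and L - 1, so their congruence modulo L is an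
    equality.\<close>
  have "\<bar>(2 * int l - 2 - int i - int j) - int k\<bar> < int L" using assms ij by linarith
  then have "(2 * int l - 2 - int i - int j) - int k = 0" using dvd by (metis abs_ge_zero zdvd_not_zless dvd_abs_iff abs_eq_0 order_le_less)
  then show ?thesis using ij assms by linarith
qed

text \<open>The column just past the block serves as the column \<open>x\<^sub>0\<close> missed by
  the region.\<close>

lemma block_column:
  assumes "l \<ge> 1" "l < L" "(x, y) \<in> block L l (cx, cy)"
  shows "x \<noteq> (cx + l) mod L"
proof
  assume eq: "x = (cx + l) mod L"
  obtain i where i: "i < l" "x = (cx + i) mod L" using assms(3) by (auto simp: block_def)
  then have "int L dvd (int cx + int l) - (int cx + int i)"
    using eq by (metis mod_eq_dvd_iff of_nat_add of_nat_mod)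
  then have "int L dvd int l - int i" by simp
  then show False using i assms zdvd_not_zless[of "int l - int i" "int L"] by linarith
qed

text \<open>Admitting any subset of the block covers both the region itself and the empty region
  that describes the norm. The middle term is |A| r m^2 with r \<le> 1 / D^2 and m = 2 / D.\<close>

lemma partition_function_block_le:
  assumes D: "D \<ge> 3" and d: "d \<ge> 2" and l: "l \<ge> 1" and L: "2 * l \<le> L" and A: "A \<subseteq> block L l c" "A \<subseteq> torus L"
  shows "(\<Sum>\<sigma>\<in>torus L \<rightarrow>\<^sub>E UNIV. \<Prod>v\<in>torus L. site_weight D d (v \<in> A) (\<sigma> v) (\<sigma> (right L v)) (\<sigma> (up L v))) \<le>
    (1 / real d) ^ card A + 4 * real (card A) / real D ^ 4 + 2 ^ L * (2 / 3) ^ (2 * (L - (2 * l - 1)))"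
proof -
  obtain cx cy where c: "c = (cx, cy)" by (cases c)
  define h where "h = cx + cy + 2 * l - 1"
  define B where "B = {(k, x). k < L \<and> x < L \<and> layer_site L h (Suc k) x \<in> A}"
  define p where "p = real d * (real D ^ 4 - 1) / gap D d"
  define r where "r = real D ^ 2 * (real d ^ 2 - 1) / gap D d"
  interpret wall_weights "site_weight D d" p r "2 / real D" "2 / 3"
    unfolding p_def r_def by (rule site_weight_wall[OF D d])
  have B_sub: "B \<subseteq> {..<2 * l - 1} \<times> {..<L}"
    using block_layers[OF l L] A by (auto simp: B_def c h_def)
  have x0: "(k, (cx + l) mod L) \<notin> B" for k
    using block_column[of l L _ _ cx cy] A l L by (force simp: B_def c layer_site_def)
  have "bij_betw (\<lambda>(k, x). layer_site L h (Suc k) x) B A"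
  proof (rule bij_betw_subset[OF bij_layer_site[of L h]])
    show "B \<subseteq> {..<L} \<times> {..<L}" by (auto simp: B_def)
    show "(\<lambda>(k, x). layer_site L h (Suc k) x) ` B = A"
    proof
      show "A \<subseteq> (\<lambda>(k, x). layer_site L h (Suc k) x) ` B"
      proof
        fix v assume "v \<in> A"
        then have "v \<in> (\<lambda>(k, x). layer_site L h (Suc k) x) ` ({..<L} \<times> {..<L})"
          using A bij_layer_site[of L h] by (auto simp: bij_betw_def)
        with \<open>v \<in> A\<close> show "v \<in> (\<lambda>(k, x). layer_site L h (Suc k) x) ` B" by (force simp: B_def)
      qed
    qed (auto simp: B_def)
  qed
  then have card: "card B = card A" by (rule bij_betw_same_card)
  have "(\<Sum>\<sigma>\<in>torus L \<rightarrow>\<^sub>E UNIV. \<Prod>v\<in>torus L. site_weight D d (v \<in> A) (\<sigma> v) (\<sigma> (right L v)) (\<sigma> (up L v))) =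
      (\<Sum>s\<in>{..<L} \<rightarrow>\<^sub>E ({..<L} \<rightarrow>\<^sub>E UNIV). \<Prod>k<L. \<Prod>x<L.
        site_weight D d ((k, x) \<in> B) (s (Suc k mod L) x) (s k x) (s k (Suc x mod L)))"
    unfolding torus_sum_layers[where h = h] by (intro sum.cong prod.cong refl) (simp add: B_def)
  also have "\<dots> \<le> p ^ card B + real (card B) * r * (2 / real D)\<^sup>2 + 2 ^ L * (2 / 3) ^ (2 * (L - (2 * l - 1)))"
    using l L x0 B_sub by (intro partition_function_le[of L B "2 * l - 1" "(cx + l) mod L"]) auto
  also have "p ^ card B \<le> (1 / real d) ^ card A"
    unfolding card using site_weight_bounds(1)[OF D d] p_nonneg by (intro power_mono) (auto simp: p_def)
  also have "real (card B) * r * (2 / real D)\<^sup>2 \<le> real (card A) * (1 / real D ^ 2) * (2 / real D)\<^sup>2"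
    unfolding card using site_weight_bounds(2)[OF D d]
    by (intro mult_right_mono mult_left_mono) (auto simp: r_def)
  also have "\<dots> = 4 * real (card A) / real D ^ 4" by (simp add: power_divide eval_nat_numeral mult_ac)
  finally show ?thesis by simp
qed

text \<open>Up to the constant factor (9 / 4)^K the expression is (2 * 4 / 9)^L, with base 8 /
  9.\<close>

lemma tail_small:
  fixes \<delta> :: real
  assumes "\<delta> > 0"
  shows "\<exists>n. \<forall>L\<ge>n. 2 ^ L * (2 / 3) ^ (2 * (L - K)) \<le> \<delta>"
proof -
  obtain n where n: "(8 / 9 :: real) ^ n < (4 / 9) ^ K * \<delta>"
    using real_arch_pow_inv[of "(4 / 9) ^ K * \<delta>" "8 / 9"] assms by auto
  have "2 ^ L * (2 / 3) ^ (2 * (L - K)) \<le> \<delta>" if L: "L \<ge> max n K" for L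
  proof -
    have "(2 / 3) ^ (2 * (L - K)) = ((2 / 3 :: real)\<^sup>2) ^ (L - K)" by (rule power_mult)
    also have "(2 / 3 :: real)\<^sup>2 = 4 / 9" by (simp add: power2_eq_square)
    finally have "(4 / 9) ^ K * (2 ^ L * (2 / 3) ^ (2 * (L - K))) = 2 ^ L * ((4 / 9) ^ K * (4 / 9 :: real) ^ (L - K))"
      by (simp only: mult_ac)
    also have "\<dots> = 2 ^ L * (4 / 9) ^ L" using L by (simp add: power_add[symmetric])
    also have "\<dots> = (8 / 9) ^ L" by (simp add: power_mult_distrib[symmetric])
    also have "\<dots> \<le> (8 / 9) ^ n" using L by (intro power_decreasing) auto
    also have "\<dots> \<le> (4 / 9) ^ K * \<delta>" using n by simp
    finally show ?thesis by (simp add: mult_le_cancel_left)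
  qed
  then show ?thesis by blast
qed

lemma block_subset: "c \<in> torus L \<Longrightarrow> block L l c \<subseteq> torus L"
  by (auto simp: block_def torus_def)

lemma card_block_le: "card (block L l c) \<le> l\<^sup>2"
proof -
  have "card (block L l c) \<le> card ({..<l} \<times> {..<l})"
    unfolding block_def by (cases c) (simp only: case_prod_conv, rule card_image_le, simp)
  then show ?thesis by (simp add: power2_eq_square)
qed

section \<open>From mean values to the probability bound\<close>

context random_network
begin

text \<open>With X the purity, T the squared norm and q = 1 / d^|A|, one has |X - q| \<le> (X - q
  T^2) + q |T^2 - 1|. The first term is nonnegative and has a small mean; the second is controlled
  by the variance of T.\<close>

lemma expectation_purity_deviation_le:
  assumes D: "D \<ge> 3" and d: "d \<ge> 2" and A: "A \<subseteq> torus L"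
    and le_A: "replica_sum A \<le> 1 / real d ^ card A + a / real D ^ 4 + \<delta>" and le_empty: "replica_sum {} \<le> 1 + \<delta>"
    and \<delta>: "\<delta> \<le> 1 / real D ^ 8"
  shows "(\<integral>U. cmod (purity (configs A d) (reduced_density L D d \<phi> A U) - 1 / of_nat d ^ card A) \<partial>ensemble) \<le>
    (a + 4) / real D ^ 4"
proof -
  have total: "measure ensemble (space ensemble) = 1"
    by (intro prob_space.prob_space prob_space_PiM prob_space_axioms)
  let ?P = "\<lambda>U. purity (configs A d) (reduced_density L D d \<phi> A U)"
  let ?X = "\<lambda>U. Re (?P U)"
  define q where "q = 1 / real d ^ card A"
  define M where "M = real D ^ 4"
  have q: "q > 0" "q \<le> 1" using d by (auto simp: q_def divide_simps)
  have M: "M \<ge> 1" using D by (simp add: M_def)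
  have M2: "real D ^ 8 = M * M" by (simp add: M_def power_add[symmetric])
  have P: "?P U \<in> \<real>" "(sq_norm U)\<^sup>2 \<le> real d ^ card A * ?X U" for U
    using purity_real_ge[OF finite_torus A, where d = d and \<psi> = "tn_state L D d \<phi> U"]
    by (simp_all add: reduced_density_def sq_norm_def)
  have int_X: "integrable ensemble ?X" and E_X: "(\<integral>U. ?X U \<partial>ensemble) = replica_sum A"
    using integrable_purity[OF A] expectation_purity[OF A] by (simp_all add: integral_Re)
  have int_T2: "integrable ensemble (\<lambda>U. (sq_norm U)\<^sup>2)" and E_T2: "(\<integral>U. (sq_norm U)\<^sup>2 \<partial>ensemble) = replica_sum {}"
  proof -
    have eq: "(sq_norm U)\<^sup>2 = Re (purity (configs {} d) (reduced_density L D d \<phi> {} U))" for U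
      using sq_norm_sq[of U] by (metis Re_complex_of_real)
    show "integrable ensemble (\<lambda>U. (sq_norm U)\<^sup>2)" "(\<integral>U. (sq_norm U)\<^sup>2 \<partial>ensemble) = replica_sum {}"
      using integrable_purity[of "{}"] expectation_purity[of "{}"] by (simp_all add: eq integral_Re)
  qed
  have sq: "(sq_norm U - 1)\<^sup>2 = (sq_norm U)\<^sup>2 - 2 * sq_norm U + 1" for U
    by (simp add: power2_eq_square algebra_simps)
  have int_S: "integrable ensemble (\<lambda>U. (sq_norm U - 1)\<^sup>2)" and E_S: "(\<integral>U. (sq_norm U - 1)\<^sup>2 \<partial>ensemble) = replica_sum {} - 1"
    using int_T2 integrable_norm2 by (simp_all add: sq E_T2 expectation_norm2 total)
  have Z1: "replica_sum {} \<ge> 1"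
    using E_S Bochner_Integration.integral_nonneg[of ensemble "\<lambda>U. (sq_norm U - 1)\<^sup>2"] by simp
  let ?G = "\<lambda>U. ?X U - q * (sq_norm U)\<^sup>2 + (1 + M) * (sq_norm U - 1)\<^sup>2 + 1 / M"
  have bound: "cmod (?P U - 1 / of_nat d ^ card A) \<le> ?G U" for U
  proof -
    have "?P U - 1 / of_nat d ^ card A = of_real (?X U - q)"
      using P(1)[of U] by (simp add: q_def of_real_Re)
    then have "cmod (?P U - 1 / of_nat d ^ card A) = \<bar>?X U - q\<bar>" by (simp only: norm_of_real)
    moreover have "q * (sq_norm U)\<^sup>2 \<le> ?X U"
      using P(2)[of U] d by (simp add: q_def divide_simps mult.commute)
    moreover have "\<bar>q * ((sq_norm U)\<^sup>2 - 1)\<bar> \<le> (1 + M) * (sq_norm U - 1)\<^sup>2 + 1 / M"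
    proof -
      have "\<bar>q * ((sq_norm U)\<^sup>2 - 1)\<bar> \<le> \<bar>(sq_norm U)\<^sup>2 - 1\<bar>"
        using q by (simp add: abs_mult mult_left_le_one_le)
      also have "\<dots> \<le> (sq_norm U - 1)\<^sup>2 + 2 * \<bar>sq_norm U - 1\<bar>"
      proof -
        have "(sq_norm U)\<^sup>2 - 1 = (sq_norm U - 1)\<^sup>2 + 2 * (sq_norm U - 1)" by (simp add: sq)
        then show ?thesis
          using abs_triangle_ineq[of "(sq_norm U - 1)\<^sup>2" "2 * (sq_norm U - 1)"] by (simp only: abs_mult abs_power2 abs_numeral)
      qed
      \<comment> \<open>The arithmetic-geometric mean inequality with weight M = D^4: the constant
        part 1 / M already has the target order, and the variance, at most D^(-8), can absorb the
        factor M.\<close>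
      also have "2 * \<bar>sq_norm U - 1\<bar> \<le> M * (sq_norm U - 1)\<^sup>2 + 1 / M"
      proof -
        have "0 \<le> (M * \<bar>sq_norm U - 1\<bar> - 1)\<^sup>2 / M" using M by simp
        also have "\<dots> = M * (sq_norm U - 1)\<^sup>2 + 1 / M - 2 * \<bar>sq_norm U - 1\<bar>"
          using M by (simp add: power2_diff power_mult_distrib field_simps) (simp add: power2_eq_square algebra_simps)
        finally show ?thesis by simp
      qed
      finally show ?thesis by (simp add: algebra_simps)
    qed
    ultimately show ?thesis by (simp add: algebra_simps)
  qed
  have "(\<integral>U. cmod (?P U - 1 / of_nat d ^ card A) \<partial>ensemble) \<le> (\<integral>U. ?G U \<partial>ensemble)"
    using integrable_purity[OF A] int_X int_T2 int_S
    by (intro integral_mono bound integrable_norm Bochner_Integration.integrable_diff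
      Bochner_Integration.integrable_add integrable_mult_right) auto
  also have "\<dots> = replica_sum A - q * replica_sum {} + (1 + M) * (replica_sum {} - 1) + 1 / M"
    using int_X int_T2 int_S by (simp add: E_X E_T2 E_S total)
  also have "\<dots> \<le> (q + a / M + 1 / (M * M)) - q * 1 + (1 + M) * (1 / (M * M)) + 1 / M"
  proof (intro add_mono diff_mono mult_left_mono)
    show "replica_sum A \<le> q + a / M + 1 / (M * M)" using le_A \<delta> by (simp add: q_def M_def[symmetric] M2)
    show "replica_sum {} - 1 \<le> 1 / (M * M)" using le_empty \<delta> by (simp add: M2)
  qed (use Z1 q M in auto)
  also have "\<dots> = a / M + 2 / (M * M) + 2 / M" using M by (simp add: field_simps)
  also have "\<dots> \<le> (a + 4) / M" using M by (simp add: field_simps)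
  finally show ?thesis by (simp add: M_def)
qed

lemma purity_deviation_prob:
  assumes "A \<subseteq> torus L" and "\<epsilon> > 0"
    and le: "(\<integral>U. cmod (purity (configs A d) (reduced_density L D d \<phi> A U) - 1 / of_nat d ^ card A) \<partial>ensemble) \<le> B"
  shows "\<P>(U in ensemble. cmod (purity (configs A d) (reduced_density L D d \<phi> A U) - 1 / of_nat d ^ card A) \<ge> \<epsilon>) \<le> B / \<epsilon>"
proof -
  let ?F = "\<lambda>U. cmod (purity (configs A d) (reduced_density L D d \<phi> A U) - 1 / of_nat d ^ card A)"
  have "integrable ensemble ?F" using integrable_purity[OF assms(1)] by auto
  then have "measure ensemble {U \<in> space ensemble. \<epsilon> \<le> ?F U} \<le> (\<integral>U. ?F U \<partial>ensemble) / \<epsilon>"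
    using assms(2) by (intro integral_Markov_inequality_measure[where A = "space ensemble"]) auto
  also have "\<dots> \<le> B / \<epsilon>" using assms by (intro divide_right_mono) auto
  finally show ?thesis .
qed

end

theorem theorem3:
  fixes d l :: nat
  assumes "d \<ge> 2" and "l \<ge> 1"
  shows "\<exists>C::real. \<forall>D::nat. D \<ge> 3 \<longrightarrow>
    (\<exists>L\<^sub>0\<ge>l. \<forall>L\<ge>L\<^sub>0. \<forall>\<mu> \<phi>. \<forall>c\<in>torus L. \<forall>\<epsilon>>0.
       haar_measure (legs D d) \<mu> \<longrightarrow> unit_vector d \<phi> \<longrightarrow>
       (let A = block L l c in
        \<P>(U in \<Pi>\<^sub>M v\<in>torus L. \<mu>.
           cmod (purity (configs A d) (reduced_density L D d \<phi> A U) - 1 / of_nat d ^ card A) \<ge> \<epsilon>)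
        \<le> C * (1 / real D ^ 4) / \<epsilon>))"
proof (intro exI[of _ "4 * (real l)\<^sup>2 + 4"] allI impI)
  fix D :: nat assume D: "D \<ge> 3"
  define t where "t L = (2::real) ^ L * (2 / 3) ^ (2 * (L - (2 * l - 1)))" for L
  \<comment> \<open>The order D^(-8) is required because the variance gets multiplied by 1 + D^4.
    The threshold for \<open>L\<close> thus depends on \<open>D\<close>, while the constant does
    not.\<close>
  obtain n where n: "\<And>L. L \<ge> n \<Longrightarrow> t L \<le> 1 / real D ^ 8"
    using tail_small[of "1 / real D ^ 8" "2 * l - 1"] D unfolding t_def by auto
  show "\<exists>L\<^sub>0\<ge>l. \<forall>L\<ge>L\<^sub>0. \<forall>\<mu> \<phi>. \<forall>c\<in>torus L. \<forall>\<epsilon>>0.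
       haar_measure (legs D d) \<mu> \<longrightarrow> unit_vector d \<phi> \<longrightarrow>
       (let A = block L l c in
        \<P>(U in \<Pi>\<^sub>M v\<in>torus L. \<mu>.
           cmod (purity (configs A d) (reduced_density L D d \<phi> A U) - 1 / of_nat d ^ card A) \<ge> \<epsilon>)
        \<le> (4 * (real l)\<^sup>2 + 4) * (1 / real D ^ 4) / \<epsilon>)"
  proof (rule exI[of _ "max n (2 * l)"], intro conjI allI ballI impI)
    fix L \<mu> \<phi> c and \<epsilon> :: real
    assume L: "L \<ge> max n (2 * l)" and c: "c \<in> torus L" and \<epsilon>: "\<epsilon> > 0"
      and haar: "haar_measure (legs D d) \<mu>" and unit: "unit_vector d \<phi>"
    define A where "A = block L l c"
    have "card (legs D d) \<ge> 2"
    proof -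
      have "1 * 1 * 2 \<le> D * D * d" using D assms(1) by (intro mult_mono) auto
      then show ?thesis by (simp add: legs_def)
    qed
    then interpret random_network D d \<mu> \<phi> L
      by unfold_locales (use haar unit in \<open>auto simp: legs_def\<close>)
    have A: "A \<subseteq> torus L" using c by (simp add: A_def block_subset)
    have card: "real (card A) \<le> (real l)\<^sup>2"
      unfolding A_def using card_block_le[of L l c] by (metis of_nat_le_iff of_nat_power)
    have "replica_sum A \<le> 1 / real d ^ card A + 4 * real (card A) / real D ^ 4 + t L"
      unfolding replica_sum_def t_def
      using partition_function_block_le[OF D assms, of L A c] L A by (simp add: A_def power_one_over)
    moreover have "replica_sum {} \<le> 1 + t L"
      unfolding replica_sum_def t_def using partition_function_block_le[OF D assms, of L "{}" c] L by simp
    ultimately have "(\<integral>U. cmod (purity (configs A d) (reduced_density L D d \<phi> A U) - 1 / of_nat d ^ card A) \<partial>ensemble) \<le>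
        (4 * real (card A) + 4) / real D ^ 4"
      using n[of L] L by (intro expectation_purity_deviation_le D assms A) auto
    \<comment> \<open>In the constant, 4 l^2 stems from swaps created inside the block and 4 from
      the fluctuations of the norm and the tails.\<close>
    also have "\<dots> \<le> (4 * (real l)\<^sup>2 + 4) * (1 / real D ^ 4)"
      using card by (simp add: divide_right_mono)
    finally show "let A = block L l c in
        \<P>(U in \<Pi>\<^sub>M v\<in>torus L. \<mu>.
           cmod (purity (configs A d) (reduced_density L D d \<phi> A U) - 1 / of_nat d ^ card A) \<ge> \<epsilon>)
        \<le> (4 * (real l)\<^sup>2 + 4) * (1 / real D ^ 4) / \<epsilon>"
      unfolding Let_def A_def[symmetric] by (intro purity_deviation_prob A \<epsilon>)
  qed simp
qed

end
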